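(* Let $(M=B\times_f F,g^f,\Pi)$ be an Einstein Poisson warped product space with $Ric=\lambda g^f$, with $\dim B=s_1\geq2$, where $f$ is a Casimir function on $(B,\Pi_B)$. Let $\hat\lambda$ be the constant such that $Ric_F=\hat\lambda g_F$, and suppose $\hat\lambda>0$. Then: (a) if $\lambda>0$, then $f=\sqrt{\lambda/\hat\lambda}$; (b) if $\lambda<0$, then no such warping function $f$ exists.
   Context: Contravariant geometry. Let $(N,\Pi)$ be a Poisson manifold with Poisson bivector field $\Pi$. The anchor map $\sharp_\Pi:T^*N\to TN$ is defined by $\beta(\sharp_\Pi(\alpha))=\Pi(\alpha,\beta)$. The Koszul bracket on 1-forms is $[\alpha,\beta]_\Pi=\mathcal L_{\sharp_\Pi(\alpha)}\beta-\mathcal L_{\sharp_\Pi(\beta)}\alpha-d(\Pi(\alpha,\beta))$. A pseudo-Riemannian metric $\tilde g$ on $N$ induces a metric $g$ on $T^*N$ (its cometric) through the isomorphism $X\mapsto\tilde g(X,\cdot)$. The contravariant Levi-Civita connection of $(\Pi,g)$ is the unique $\mathbb R$-bilinear map $\mathcal D:\Gamma(T^*N)\times\Gamma(T^*N)\to\Gamma(T^*N)$ with $\mathcal D_{u\alpha}\beta=u\mathcal D_\alpha\beta$, $\mathcal D_\alpha(u\beta)=u\mathcal D_\alpha\beta+\sharp_\Pi(\alpha)(u)\beta$ for $u\in C^\infty(N)$, $\mathcal D_\alpha\beta-\mathcal D_\beta\alpha=[\alpha,\beta]_\Pi$, and $\sharp_\Pi(\alpha)(g(\beta,\gamma))=g(\mathcal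 D_\alpha\beta,\gamma)+g(\beta,\mathcal D_\alpha\gamma)$. Its curvature is $\mathcal R(\alpha,\beta)\gamma=\mathcal D_\alpha\mathcal D_\beta\gamma-\mathcal D_\beta\mathcal D_\alpha\gamma-\mathcal D_{[\alpha,\beta]_\Pi}\gamma$. For a local $g$-orthonormal coframe $\{\eta_i\}$ with $\varepsilon_i=g(\eta_i,\eta_i)=\pm1$, the Ricci curvature is $Ric(\alpha,\beta)=\sum_i\varepsilon_i\,g(\mathcal R(\alpha,\eta_i)\eta_i,\beta)$. The triple $(N,g,\Pi)$ is a (pseudo-)Riemannian Poisson manifold if $\mathcal D\Pi=0$, i.e. $\sharp_\Pi(\alpha)(\Pi(\beta,\gamma))-\Pi(\mathcal D_\alpha\beta,\gamma)-\Pi(\beta,\mathcal D_\alpha\gamma)=0$ for all 1-forms $\alpha,\beta,\gamma$. A function $f$ is Casimir if $\sharp_\Pi(df)=0$. Warped products. Let $(B,\tilde g_B)$, $(F,\tilde g_F)$ be pseudo-Riemannian manifolds of positive dimensions with cometrics $g_B,g_F$ and Poisson bivector fields $\Pi_B,\Pi_F$; let $f>0$ be a smooth function on $B$ (the warping function), and let $\pi,\sigma$ be the projections of $B\times F$ onto $B$ and $F$. Put $u^h=u\circ\pi$, $\alpha_1^h=\pi^*\alpha_1$ for functions and 1-forms on $B$, and $w^v=w\circ\sigma$, $\alpha_2^v=\sigma^*\alpha_2$ for functions and 1-forms on $F$. On $M=B\times_fF$ (the manifold $B\times F$) one takes the warped metric $\tilde g^f=\pi^*\tilde g_B+(f^h)^2\sigma^*\tilde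 g_F$, whose cometric $g^f$ satisfies $g^f(\alpha_1^h,\beta_1^h)=g_B(\alpha_1,\beta_1)^h$, $g^f(\alpha_1^h,\beta_2^v)=0$, $g^f(\alpha_2^v,\beta_2^v)=\frac1{(f^h)^2}g_F(\alpha_2,\beta_2)^v$, and the Poisson bivector $\Pi=\Pi_B+\Pi_F$ given by $\Pi(\alpha_1^h,\beta_1^h)=\Pi_B(\alpha_1,\beta_1)^h$, $\Pi(\alpha_1^h,\beta_2^v)=0$, $\Pi(\alpha_2^v,\beta_2^v)=\Pi_F(\alpha_2,\beta_2)^v$. $Ric,Ric_B,Ric_F$ are the Ricci curvatures of $(M,\Pi,g^f)$, $(B,\Pi_B,g_B)$, $(F,\Pi_F,g_F)$. The triple $(M,g^f,\Pi)$ is an Einstein Poisson warped product space if it is a (pseudo-)Riemannian Poisson manifold, $f$ is Casimir on $(B,\Pi_B)$, and $Ric=\lambda g^f$ for a constant $\lambda$; in that case $Ric_F=\hat\lambda g_F$ for a constant $\hat\lambda$. *)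

theory Defs
  imports "HOL-Analysis.Analysis"
begin

section \<open>Smooth maps between Euclidean spaces\<close>

text \<open>Meant for open sets \<open>S\<close> only.\<close>

primrec Ck_on :: "nat \<Rightarrow> ('a::euclidean_space \<Rightarrow> 'b::euclidean_space) \<Rightarrow> 'a set \<Rightarrow> bool" where
  "Ck_on 0 f S \<longleftrightarrow> continuous_on S f"
| "Ck_on (Suc k) f S \<longleftrightarrow>
     (\<forall>x\<in>S. f differentiable (at x)) \<and> (\<forall>v. Ck_on k (\<lambda>x. frechet_derivative f (at x) v) S)"

definition smooth_on :: "'a set \<Rightarrow> ('a::euclidean_space \<Rightarrow> 'b::euclidean_space) \<Rightarrow> bool" where
  "smooth_on S f \<longleftrightarrow> (\<forall>k. Ck_on k f S)"


section \<open>Manifolds\<close>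

text \<open>
  A chart is a pairing \<open>(U, \<phi>)\<close>; only the values of \<open>\<phi>\<close> on \<open>U\<close> matter.  A manifold is a
  whole type \<open>'a\<close> (Hausdorff, second countable) with an atlas modelled on the Euclidean space
  \<open>'e\<close>, so its dimension is \<open>DIM('e)\<close>.  In addition a chart \<open>chart_at p\<close> is singled out around
  every point \<open>p\<close>.  Through this chart the tangent space at \<open>p\<close> is identified with \<open>'e\<close>, and
  the cotangent space with the linear functionals on \<open>'e\<close>.  The choice is used for nothing else:
  smoothness below is always tested in all charts of the atlas.
\<close>

type_synonym ('a, 'e) chart = "'a set \<times> ('a \<Rightarrow> 'e)"

record ('a, 'e) mfd =
  atlas :: "('a, 'e) chart set"
  chart_at :: "'a \<Rightarrow> ('a, 'e) chart"

definition chart_inv :: "('a, 'e) chart \<Rightarrow> 'e \<Rightarrow> 'a" where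
  "chart_inv c = inv_into (fst c) (snd c)"

definition is_chart :: "('a::topological_space, 'e::euclidean_space) chart \<Rightarrow> bool" where
  "is_chart c \<longleftrightarrow> open (fst c) \<and> open (snd c ` fst c) \<and>
     homeomorphism (fst c) (snd c ` fst c) (snd c) (chart_inv c)"

definition smooth_manifold ::
    "('a::{t2_space, second_countable_topology}, 'e::euclidean_space) mfd \<Rightarrow> bool" where
  "smooth_manifold M \<longleftrightarrow>
     (\<forall>c\<in>atlas M. is_chart c) \<and>
     (\<forall>c\<in>atlas M. \<forall>c'\<in>atlas M. smooth_on (snd c ` (fst c \<inter> fst c')) (snd c' \<circ> chart_inv c)) \<and>
     (\<forall>p. chart_at M p \<in> atlas M \<and> p \<in> fst (chart_at M p))"

definition prod_chart ::
    "('a, 'e) chart \<Rightarrow> ('b, 'h) chart \<Rightarrow> ('a \<times> 'b, 'e \<times> 'h) chart" where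
  "prod_chart c d = (fst c \<times> fst d, map_prod (snd c) (snd d))"

text \<open>
  By the choice of \<open>chart_at\<close>, the tangent space of the product at \<open>(b, q)\<close> is the product of
  the tangent spaces at \<open>b\<close> and at \<open>q\<close>.
\<close>

definition prod_mfd :: "('a, 'e) mfd \<Rightarrow> ('b, 'h) mfd \<Rightarrow> ('a \<times> 'b, 'e \<times> 'h) mfd" where
  "prod_mfd B F = \<lparr> atlas = {prod_chart c d | c d. c \<in> atlas B \<and> d \<in> atlas F},
                    chart_at = (\<lambda>(b, q). prod_chart (chart_at B b) (chart_at F q)) \<rparr>"

definition smooth_fun :: "('a, 'e::euclidean_space) mfd \<Rightarrow> ('a \<Rightarrow> real) \<Rightarrow> bool" where
  "smooth_fun M u \<longleftrightarrow> (\<forall>c\<in>atlas M. smooth_on (snd c ` fst c) (u \<circ> chart_inv c))"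

definition ext_d :: "('a, 'e::euclidean_space) mfd \<Rightarrow> ('a \<Rightarrow> real) \<Rightarrow> 'a \<Rightarrow> 'e \<Rightarrow> real" where
  "ext_d M u p = frechet_derivative (u \<circ> chart_inv (chart_at M p)) (at (snd (chart_at M p) p))"

definition tangent_map ::
    "('a, 'e::euclidean_space) mfd \<Rightarrow> ('b, 'h::euclidean_space) mfd \<Rightarrow> ('a \<Rightarrow> 'b) \<Rightarrow> 'a \<Rightarrow> 'e \<Rightarrow> 'h" where
  "tangent_map M N \<phi> p =
     frechet_derivative (snd (chart_at N (\<phi> p)) \<circ> \<phi> \<circ> chart_inv (chart_at M p))
       (at (snd (chart_at M p) p))"

text \<open>
  \<open>coord_vec M c p e\<close> is the tangent vector at \<open>p\<close> with components \<open>e\<close> in the chart \<open>c\<close>;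
  \<open>coords M c p v\<close> are the components in the chart \<open>c\<close> of the tangent vector \<open>v\<close> at \<open>p\<close>.
\<close>

definition coord_vec :: "('a, 'e::euclidean_space) mfd \<Rightarrow> ('a, 'e) chart \<Rightarrow> 'a \<Rightarrow> 'e \<Rightarrow> 'e" where
  "coord_vec M c p = frechet_derivative (snd (chart_at M p) \<circ> chart_inv c) (at (snd c p))"

definition coords :: "('a, 'e::euclidean_space) mfd \<Rightarrow> ('a, 'e) chart \<Rightarrow> 'a \<Rightarrow> 'e \<Rightarrow> 'e" where
  "coords M c p =
     frechet_derivative (snd c \<circ> chart_inv (chart_at M p)) (at (snd (chart_at M p) p))"


section \<open>Tensor fields\<close>

type_synonym ('a, 'e) vfield = "'a \<Rightarrow> 'e"
type_synonym ('a, 'e) form = "'a \<Rightarrow> 'e \<Rightarrow> real"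
type_synonym ('a, 'e) metric = "'a \<Rightarrow> 'e \<Rightarrow> 'e \<Rightarrow> real"
type_synonym ('a, 'e) cobilinear = "'a \<Rightarrow> ('e \<Rightarrow> real) \<Rightarrow> ('e \<Rightarrow> real) \<Rightarrow> real"

definition scale_form :: "('a \<Rightarrow> real) \<Rightarrow> ('a, 'e) form \<Rightarrow> ('a, 'e) form" where
  "scale_form u \<alpha> = (\<lambda>p v. u p * \<alpha> p v)"

definition add_form :: "('a, 'e) form \<Rightarrow> ('a, 'e) form \<Rightarrow> ('a, 'e) form" where
  "add_form \<alpha> \<beta> = (\<lambda>p v. \<alpha> p v + \<beta> p v)"

definition diff_form :: "('a, 'e) form \<Rightarrow> ('a, 'e) form \<Rightarrow> ('a, 'e) form" where
  "diff_form \<alpha> \<beta> = (\<lambda>p v. \<alpha> p v - \<beta> p v)"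

definition pairing :: "('a, 'e) cobilinear \<Rightarrow> ('a, 'e) form \<Rightarrow> ('a, 'e) form \<Rightarrow> 'a \<Rightarrow> real" where
  "pairing T \<alpha> \<beta> = (\<lambda>p. T p (\<alpha> p) (\<beta> p))"

text \<open>
  A 1-form (metric, bivector field) is smooth if its components in every chart of the atlas are
  smooth functions of the coordinates.
\<close>

definition forms :: "('a, 'e::euclidean_space) mfd \<Rightarrow> ('a, 'e) form set" where
  "forms M = {\<alpha>. (\<forall>p. linear (\<alpha> p)) \<and>
     (\<forall>c\<in>atlas M. \<forall>e. smooth_on (snd c ` fst c)
        (\<lambda>x. let p = chart_inv c x in \<alpha> p (coord_vec M c p e)))}"

definition pseudo_riemannian_metric ::
    "('a, 'e::euclidean_space) mfd \<Rightarrow> ('a, 'e) metric \<Rightarrow> bool" where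
  "pseudo_riemannian_metric M g \<longleftrightarrow>
     (\<forall>p. bilinear (g p)) \<and>
     (\<forall>p v w. g p v w = g p w v) \<and>
     (\<forall>p v. (\<forall>w. g p v w = 0) \<longrightarrow> v = 0) \<and>
     (\<forall>c\<in>atlas M. \<forall>e e'. smooth_on (snd c ` fst c)
        (\<lambda>x. let p = chart_inv c x in g p (coord_vec M c p e) (coord_vec M c p e')))"

text \<open>The metric induced on covectors through the isomorphism sending \<open>X\<close> to \<open>g(X, _)\<close>.\<close>

definition dual_vec :: "('a, 'e) metric \<Rightarrow> 'a \<Rightarrow> ('e \<Rightarrow> real) \<Rightarrow> 'e" where
  "dual_vec g p a = (THE v. g p v = a)"

definition cometric :: "('a, 'e) metric \<Rightarrow> ('a, 'e) cobilinear" where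
  "cometric g p a b = g p (dual_vec g p a) (dual_vec g p b)"

text \<open>The values \<open>P p a b\<close> on nonlinear \<open>a\<close> or \<open>b\<close> are irrelevant.\<close>

definition bivector_field ::
    "('a, 'e::euclidean_space) mfd \<Rightarrow> ('a, 'e) cobilinear \<Rightarrow> bool" where
  "bivector_field M P \<longleftrightarrow>
     (\<forall>p a b c. linear a \<and> linear b \<and> linear c \<longrightarrow>
        (\<forall>s t. P p (\<lambda>v. s * a v + t * b v) c = s * P p a c + t * P p b c)) \<and>
     (\<forall>p a b. linear a \<and> linear b \<longrightarrow> P p a b = - P p b a) \<and>
     (\<forall>c\<in>atlas M. \<forall>a b. linear a \<and> linear b \<longrightarrow> smooth_on (snd c ` fst c)
        (\<lambda>x. let p = chart_inv c x in P p (a \<circ> coords M c p) (b \<circ> coords M c p)))"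

definition poisson_bracket ::
    "('a, 'e::euclidean_space) mfd \<Rightarrow> ('a, 'e) cobilinear \<Rightarrow> ('a \<Rightarrow> real) \<Rightarrow> ('a \<Rightarrow> real) \<Rightarrow> 'a \<Rightarrow> real" where
  "poisson_bracket M P u w = pairing P (ext_d M u) (ext_d M w)"

definition poisson_bivector ::
    "('a, 'e::euclidean_space) mfd \<Rightarrow> ('a, 'e) cobilinear \<Rightarrow> bool" where
  "poisson_bivector M P \<longleftrightarrow> bivector_field M P \<and>
     (\<forall>u v w. smooth_fun M u \<and> smooth_fun M v \<and> smooth_fun M w \<longrightarrow>
        (\<forall>p. poisson_bracket M P u (poisson_bracket M P v w) p
           + poisson_bracket M P v (poisson_bracket M P w u) p
           + poisson_bracket M P w (poisson_bracket M P u v) p = 0))"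


section \<open>Contravariant geometry\<close>

definition anchor :: "('a, 'e::euclidean_space) cobilinear \<Rightarrow> ('a, 'e) form \<Rightarrow> ('a, 'e) vfield" where
  "anchor P \<alpha> p = (THE v. \<forall>b. linear b \<longrightarrow> b v = P p (\<alpha> p) b)"

definition act :: "('a, 'e::euclidean_space) mfd \<Rightarrow> ('a, 'e) vfield \<Rightarrow> ('a \<Rightarrow> real) \<Rightarrow> 'a \<Rightarrow> real" where
  "act M X u p = ext_d M u p (X p)"

text \<open>
  The Lie derivative of a 1-form, by the local formula
  \<open>(L\<^sub>X \<beta>)\<^sub>j = X\<^sup>i \<partial>\<^sub>i \<beta>\<^sub>j + \<beta>\<^sub>i \<partial>\<^sub>j X\<^sup>i\<close> in the chart \<open>chart_at M p\<close>.
\<close>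

definition lie_form ::
    "('a, 'e::euclidean_space) mfd \<Rightarrow> ('a, 'e) vfield \<Rightarrow> ('a, 'e) form \<Rightarrow> ('a, 'e) form" where
  "lie_form M X \<beta> p v =
     (let c = chart_at M p;
          X' = (\<lambda>x. let q = chart_inv c x in coords M c q (X q));
          \<beta>' = (\<lambda>x w. let q = chart_inv c x in \<beta> q (coord_vec M c q w));
          x\<^sub>0 = snd c p
      in frechet_derivative (\<lambda>x. \<beta>' x v) (at x\<^sub>0) (X' x\<^sub>0)
         + \<beta>' x\<^sub>0 (frechet_derivative X' (at x\<^sub>0) v))"

definition koszul ::
    "('a, 'e::euclidean_space) mfd \<Rightarrow> ('a, 'e) cobilinear \<Rightarrow>
     ('a, 'e) form \<Rightarrow> ('a, 'e) form \<Rightarrow> ('a, 'e) form" where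
  "koszul M P \<alpha> \<beta> =
     diff_form (diff_form (lie_form M (anchor P \<alpha>) \<beta>) (lie_form M (anchor P \<beta>) \<alpha>))
       (ext_d M (pairing P \<alpha> \<beta>))"

type_synonym ('a, 'e) connection = "('a, 'e) form \<Rightarrow> ('a, 'e) form \<Rightarrow> ('a, 'e) form"

text \<open>
  \<open>levi_civita M P g D\<close>: the map \<open>D\<close>, restricted to smooth 1-forms, is the contravariant
  Levi-Civita connection of the bivector field \<open>P\<close> and the cometric \<open>g\<close>.
\<close>

definition levi_civita ::
    "('a, 'e::euclidean_space) mfd \<Rightarrow> ('a, 'e) cobilinear \<Rightarrow> ('a, 'e) cobilinear \<Rightarrow>
     ('a, 'e) connection \<Rightarrow> bool" where
  "levi_civita M P g D \<longleftrightarrow>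
     (\<forall>\<alpha>\<in>forms M. \<forall>\<beta>\<in>forms M. D \<alpha> \<beta> \<in> forms M) \<and>
     (\<forall>\<alpha>\<in>forms M. \<forall>\<beta>\<in>forms M. \<forall>\<gamma>\<in>forms M.
        D (add_form \<alpha> \<beta>) \<gamma> = add_form (D \<alpha> \<gamma>) (D \<beta> \<gamma>) \<and>
        D \<gamma> (add_form \<alpha> \<beta>) = add_form (D \<gamma> \<alpha>) (D \<gamma> \<beta>)) \<and>
     (\<forall>r. \<forall>\<alpha>\<in>forms M. \<forall>\<beta>\<in>forms M.
        D (scale_form (\<lambda>_. r) \<alpha>) \<beta> = scale_form (\<lambda>_. r) (D \<alpha> \<beta>) \<and>
        D \<alpha> (scale_form (\<lambda>_. r) \<beta>) = scale_form (\<lambda>_. r) (D \<alpha> \<beta>)) \<and>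
     (\<forall>u. smooth_fun M u \<longrightarrow> (\<forall>\<alpha>\<in>forms M. \<forall>\<beta>\<in>forms M.
        D (scale_form u \<alpha>) \<beta> = scale_form u (D \<alpha> \<beta>) \<and>
        D \<alpha> (scale_form u \<beta>) =
          add_form (scale_form u (D \<alpha> \<beta>)) (scale_form (act M (anchor P \<alpha>) u) \<beta>))) \<and>
     (\<forall>\<alpha>\<in>forms M. \<forall>\<beta>\<in>forms M. diff_form (D \<alpha> \<beta>) (D \<beta> \<alpha>) = koszul M P \<alpha> \<beta>) \<and>
     (\<forall>\<alpha>\<in>forms M. \<forall>\<beta>\<in>forms M. \<forall>\<gamma>\<in>forms M. \<forall>p.
        act M (anchor P \<alpha>) (pairing g \<beta> \<gamma>) p = pairing g (D \<alpha> \<beta>) \<gamma> p + pairing g \<beta> (D \<alpha> \<gamma>) p)"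

definition curvature ::
    "('a, 'e::euclidean_space) mfd \<Rightarrow> ('a, 'e) cobilinear \<Rightarrow> ('a, 'e) connection \<Rightarrow>
     ('a, 'e) form \<Rightarrow> ('a, 'e) form \<Rightarrow> ('a, 'e) form \<Rightarrow> ('a, 'e) form" where
  "curvature M P D \<alpha> \<beta> \<gamma> =
     diff_form (diff_form (D \<alpha> (D \<beta> \<gamma>)) (D \<beta> (D \<alpha> \<gamma>))) (D (koszul M P \<alpha> \<beta>) \<gamma>)"

text \<open>
  A \<open>g\<close>-orthonormal coframe on the open set \<open>U\<close>, with signs \<open>\<epsilon>\<close>.  The members are globally
  defined smooth forms which are orthonormal on \<open>U\<close>; every local orthonormal coframe agrees with
  such a family near any given point of its domain.
\<close>

definition local_coframe ::
    "('a::topological_space, 'e::euclidean_space) mfd \<Rightarrow> ('a, 'e) cobilinear \<Rightarrow> 'a set \<Rightarrow>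
     (nat \<Rightarrow> ('a, 'e) form) \<Rightarrow> (nat \<Rightarrow> real) \<Rightarrow> bool" where
  "local_coframe M g U \<eta> \<epsilon> \<longleftrightarrow> open U \<and>
     (\<forall>i<DIM('e). \<eta> i \<in> forms M \<and> \<epsilon> i \<in> {1, -1}) \<and>
     (\<forall>p\<in>U. \<forall>i<DIM('e). \<forall>j<DIM('e). pairing g (\<eta> i) (\<eta> j) p = (if i = j then \<epsilon> i else 0))"

text \<open>
  \<open>ricci M P g Ric\<close>: \<open>Ric\<close> is the Ricci curvature of \<open>(M, P, g)\<close>.  As the Levi-Civita
  connection exists and is unique, and local orthonormal coframes exist around every point, this
  determines \<open>Ric\<close> on smooth 1-forms.
\<close>

definition ricci ::
    "('a::topological_space, 'e::euclidean_space) mfd \<Rightarrow> ('a, 'e) cobilinear \<Rightarrow> ('a, 'e) cobilinear \<Rightarrow>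
     (('a, 'e) form \<Rightarrow> ('a, 'e) form \<Rightarrow> 'a \<Rightarrow> real) \<Rightarrow> bool" where
  "ricci M P g Ric \<longleftrightarrow> (\<exists>D. levi_civita M P g D \<and>
     (\<forall>U \<eta> \<epsilon>. local_coframe M g U \<eta> \<epsilon> \<longrightarrow>
        (\<forall>\<alpha>\<in>forms M. \<forall>\<beta>\<in>forms M. \<forall>p\<in>U.
           Ric \<alpha> \<beta> p = (\<Sum>i<DIM('e). \<epsilon> i * pairing g (curvature M P D \<alpha> (\<eta> i) (\<eta> i)) \<beta> p))))"

definition einstein_const ::
    "('a::topological_space, 'e::euclidean_space) mfd \<Rightarrow> ('a, 'e) cobilinear \<Rightarrow> ('a, 'e) cobilinear \<Rightarrow>
     real \<Rightarrow> bool" where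
  "einstein_const M P g lam \<longleftrightarrow> (\<exists>Ric. ricci M P g Ric \<and>
     (\<forall>\<alpha>\<in>forms M. \<forall>\<beta>\<in>forms M. \<forall>p. Ric \<alpha> \<beta> p = lam * pairing g \<alpha> \<beta> p))"

definition riemannian_poisson ::
    "('a, 'e::euclidean_space) mfd \<Rightarrow> ('a, 'e) cobilinear \<Rightarrow> ('a, 'e) cobilinear \<Rightarrow> bool" where
  "riemannian_poisson M P g \<longleftrightarrow> (\<exists>D. levi_civita M P g D \<and>
     (\<forall>\<alpha>\<in>forms M. \<forall>\<beta>\<in>forms M. \<forall>\<gamma>\<in>forms M. \<forall>p.
        act M (anchor P \<alpha>) (pairing P \<beta> \<gamma>) p - pairing P (D \<alpha> \<beta>) \<gamma> p - pairing P \<beta> (D \<alpha> \<gamma>) p = 0))"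

definition casimir ::
    "('a, 'e::euclidean_space) mfd \<Rightarrow> ('a, 'e) cobilinear \<Rightarrow> ('a \<Rightarrow> real) \<Rightarrow> bool" where
  "casimir M P f \<longleftrightarrow> smooth_fun M f \<and> (\<forall>p. anchor P (ext_d M f) p = 0)"


section \<open>Warped products\<close>

definition pullback_metric ::
    "('a, 'e::euclidean_space) mfd \<Rightarrow> ('b, 'h::euclidean_space) mfd \<Rightarrow> ('a \<Rightarrow> 'b) \<Rightarrow>
     ('b, 'h) metric \<Rightarrow> ('a, 'e) metric" where
  "pullback_metric M N \<phi> g p v w = g (\<phi> p) (tangent_map M N \<phi> p v) (tangent_map M N \<phi> p w)"

definition warped_metric ::
    "('b, 'e::euclidean_space) mfd \<Rightarrow> ('b, 'e) metric \<Rightarrow> ('f, 'h::euclidean_space) mfd \<Rightarrow> ('f, 'h) metric \<Rightarrow>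
     ('b \<Rightarrow> real) \<Rightarrow> ('b \<times> 'f, 'e \<times> 'h) metric" where
  "warped_metric B gB F gF f p v w =
     pullback_metric (prod_mfd B F) B fst gB p v w
     + (f (fst p))\<^sup>2 * pullback_metric (prod_mfd B F) F snd gF p v w"

text \<open>
  The bivector \<open>P\<^sub>B + P\<^sub>F\<close>: a covector on the product is split into its restrictions to the
  two factors of the tangent space.
\<close>

definition prod_bivector ::
    "('b, 'e::euclidean_space) cobilinear \<Rightarrow> ('f, 'h::euclidean_space) cobilinear \<Rightarrow>
     ('b \<times> 'f, 'e \<times> 'h) cobilinear" where
  "prod_bivector PB PF p a b =
     PB (fst p) (\<lambda>x. a (x, 0)) (\<lambda>x. b (x, 0)) + PF (snd p) (\<lambda>y. a (0, y)) (\<lambda>y. b (0, y))"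

definition warping_function :: "('b, 'e::euclidean_space) mfd \<Rightarrow> ('b \<Rightarrow> real) \<Rightarrow> bool" where
  "warping_function B f \<longleftrightarrow> smooth_fun B f \<and> (\<forall>b. f b > 0)"

definition einstein_poisson_warped_product ::
    "('b::topological_space, 'e::euclidean_space) mfd \<Rightarrow> ('b, 'e) metric \<Rightarrow> ('b, 'e) cobilinear \<Rightarrow>
     ('f::topological_space, 'h::euclidean_space) mfd \<Rightarrow> ('f, 'h) metric \<Rightarrow> ('f, 'h) cobilinear \<Rightarrow>
     ('b \<Rightarrow> real) \<Rightarrow> real \<Rightarrow> bool" where
  "einstein_poisson_warped_product B gB PB F gF PF f lam \<longleftrightarrow>
     (let M = prod_mfd B F;
          P = prod_bivector PB PF;
          g = cometric (warped_metric B gB F gF f)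
      in riemannian_poisson M P g \<and> casimir B PB f \<and> einstein_const M P g lam)"

end

(*
  Since f is Casimir, every anchor annihilates f, so f behaves like a constant in the Koszul
  formula. Hence the connection D of the warped product satisfies D(a^v)(b^v) = (D_F a b)^v and
  D(a^v)(c^h) = D(c^h)(a^v) = 0 for vertical lifts a^v, b^v and horizontal lifts c^h. If (c_i) and
  (e_j) are local orthonormal coframes of B and F, then the c_i^h together with the f e_j^v form
  one of the product. In the Ricci curvature of a^v and b^v the terms of the c_i^h vanish, and in
  those of the f e_j^v the factor f^2 cancels the factor 1/f^2 of the cometric, so that
  Ric(a^v, b^v) = Ric_F(a, b)^v. Comparing the Einstein equations gives lambda = lambda_F f^2.

  Orthonormal coframes are dual to frames obtained by Gram-Schmidt from vector fields with
  prescribed value at a point; these come from a bump function built on exp(-1/t).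
*)
theory Submission
  imports Defs
begin

section \<open>Smooth maps\<close>

text \<open>The two Einstein conditions provide a Levi-Civita connection on the product and one on
  \<open>F\<close>, but none on \<open>B\<close>. The connections are therefore compared through the
  right-hand side of the Koszul formula, which makes sense on \<open>B\<close> without a connection
  and splits into the part of \<open>B\<close> plus \<open>1 / f^2\<close> times the part of
  \<open>F\<close>. Identities of covectors are tested against sums of lifts alone, which suffices
  because both cometrics of the factors are nondegenerate. Coframes have to consist of globally
  defined smooth forms that are orthonormal on a smaller set; hence the cutoffs. In indefinite
  signature Gram-Schmidt can meet null vectors, so each new frame vector is chosen non-null at the
  given point and normalised only near it, by a function that is smooth on the whole line but an
  inverse square root only where this is wanted. The final comparison uses a single non-null form on
  \<open>F\<close>, which exists because \<open>F\<close> has positive dimension. It holds over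
  every point of \<open>B\<close> with the same constants, and this makes \<open>f\<close>
  constant.\<close>

lemma frechet_derivative_eqI:
  "(f has_derivative D) (at x) \<Longrightarrow> frechet_derivative f (at x) = D"
  by (metis frechet_derivative_at)

text \<open>\<open>frechet_derivative\<close> is a choice from a predicate. Functions that agree
  near \<open>x\<close> satisfy the same predicate, so the choices coincide even where no derivative
  exists.\<close>

lemma frechet_derivative_cong_open:
  assumes "open S" "x \<in> S" "\<And>y. y \<in> S \<Longrightarrow> f y = g y"
  shows "frechet_derivative f (at x) = frechet_derivative g (at x)"
proof -
  have "(f has_derivative D) (at x) \<longleftrightarrow> (g has_derivative D) (at x)" for D
    using assms by (metis has_derivative_transform_within_open)
  then show ?thesis unfolding frechet_derivative_def by simp
qed

lemma differentiable_cong_open: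
  assumes "open S" "x \<in> S" "\<And>y. y \<in> S \<Longrightarrow> f y = g y" "f differentiable (at x)"
  shows "g differentiable (at x)"
  using assms unfolding differentiable_def by (metis has_derivative_transform_within_open)

section \<open>Calculus of C^k maps\<close>

lemma Ck_on_cong:
  assumes "open S" "\<And>x. x \<in> S \<Longrightarrow> f x = g x" "Ck_on k f S"
  shows "Ck_on k g S"
  using assms(2,3)
proof (induction k arbitrary: f g)
  case 0
  then show ?case using continuous_on_cong[of S S f g] by simp
next
  case (Suc k)
  have "g differentiable (at x)" if "x \<in> S" for x
    using differentiable_cong_open[OF assms(1) that Suc.prems(1)] Suc.prems(2) that by simp
  moreover have "Ck_on k (\<lambda>x. frechet_derivative g (at x) v) S" for v
  proof (rule Suc.IH)
    show "frechet_derivative f (at x) v = frechet_derivative g (at x) v" if "x \<in> S" for x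
      using frechet_derivative_cong_open[OF assms(1) that Suc.prems(1)] by simp
    show "Ck_on k (\<lambda>x. frechet_derivative f (at x) v) S" using Suc.prems(2) by simp
  qed
  ultimately show ?case by simp
qed

lemma Ck_on_subset: "Ck_on k f S \<Longrightarrow> T \<subseteq> S \<Longrightarrow> Ck_on k f T"
  by (induction k arbitrary: f) (auto intro: continuous_on_subset)

lemma Ck_on_local:
  assumes "\<And>x. x \<in> S \<Longrightarrow> \<exists>T. open T \<and> x \<in> T \<and> Ck_on k f T"
  shows "Ck_on k f S"
  using assms
proof (induction k arbitrary: f)
  case 0
  have "isCont f x" if x: "x \<in> S" for x
  proof -
    obtain T where "open T" "x \<in> T" "continuous_on T f"
      using 0[OF x] by auto
    then show ?thesis by (simp add: continuous_on_eq_continuous_at)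
  qed
  then show ?case by (simp add: continuous_at_imp_continuous_on)
next
  case (Suc k)
  have "f differentiable (at x)" if "x \<in> S" for x
    using Suc.prems[OF that] by auto
  moreover have "Ck_on k (\<lambda>x. frechet_derivative f (at x) v) S" for v
    by (rule Suc.IH) (use Suc.prems in fastforce)
  ultimately show ?case by simp
qed

lemma Ck_on_SucD: "Ck_on (Suc k) f S \<Longrightarrow> Ck_on k f S"
proof (induction k arbitrary: f)
  case 0
  then show ?case
    by (auto intro!: continuous_at_imp_continuous_on differentiable_imp_continuous_within)
next
  case (Suc k)
  then show ?case by (metis Ck_on.simps(2))
qed

lemma Ck_on_const: "Ck_on k (\<lambda>x. c) S"
proof (induction k arbitrary: c)
  case (Suc k)
  have "frechet_derivative (\<lambda>x. c) (at x) = (\<lambda>v. 0)" for x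
    by (rule frechet_derivative_eqI) simp
  then show ?case using Suc by simp
qed simp

lemma Ck_on_linear:
  assumes "linear L"
  shows "Ck_on k L S"
proof (cases k)
  case 0
  then show ?thesis using assms by (simp add: linear_continuous_on linear_conv_bounded_linear)
next
  case (Suc m)
  have "(L has_derivative L) (at x)" for x
    using assms by (simp add: linear_imp_has_derivative)
  then have "L differentiable (at x)" "frechet_derivative L (at x) = L" for x
    by (auto simp: differentiable_def intro: frechet_derivative_eqI)
  then show ?thesis using Suc by (simp add: Ck_on_const)
qed

lemma Ck_on_linear_comp:
  assumes "open S" "linear L" "Ck_on k f S"
  shows "Ck_on k (\<lambda>x. L (f x)) S"
  using assms(3)
proof (induction k arbitrary: f)
  case 0
  have "continuous_on UNIV L"
    using assms(2) by (simp add: linear_continuous_on linear_conv_bounded_linear)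
  with 0 show ?case by (auto intro: continuous_on_compose2)
next
  case (Suc k)
  have D: "((\<lambda>x. L (f x)) has_derivative (\<lambda>v. L (frechet_derivative f (at x) v))) (at x)"
    if "x \<in> S" for x
  proof -
    have "(f has_derivative frechet_derivative f (at x)) (at x)"
      using Suc.prems that by (simp add: frechet_derivative_works[symmetric])
    then show ?thesis
      using assms(2) by (simp add: bounded_linear.has_derivative linear_conv_bounded_linear)
  qed
  have "Ck_on k (\<lambda>x. frechet_derivative (\<lambda>x. L (f x)) (at x) v) S" for v
    by (rule Ck_on_cong[OF assms(1), where f = "\<lambda>x. L (frechet_derivative f (at x) v)"])
       (use D Suc in \<open>auto simp: frechet_derivative_eqI[OF D]\<close>)
  then show ?case using D by (auto simp: differentiable_def)
qed

lemma Ck_on_add: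
  assumes "open S" "Ck_on k f S" "Ck_on k g S"
  shows "Ck_on k (\<lambda>x. f x + g x) S"
  using assms(2,3)
proof (induction k arbitrary: f g)
  case 0
  then show ?case by (auto intro: continuous_on_add)
next
  case (Suc k)
  have D: "((\<lambda>x. f x + g x) has_derivative
      (\<lambda>v. frechet_derivative f (at x) v + frechet_derivative g (at x) v)) (at x)"
    if "x \<in> S" for x
    using Suc.prems that by (intro has_derivative_add) (auto simp: frechet_derivative_works[symmetric])
  have "Ck_on k (\<lambda>x. frechet_derivative (\<lambda>x. f x + g x) (at x) v) S" for v
    by (rule Ck_on_cong[OF assms(1),
          where f = "\<lambda>x. frechet_derivative f (at x) v + frechet_derivative g (at x) v"])
       (use D Suc in \<open>auto simp: frechet_derivative_eqI[OF D]\<close>)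
  then show ?case using D by (auto simp: differentiable_def)
qed

text \<open>By the product rule the derivative is a sum of products of functions of class
  \<open>Ck_on k\<close>, where \<open>Ck_on_SucD\<close> lowers the order of the undifferentiated
  factors.\<close>

lemma Ck_on_mult:
  fixes f g :: "'a::euclidean_space \<Rightarrow> real"
  assumes "open S" "Ck_on k f S" "Ck_on k g S"
  shows "Ck_on k (\<lambda>x. f x * g x) S"
  using assms(2,3)
proof (induction k arbitrary: f g)
  case 0
  then show ?case by (auto intro: continuous_on_mult)
next
  case (Suc k)
  have D: "((\<lambda>x. f x * g x) has_derivative
      (\<lambda>v. f x * frechet_derivative g (at x) v + frechet_derivative f (at x) v * g x)) (at x)"
    if "x \<in> S" for x
    using Suc.prems that by (intro has_derivative_mult) (auto simp: frechet_derivative_works[symmetric])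
  have "Ck_on k (\<lambda>x. frechet_derivative (\<lambda>x. f x * g x) (at x) v) S" for v
  proof (rule Ck_on_cong[OF assms(1), where
      f = "\<lambda>x. f x * frechet_derivative g (at x) v + frechet_derivative f (at x) v * g x"])
    show "Ck_on k (\<lambda>x. f x * frechet_derivative g (at x) v + frechet_derivative f (at x) v * g x) S"
      using Suc.prems Suc.IH Ck_on_SucD[OF Suc.prems(1)] Ck_on_SucD[OF Suc.prems(2)]
      by (intro Ck_on_add assms(1)) simp_all
  qed (simp add: frechet_derivative_eqI[OF D])
  then show ?case using D by (auto simp: differentiable_def)
qed

lemma Ck_on_sum:
  assumes "open S" "finite I" "\<And>i. i \<in> I \<Longrightarrow> Ck_on k (f i) S"
  shows "Ck_on k (\<lambda>x. \<Sum>i\<in>I. f i x) S"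
  using assms(2,3) by (induction I) (auto intro: Ck_on_const Ck_on_add assms(1))

text \<open>The chain rule differentiates \<open>g\<close> in a direction that moves with
  \<open>x\<close>, whereas \<open>Ck_on\<close> speaks of fixed directions only. Expanding the
  direction in the basis leaves derivatives of \<open>g\<close> in fixed directions, to which the
  induction hypothesis applies, combined by sums and products of real functions.\<close>

lemma Ck_on_compose:
  fixes f :: "'a::euclidean_space \<Rightarrow> 'b::euclidean_space" and g :: "'b \<Rightarrow> 'c::euclidean_space"
  assumes "open S" "open T" "f ` S \<subseteq> T" "Ck_on k f S" "Ck_on k g T"
  shows "Ck_on k (\<lambda>x. g (f x)) S"
  using assms(4,5)
proof (induction k arbitrary: g)
  case 0
  then show ?case using assms(3) by (auto intro: continuous_on_compose2)
next
  case (Suc k)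
  have dg: "(g has_derivative frechet_derivative g (at y)) (at y)" if "y \<in> T" for y
    using Suc.prems that by (simp add: frechet_derivative_works[symmetric])
  have df: "(f has_derivative frechet_derivative f (at x)) (at x)" if "x \<in> S" for x
    using Suc.prems that by (simp add: frechet_derivative_works[symmetric])
  have fT: "f x \<in> T" if "x \<in> S" for x using assms(3) that by auto
  have D: "((\<lambda>x. g (f x)) has_derivative
      (\<lambda>v. frechet_derivative g (at (f x)) (frechet_derivative f (at x) v))) (at x)" if "x \<in> S" for x
    using diff_chain_at[OF df dg, OF that fT[OF that]] by (simp add: o_def)
  have expand: "frechet_derivative g (at y) w = (\<Sum>b\<in>Basis. (w \<bullet> b) *\<^sub>R frechet_derivative g (at y) b)"
    if "y \<in> T" for y w
  proof -
    have "linear (frechet_derivative g (at y))" using dg[OF that] by (rule has_derivative_linear)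
    from linear_sum[OF this, of "\<lambda>b. (w \<bullet> b) *\<^sub>R b" Basis] show ?thesis
      by (simp add: euclidean_representation linear_scale[OF \<open>linear _\<close>])
  qed
  have "Ck_on k (\<lambda>x. frechet_derivative (\<lambda>x. g (f x)) (at x) v) S" for v
  proof (rule Ck_on_cong[OF assms(1)])
    show "(\<Sum>c\<in>Basis. (\<Sum>b\<in>Basis. (frechet_derivative f (at x) v \<bullet> b) *
             (frechet_derivative g (at (f x)) b \<bullet> c)) *\<^sub>R c)
         = frechet_derivative (\<lambda>x. g (f x)) (at x) v" if "x \<in> S" for x
    proof -
      let ?w = "frechet_derivative g (at (f x)) (frechet_derivative f (at x) v)"
      have w: "?w \<bullet> c = (\<Sum>b\<in>Basis. (frechet_derivative f (at x) v \<bullet> b) *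
          (frechet_derivative g (at (f x)) b \<bullet> c))" for c
        by (simp add: expand[OF fT[OF that], of "frechet_derivative f (at x) v"] inner_sum_left)
      then show ?thesis
        unfolding frechet_derivative_eqI[OF D[OF that]]
        using euclidean_representation[of ?w] by (simp only: w)
    qed
    show "Ck_on k (\<lambda>x. \<Sum>c\<in>Basis. (\<Sum>b\<in>Basis. (frechet_derivative f (at x) v \<bullet> b) *
             (frechet_derivative g (at (f x)) b \<bullet> c)) *\<^sub>R c) S"
    proof (rule Ck_on_sum[OF assms(1) finite_Basis])
      fix c :: 'c
      let ?h = "\<lambda>x. \<Sum>b\<in>Basis. (frechet_derivative f (at x) v \<bullet> b) *
             (frechet_derivative g (at (f x)) b \<bullet> c)"
      have "Ck_on k (\<lambda>x. frechet_derivative f (at x) v) S" using Suc.prems by auto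
      then have 1: "Ck_on k (\<lambda>x. frechet_derivative f (at x) v \<bullet> b) S" for b
        by (rule Ck_on_linear_comp[where L = "\<lambda>u. u \<bullet> b", OF assms(1), rotated])
           (simp add: linear_iff inner_add_left)
      have "Ck_on k (\<lambda>x. frechet_derivative g (at (f x)) b) S" for b
        using Suc.prems(2) by (auto intro!: Suc.IH[OF Ck_on_SucD[OF Suc.prems(1)]])
      then have 2: "Ck_on k (\<lambda>x. frechet_derivative g (at (f x)) b \<bullet> c) S" for b
        by (rule Ck_on_linear_comp[where L = "\<lambda>u. u \<bullet> c", OF assms(1), rotated])
           (simp add: linear_iff inner_add_left)
      have "Ck_on k ?h S"
        by (rule Ck_on_sum[OF assms(1) finite_Basis Ck_on_mult[OF assms(1) 1 2]])
      then show "Ck_on k (\<lambda>x. ?h x *\<^sub>R c) S"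
        by (rule Ck_on_linear_comp[where L = "\<lambda>t. t *\<^sub>R c", OF assms(1), rotated])
           (simp add: linear_iff scaleR_add_left)
    qed
  qed
  then show ?case using D by (auto simp: differentiable_def)
qed

section \<open>Closure properties of smooth maps\<close>

lemma smooth_on_cong:
  "open S \<Longrightarrow> smooth_on S f \<Longrightarrow> (\<And>x. x \<in> S \<Longrightarrow> f x = g x) \<Longrightarrow> smooth_on S g"
  unfolding smooth_on_def by (meson Ck_on_cong)

lemma smooth_on_subset: "smooth_on S f \<Longrightarrow> T \<subseteq> S \<Longrightarrow> smooth_on T f"
  unfolding smooth_on_def by (meson Ck_on_subset)

lemma smooth_on_local:
  "(\<And>x. x \<in> S \<Longrightarrow> \<exists>T. open T \<and> x \<in> T \<and> smooth_on T f) \<Longrightarrow> smooth_on S f"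
  unfolding smooth_on_def by (meson Ck_on_local)

lemma smooth_on_const: "smooth_on S (\<lambda>x. c)"
  unfolding smooth_on_def by (simp add: Ck_on_const)

lemma smooth_on_linear: "linear L \<Longrightarrow> smooth_on S L"
  unfolding smooth_on_def by (simp add: Ck_on_linear)

lemma smooth_on_linear_comp:
  "open S \<Longrightarrow> linear L \<Longrightarrow> smooth_on S f \<Longrightarrow> smooth_on S (\<lambda>x. L (f x))"
  unfolding smooth_on_def by (simp add: Ck_on_linear_comp)

lemma smooth_on_add:
  "open S \<Longrightarrow> smooth_on S f \<Longrightarrow> smooth_on S g \<Longrightarrow> smooth_on S (\<lambda>x. f x + g x)"
  unfolding smooth_on_def by (simp add: Ck_on_add)

lemma smooth_on_mult:
  fixes f g :: "'a::euclidean_space \<Rightarrow> real"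
  shows "open S \<Longrightarrow> smooth_on S f \<Longrightarrow> smooth_on S g \<Longrightarrow> smooth_on S (\<lambda>x. f x * g x)"
  unfolding smooth_on_def by (simp add: Ck_on_mult)

lemma smooth_on_sum:
  "open S \<Longrightarrow> finite I \<Longrightarrow> (\<And>i. i \<in> I \<Longrightarrow> smooth_on S (f i)) \<Longrightarrow> smooth_on S (\<lambda>x. \<Sum>i\<in>I. f i x)"
  unfolding smooth_on_def by (simp add: Ck_on_sum)

lemma smooth_on_compose:
  "open S \<Longrightarrow> open T \<Longrightarrow> f ` S \<subseteq> T \<Longrightarrow> smooth_on S f \<Longrightarrow> smooth_on T g \<Longrightarrow> smooth_on S (\<lambda>x. g (f x))"
  unfolding smooth_on_def by (simp add: Ck_on_compose)

lemma smooth_on_inner: "open S \<Longrightarrow> smooth_on S f \<Longrightarrow> smooth_on S (\<lambda>x. f x \<bullet> c)"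
  by (rule smooth_on_linear_comp[where L = "\<lambda>u. u \<bullet> c"]) (auto simp: linear_iff inner_add_left)

lemma smooth_on_componentwise:
  assumes "open S" "\<And>b. b \<in> Basis \<Longrightarrow> smooth_on S (\<lambda>x. f x \<bullet> b)"
  shows "smooth_on S f"
proof -
  have "smooth_on S (\<lambda>x. \<Sum>b\<in>Basis. (f x \<bullet> b) *\<^sub>R b)"
    by (intro smooth_on_sum assms finite_Basis smooth_on_linear_comp[where L = "\<lambda>t. t *\<^sub>R b" for b])
       (auto simp: linear_iff scaleR_add_left)
  then show ?thesis by (simp add: euclidean_representation)
qed

lemma smooth_on_scaleR:
  assumes "open S" "smooth_on S u" "smooth_on S f"
  shows "smooth_on S (\<lambda>x. u x *\<^sub>R f x)"
  by (rule smooth_on_componentwise)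
     (use assms in \<open>auto intro!: smooth_on_mult smooth_on_inner\<close>)

lemma smooth_on_differentiable: "smooth_on S f \<Longrightarrow> x \<in> S \<Longrightarrow> f differentiable (at x)"
  unfolding smooth_on_def by (metis Ck_on.simps(2))

lemma smooth_on_has_derivative:
  "smooth_on S f \<Longrightarrow> x \<in> S \<Longrightarrow> (f has_derivative frechet_derivative f (at x)) (at x)"
  using smooth_on_differentiable frechet_derivative_works by blast

lemma smooth_on_continuous_on: "smooth_on S f \<Longrightarrow> continuous_on S f"
  unfolding smooth_on_def by (metis Ck_on.simps(1))

lemma smooth_on_frechet_derivative:
  "smooth_on S f \<Longrightarrow> smooth_on S (\<lambda>x. frechet_derivative f (at x) v)"
  unfolding smooth_on_def by (metis Ck_on.simps(2))

section \<open>Real powers and the flat exponential\<close>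

lemma smooth_on_closed_family:
  fixes f :: "'i \<Rightarrow> real \<Rightarrow> real"
  assumes "open S"
    and "\<And>i x. x \<in> S \<Longrightarrow> (f i has_real_derivative (\<Sum>j\<in>J i. a i j * f j x)) (at x)"
    and "\<And>i. finite (J i)"
  shows "smooth_on S (f i)"
proof -
  \<comment> \<open>The order is raised for all members at once: the derivative of one member is a
    constant linear combination of members, which have class \<open>Ck_on k\<close> by the induction
    hypothesis.\<close>
  have "Ck_on k (f i) S" for k
  proof (induction k arbitrary: i)
    case 0
    then show ?case
      using assms(2) by (auto intro!: continuous_at_imp_continuous_on DERIV_isCont)
  next
    case (Suc k)
    have D: "(f i has_derivative (\<lambda>v. (\<Sum>j\<in>J i. a i j * f j x) * v)) (at x)" if "x \<in> S" for x
      using assms(2)[OF that] by (simp add: has_field_derivative_def)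
    have "Ck_on k (\<lambda>x. frechet_derivative (f i) (at x) v) S" for v
    proof (rule Ck_on_cong[OF assms(1)])
      show "(\<Sum>j\<in>J i. a i j * f j x) * v = frechet_derivative (f i) (at x) v" if "x \<in> S" for x
        by (simp add: frechet_derivative_eqI[OF D[OF that]])
      show "Ck_on k (\<lambda>x. (\<Sum>j\<in>J i. a i j * f j x) * v) S"
        by (intro Ck_on_mult Ck_on_sum Ck_on_const assms Suc)
    qed
    then show ?case using D by (auto simp: differentiable_def)
  qed
  then show ?thesis by (simp add: smooth_on_def)
qed

lemma smooth_on_powr: "smooth_on {0<..} (\<lambda>x::real. x powr a)"
proof (rule smooth_on_closed_family[where f = "\<lambda>a x. x powr a" and J = "\<lambda>a. {a - 1}" and a = "\<lambda>a _. a"])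
  fix a x :: real assume "x \<in> {0<..}"
  then show "((\<lambda>x. x powr a) has_real_derivative (\<Sum>j\<in>{a - 1}. a * x powr j)) (at x)"
    by (auto intro!: derivative_eq_intros)
qed auto

text \<open>The classical flat function is the case \<open>n = 0\<close>. The quotients by powers of
  \<open>t\<close> are included because they arise on differentiation, which makes the family closed
  in the sense of \<open>smooth_on_closed_family\<close>.\<close>

definition flat_exp :: "nat \<Rightarrow> real \<Rightarrow> real" where
  "flat_exp n t = (if t > 0 then exp (- 1 / t) / t ^ n else 0)"

text \<open>With \<open>1 / t\<close> as the variable this is the growth of \<open>exp\<close>
  against powers.\<close>

lemma flat_exp_tendsto_0: "(flat_exp n \<longlongrightarrow> 0) (at 0)"
proof -
  have "((\<lambda>x::real. x ^ n / exp x) \<longlongrightarrow> 0) at_top"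
    by (rule tendsto_power_div_exp_0)
  then have "((\<lambda>t::real. inverse t ^ n / exp (inverse t)) \<longlongrightarrow> 0) (at_right 0)"
    by (rule filterlim_compose) (rule filterlim_inverse_at_top_right)
  then have "(flat_exp n \<longlongrightarrow> 0) (at_right 0)"
    by (rule Lim_transform_eventually)
       (auto simp: eventually_at_filter flat_exp_def exp_minus divide_simps)
  moreover have "(flat_exp n \<longlongrightarrow> 0) (at_left 0)"
    by (rule Lim_transform_eventually[OF tendsto_const])
       (auto simp: eventually_at_filter flat_exp_def)
  ultimately show ?thesis by (simp add: filterlim_split_at)
qed

lemma flat_exp_deriv:
  "(flat_exp n has_real_derivative flat_exp (n + 2) t - real n * flat_exp (n + 1) t) (at t)"
proof -
  consider "t > 0" | "t < 0" | "t = 0" by linarith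
  then show ?thesis
  proof cases
    case 1
    have "((\<lambda>t. exp (- 1 / t) / t ^ n) has_real_derivative
        flat_exp (n + 2) t - real n * flat_exp (n + 1) t) (at t)"
    proof -
      have e: "((\<lambda>t. exp (- 1 / t)) has_real_derivative exp (- 1 / t) / t\<^sup>2) (at t)"
        using 1 by (auto intro!: derivative_eq_intros simp: power2_eq_square)
      have p: "((\<lambda>t. t ^ n) has_real_derivative real n * (t ^ n / t)) (at t)"
        using 1 DERIV_power[OF DERIV_ident, of n t UNIV] by (cases n) (auto simp: field_simps)
      show ?thesis
        by (rule DERIV_cong[OF DERIV_divide[OF e p]])
           (use 1 in \<open>auto simp: flat_exp_def field_simps power2_eq_square\<close>)
    qed
    then show ?thesis
      by (rule DERIV_cong_ev[THEN iffD1, rotated -1])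
         (use 1 eventually_nhds_in_open[of "{0<..}" t] in \<open>auto simp: flat_exp_def elim!: eventually_mono\<close>)
  next
    case 2
    have "((\<lambda>t. 0) has_real_derivative
        flat_exp (n + 2) t - real n * flat_exp (n + 1) t) (at t)"
      using 2 by (simp add: flat_exp_def)
    then show ?thesis
      by (rule DERIV_cong_ev[THEN iffD1, rotated -1])
         (use 2 eventually_nhds_in_open[of "{..<0}" t] in \<open>auto simp: flat_exp_def elim!: eventually_mono\<close>)
  next
    case 3
    \<comment> \<open>The difference quotient of \<open>flat_exp n\<close> at 0 is
      \<open>flat_exp (n + 1)\<close>, whose limit is known.\<close>
    have "((\<lambda>h. flat_exp n h / h) \<longlongrightarrow> 0) (at 0)"
      by (rule Lim_transform_eventually[OF flat_exp_tendsto_0[of "n + 1"]])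
         (auto simp: eventually_at_filter flat_exp_def)
    then show ?thesis using 3 by (simp add: DERIV_def flat_exp_def)
  qed
qed

lemma smooth_on_flat_exp: "smooth_on UNIV (flat_exp n)"
proof (rule smooth_on_closed_family[where J = "\<lambda>n. {n + 1, n + 2}"
      and a = "\<lambda>n j. if j = n + 1 then - real n else 1"])
  fix n x
  show "(flat_exp n has_real_derivative
      (\<Sum>j\<in>{n + 1, n + 2}. (if j = n + 1 then - real n else 1) * flat_exp j x)) (at x)"
    using flat_exp_deriv[of n x] by (simp add: algebra_simps)
qed auto

text \<open>
  The smooth function \<open>S(t) = \<rho>(t) t + 1 - \<rho>(t)\<close>, with a cutoff \<open>\<rho>\<close> vanishing left of
  \<open>t\<^sub>0/3\<close> and equal to 1 right of \<open>t\<^sub>0/2\<close>, is positive everywhere, so that \<open>S\<close> to the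
  power \<open>-1/2\<close> is smooth.
\<close>

lemma smooth_inverse_sqrt_exists:
  fixes t\<^sub>0 :: real
  assumes "t\<^sub>0 > 0"
  obtains H where "smooth_on UNIV H" "\<And>t. t > t\<^sub>0 / 2 \<Longrightarrow> H t * H t * t = 1"
proof -
  \<comment> \<open>\<open>A\<close> is positive exactly to the right of one third of the given
    value, \<open>C\<close> exactly to the left of one half of it. The two rays cover the line, so
    \<open>A + C\<close> never vanishes, and the cutoff is \<rho> =
    \<open>A / (A + C)\<close>.\<close>
  define A where "A = (\<lambda>t. flat_exp 0 (t + - (t\<^sub>0 / 3)))"
  define C where "C = (\<lambda>t. flat_exp 0 (t\<^sub>0 / 2 + - t))"
  have id: "smooth_on UNIV (\<lambda>t::real. t)" and neg: "smooth_on UNIV (\<lambda>t::real. - t)"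
    by (rule smooth_on_linear, simp add: linear_iff)+
  have smA: "smooth_on UNIV A" unfolding A_def
    by (rule smooth_on_compose[where g = "flat_exp 0", OF open_UNIV open_UNIV subset_UNIV
          smooth_on_add[OF open_UNIV id smooth_on_const] smooth_on_flat_exp])
  have smC: "smooth_on UNIV C" unfolding C_def
    by (rule smooth_on_compose[where g = "flat_exp 0", OF open_UNIV open_UNIV subset_UNIV
          smooth_on_add[OF open_UNIV smooth_on_const neg] smooth_on_flat_exp])
  have AC: "A t + C t > 0" "A t \<ge> 0" "C t \<ge> 0" for t
    using assms by (auto simp: add_pos_pos A_def C_def flat_exp_def)
  define S where "S = (\<lambda>t. (A t * t + C t) * (A t + C t) powr - 1)"
  have S_pos: "S t > 0" for t
  proof -
    have "A t * t + C t > 0"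
    proof (cases "t > t\<^sub>0 / 3")
      case True
      then have "A t > 0" "t > 0" using assms by (auto simp: A_def flat_exp_def)
      then show ?thesis using AC(3)[of t] by (simp add: add_pos_nonneg)
    next
      case False
      then have "A t = 0" by (simp add: A_def flat_exp_def)
      then show ?thesis using AC(1)[of t] by simp
    qed
    then show ?thesis using AC(1)[of t] by (simp add: S_def)
  qed
  have smS: "smooth_on UNIV S" unfolding S_def
  proof (intro smooth_on_mult smooth_on_add smA smC)
    show "smooth_on UNIV (\<lambda>t::real. t)" by (rule id)
    show "smooth_on UNIV (\<lambda>x. (A x + C x) powr - 1)"
      by (rule smooth_on_compose[where f = "\<lambda>x. A x + C x", OF open_UNIV open_greaterThan _
            smooth_on_add[OF open_UNIV smA smC] smooth_on_powr]) (use AC(1) in auto)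
  qed auto
  define H where "H = (\<lambda>t. S t powr (- 1 / 2))"
  have "smooth_on UNIV H" unfolding H_def
    by (rule smooth_on_compose[where f = S, OF open_UNIV open_greaterThan _ smS smooth_on_powr])
       (use S_pos in auto)
  moreover have "H t * H t * t = 1" if "t > t\<^sub>0 / 2" for t
  proof -
    have "C t = 0" "A t > 0" "t > 0" using that assms by (auto simp: A_def C_def flat_exp_def)
    then have "S t = t" by (simp add: S_def powr_minus)
    then show ?thesis using \<open>t > 0\<close> unfolding H_def
      by (simp add: powr_minus powr_half_sqrt field_simps)
  qed
  ultimately show ?thesis using that by blast
qed

section \<open>Nondegenerate symmetric forms\<close>

locale nondegenerate_form =
  fixes h :: "'e::euclidean_space \<Rightarrow> 'e \<Rightarrow> real"
  assumes bilin: "bilinear h"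
    and sym: "h v w = h w v"
    and nondegenerate: "(\<And>w. h v w = 0) \<Longrightarrow> v = 0"
begin

lemma linear_right: "linear (h v)" and linear_left: "linear (\<lambda>v. h v w)"
  using bilin by (auto simp: bilinear_def)

text \<open>Through the Euclidean inner product \<open>h\<close> becomes an endomorphism
  \<open>G\<close> with \<open>h v w = w \<bullet> G v\<close>. Nondegeneracy makes \<open>G\<close>
  injective, hence surjective in finite dimension.\<close>

lemma ex_representing_vector:
  assumes "linear a"
  shows "\<exists>!v. h v = a"
proof -
  define G where "G v = (\<Sum>b\<in>Basis. h v b *\<^sub>R b)" for v
  have rep: "l w = w \<bullet> (\<Sum>b\<in>Basis. l b *\<^sub>R b)" if "linear l" for l :: "'e \<Rightarrow> real" and w
  proof -
    have "l w = l (\<Sum>b\<in>Basis. (w \<bullet> b) *\<^sub>R b)" by (simp add: euclidean_representation)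
    also have "\<dots> = w \<bullet> (\<Sum>b\<in>Basis. l b *\<^sub>R b)"
      by (simp add: linear_sum[OF that] linear_scale[OF that] inner_sum_right mult.commute)
    finally show ?thesis .
  qed
  have hG: "h v w = w \<bullet> G v" for v w unfolding G_def by (rule rep[OF linear_right])
  have "linear G"
  proof
    show "G (v + w) = G v + G w" for v w
      by (simp add: G_def linear_add[OF linear_left] scaleR_add_left sum.distrib)
    show "G (r *\<^sub>R v) = r *\<^sub>R G v" for r v
      by (simp add: G_def linear_scale[OF linear_left] scaleR_sum_right)
  qed
  have G0: "v = 0" if "G v = 0" for v
    using nondegenerate[of v] that by (simp add: hG)
  then have "inj G" using linear_injective_0[OF \<open>linear G\<close>] by blast
  then have "surj G" using linear_injective_imp_surjective[OF \<open>linear G\<close>] by blast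
  then obtain v where "G v = (\<Sum>b\<in>Basis. a b *\<^sub>R b)" by (metis surjD)
  then have "h v w = a w" for w by (simp add: hG rep[OF assms, of w])
  moreover have "v = v'" if "h v = h v'" for v v'
    using nondegenerate[of "v - v'"] that by (simp add: linear_diff[OF linear_left])
  ultimately show ?thesis by (metis ext)
qed

definition orthonormal :: "nat \<Rightarrow> (nat \<Rightarrow> 'e) \<Rightarrow> (nat \<Rightarrow> real) \<Rightarrow> bool" where
  "orthonormal k E \<epsilon> \<longleftrightarrow> (\<forall>i<k. \<epsilon> i \<in> {1, -1}) \<and>
     (\<forall>i<k. \<forall>j<k. h (E i) (E j) = (if i = j then \<epsilon> i else 0))"

text \<open>The sign occurs twice, in the coefficient and in \<open>h (E j) (E j)\<close>, and its
  square is 1. So the subtracted sum is the orthogonal projection in any signature.\<close>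

lemma orthonormal_remainder:
  assumes "orthonormal k E \<epsilon>" "j < k"
  shows "h (v - (\<Sum>i<k. (\<epsilon> i * h v (E i)) *\<^sub>R E i)) (E j) = 0"
proof -
  have "h (\<Sum>i<k. (\<epsilon> i * h v (E i)) *\<^sub>R E i) (E j) = (\<Sum>i<k. if i = j then \<epsilon> j * \<epsilon> j * h v (E j) else 0)"
    unfolding linear_sum[OF linear_left]
    by (rule sum.cong) (use assms in \<open>auto simp: orthonormal_def linear_scale[OF linear_left]\<close>)
  also have "\<dots> = h v (E j)"
    using assms by (auto simp: orthonormal_def)
  finally show ?thesis by (simp add: linear_diff[OF linear_left])
qed

text \<open>Pairing a linear relation with \<open>E j\<close> isolates the coefficient of
  \<open>E j\<close> times a nonzero sign.\<close>

lemma orthonormal_independent: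
  assumes "orthonormal k E \<epsilon>"
  shows "inj_on E {..<k}" "independent (E ` {..<k})"
proof -
  have ne: "\<epsilon> i \<noteq> 0" if "i < k" for i using assms that by (auto simp: orthonormal_def)
  show inj: "inj_on E {..<k}"
  proof (rule inj_onI)
    fix i j assume "i \<in> {..<k}" "j \<in> {..<k}" "E i = E j"
    then have "i < k" "j < k" "h (E i) (E j) = h (E i) (E i)" by auto
    then show "i = j" using assms ne[of i] by (simp add: orthonormal_def split: if_splits)
  qed
  show "independent (E ` {..<k})"
  proof
    assume "dependent (E ` {..<k})"
    then obtain u j where u: "(\<Sum>v\<in>E ` {..<k}. u v *\<^sub>R v) = 0" and j: "j < k" "u (E j) \<noteq> 0"
      by (auto simp: dependent_finite)
    have "0 = h (\<Sum>i<k. u (E i) *\<^sub>R E i) (E j)"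
      using u by (simp add: sum.reindex[OF inj] linear_0[OF linear_left])
    also have "\<dots> = (\<Sum>i<k. if i = j then u (E j) * \<epsilon> j else 0)"
      unfolding linear_sum[OF linear_left]
      by (rule sum.cong) (use assms j in \<open>auto simp: orthonormal_def linear_scale[OF linear_left]\<close>)
    also have "\<dots> = u (E j) * \<epsilon> j" using j by simp
    finally show False using j ne by simp
  qed
qed

text \<open>The remainder is orthogonal to every \<open>E i\<close>. These are independent and as
  many as the dimension, so they span the space, and nondegeneracy removes the remainder.\<close>

lemma orthonormal_expansion:
  assumes "orthonormal DIM('e) E \<epsilon>"
  shows "v = (\<Sum>i<DIM('e). (\<epsilon> i * h v (E i)) *\<^sub>R E i)"
proof -
  let ?w = "v - (\<Sum>i<DIM('e). (\<epsilon> i * h v (E i)) *\<^sub>R E i)"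
  note ind = orthonormal_independent[OF assms]
  have "UNIV \<subseteq> span (E ` {..<DIM('e)})"
    by (rule card_ge_dim_independent) (use ind in \<open>auto simp: card_image dim_UNIV\<close>)
  then have "h ?w x = 0" for x
  proof -
    have "x \<in> span (E ` {..<DIM('e)})" using \<open>UNIV \<subseteq> _\<close> by blast
    then show ?thesis
      by (induction rule: span_induct_alt)
         (auto simp: linear_0[OF linear_right] linear_add[OF linear_right]
            linear_scale[OF linear_right] orthonormal_remainder[OF assms])
  qed
  then show ?thesis using nondegenerate by (metis eq_iff_diff_eq_0)
qed

text \<open>A vector orthogonal to the family may be null. If all such vectors were null,
  polarisation would make \<open>h\<close> vanish on the orthogonal complement. Since complement and
  family together span the space, nondegeneracy would force the complement to be 0, and fewer than
  \<open>DIM('e)\<close> vectors would span everything.\<close>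

lemma orthonormal_extend:
  assumes "orthonormal k E \<epsilon>" "k < DIM('e)"
  shows "\<exists>v. (\<forall>i<k. h v (E i) = 0) \<and> h v v \<noteq> 0"
proof (rule ccontr)
  assume neg: "\<not> ?thesis"
  let ?W = "{v. \<forall>i<k. h v (E i) = 0}"
  have isotropic: "h v v = 0" if "v \<in> ?W" for v using neg that by blast
  have zero: "w = 0" if w: "w \<in> ?W" for w
  proof (rule nondegenerate)
    fix x
    define y where "y = x - (\<Sum>i<k. (\<epsilon> i * h x (E i)) *\<^sub>R E i)"
    have y: "y \<in> ?W" using orthonormal_remainder[OF assms(1)] by (simp add: y_def)
    have "w + y \<in> ?W" using w y by (simp add: linear_add[OF linear_left])
    then have "h w y = 0"
      using isotropic[of "w + y"] isotropic[OF w] isotropic[OF y] sym[of w y]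
      by (simp add: linear_add[OF linear_left] linear_add[OF linear_right])
    moreover have "h w (\<Sum>i<k. (\<epsilon> i * h x (E i)) *\<^sub>R E i) = 0"
      using w by (simp add: linear_sum[OF linear_right] linear_scale[OF linear_right])
    ultimately show "h w x = 0" by (simp add: y_def linear_diff[OF linear_right])
  qed
  have "x \<in> span (E ` {..<k})" for x
  proof -
    have "x - (\<Sum>i<k. (\<epsilon> i * h x (E i)) *\<^sub>R E i) = 0"
      by (rule zero) (use orthonormal_remainder[OF assms(1)] in simp)
    then have x: "x = (\<Sum>i<k. (\<epsilon> i * h x (E i)) *\<^sub>R E i)" by simp
    show ?thesis by (subst x) (rule span_sum, rule span_scale, rule span_base, simp)
  qed
  then have "DIM('e) \<le> card (E ` {..<k})"
    by (metis UNIV_I dim_UNIV dim_le_card finite_imageI finite_lessThan subsetI)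
  also have "\<dots> \<le> k" using card_image_le[of "{..<k}" E] by simp
  finally show False using assms(2) by simp
qed

end

section \<open>Charts\<close>

definition vfields :: "('a, 'e::euclidean_space) mfd \<Rightarrow> ('a, 'e) vfield set" where
  "vfields M = {X. \<forall>c\<in>atlas M. smooth_on (snd c ` fst c)
     (\<lambda>x. let q = chart_inv c x in coords M c q (X q))}"

locale manifold =
  fixes M :: "('a::{t2_space, second_countable_topology}, 'e::euclidean_space) mfd"
  assumes smooth_manifold: "smooth_manifold M"
begin

lemma chart:
  assumes "c \<in> atlas M"
  shows chart_open: "open (fst c)" and chart_open_image: "open (snd c ` fst c)"
    and chart_cont: "continuous_on (fst c) (snd c)"
    and chart_inv_cont: "continuous_on (snd c ` fst c) (chart_inv c)"
    and chart_inv_left: "q \<in> fst c \<Longrightarrow> chart_inv c (snd c q) = q"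
    and chart_inv_right: "x \<in> snd c ` fst c \<Longrightarrow> snd c (chart_inv c x) = x"
    and chart_inv_in: "x \<in> snd c ` fst c \<Longrightarrow> chart_inv c x \<in> fst c"
  using assms smooth_manifold
  unfolding smooth_manifold_def is_chart_def homeomorphism_def by blast+

lemma chart_at: "chart_at M p \<in> atlas M" "p \<in> fst (chart_at M p)"
  using smooth_manifold by (auto simp: smooth_manifold_def)

lemma chart_open_restrict:
  assumes "c \<in> atlas M" "open V"
  shows "open (snd c ` (fst c \<inter> V))"
proof -
  have "snd c ` (fst c \<inter> V) = chart_inv c -` V \<inter> snd c ` fst c"
    using chart_inv_left[OF assms(1)] by (auto simp: image_iff)
  moreover have "open \<dots>"
    using chart_inv_cont[OF assms(1)] chart_open_image[OF assms(1)] assms(2)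
    by (simp add: continuous_on_open_vimage)
  ultimately show ?thesis by simp
qed

lemma smooth_transition:
  "c \<in> atlas M \<Longrightarrow> d \<in> atlas M \<Longrightarrow> smooth_on (snd c ` (fst c \<inter> fst d)) (snd d \<circ> chart_inv c)"
  using smooth_manifold by (auto simp: smooth_manifold_def)

lemma smooth_on_chart_local:
  assumes "c \<in> atlas M"
    and "\<And>q. q \<in> fst c \<Longrightarrow> \<exists>U. open U \<and> q \<in> U \<and> smooth_on (snd c ` (fst c \<inter> U)) k"
  shows "smooth_on (snd c ` fst c) k"
proof (rule smooth_on_local)
  fix x assume "x \<in> snd c ` fst c"
  then obtain q where q: "q \<in> fst c" "x = snd c q" by auto
  then obtain U where "open U" "q \<in> U" "smooth_on (snd c ` (fst c \<inter> U)) k" using assms(2) by blast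
  then show "\<exists>T. open T \<and> x \<in> T \<and> smooth_on T k"
    using q chart_open_restrict[OF assms(1)] by blast
qed

text \<open>The derivative of the coordinate change from \<open>c\<close> to \<open>d\<close>.
  \<open>coords\<close> and \<open>coord_vec\<close> are the cases in which one chart is the
  distinguished one, so a single chain rule governs all changes of components.\<close>

definition jac :: "('a, 'e) chart \<Rightarrow> ('a, 'e) chart \<Rightarrow> 'a \<Rightarrow> 'e \<Rightarrow> 'e" where
  "jac c d q = frechet_derivative (snd d \<circ> chart_inv c) (at (snd c q))"

lemma coords_jac: "coords M c p = jac (chart_at M p) c p"
  and coord_vec_jac: "coord_vec M c p = jac c (chart_at M p) p"
  by (simp_all add: coords_def coord_vec_def jac_def)

lemma has_derivative_jac:
  assumes "c \<in> atlas M" "d \<in> atlas M" "q \<in> fst c" "q \<in> fst d"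
  shows "((snd d \<circ> chart_inv c) has_derivative jac c d q) (at (snd c q))"
  unfolding jac_def
  using smooth_on_has_derivative[OF smooth_transition[OF assms(1,2)]] assms by blast

lemma linear_jac:
  assumes "c \<in> atlas M" "d \<in> atlas M" "q \<in> fst c" "q \<in> fst d"
  shows "linear (jac c d q)"
  using has_derivative_jac[OF assms] by (rule has_derivative_linear)

lemma jac_jac:
  assumes "c \<in> atlas M" "d \<in> atlas M" "e \<in> atlas M" "q \<in> fst c" "q \<in> fst d" "q \<in> fst e"
  shows "jac d e q (jac c d q v) = jac c e q v"
proof -
  have "((snd e \<circ> chart_inv d) has_derivative jac d e q) (at ((snd d \<circ> chart_inv c) (snd c q)))"
    using has_derivative_jac[OF assms(2,3,5,6)] by (simp add: chart_inv_left[OF assms(1,4)])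
  from diff_chain_at[OF has_derivative_jac[OF assms(1,2,4,5)] this]
  have "(((snd e \<circ> chart_inv d) \<circ> (snd d \<circ> chart_inv c)) has_derivative jac d e q \<circ> jac c d q)
      (at (snd c q))" .
  \<comment> \<open>The composite agrees with the direct coordinate change only on the overlap of
    \<open>c\<close> and \<open>d\<close>, which is open in the coordinates of
    \<open>c\<close>.\<close>
  then have "((snd e \<circ> chart_inv c) has_derivative jac d e q \<circ> jac c d q) (at (snd c q))"
  proof (rule has_derivative_transform_within_open)
    show "open (snd c ` (fst c \<inter> fst d))"
      by (intro chart_open_restrict chart_open assms)
    show "snd c q \<in> snd c ` (fst c \<inter> fst d)" using assms by blast
    fix x assume "x \<in> snd c ` (fst c \<inter> fst d)"
    then show "(snd e \<circ> chart_inv d \<circ> (snd d \<circ> chart_inv c)) x = (snd e \<circ> chart_inv c) x"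
      by (auto simp: chart_inv_left[OF assms(1)] chart_inv_left[OF assms(2)])
  qed
  from frechet_derivative_eqI[OF this] show ?thesis by (simp add: jac_def fun_eq_iff)
qed

lemma jac_refl:
  assumes "c \<in> atlas M" "q \<in> fst c"
  shows "jac c c q = (\<lambda>v. v)"
proof -
  have "((\<lambda>x. x) has_derivative (\<lambda>v. v)) (at (snd c q))" by simp
  then have "((snd c \<circ> chart_inv c) has_derivative (\<lambda>v. v)) (at (snd c q))"
    by (rule has_derivative_transform_within_open[OF _ chart_open_image[OF assms(1)]])
       (use assms chart_inv_right[OF assms(1)] in auto)
  from frechet_derivative_eqI[OF this] show ?thesis by (simp add: jac_def)
qed

lemma
  assumes "c \<in> atlas M" "q \<in> fst c"
  shows linear_coords: "linear (coords M c q)"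
    and linear_coord_vec: "linear (coord_vec M c q)"
    and coords_coord_vec: "coords M c q (coord_vec M c q v) = v"
    and coord_vec_coords: "coord_vec M c q (coords M c q v) = v"
  unfolding coords_jac coord_vec_jac
  using assms chart_at[of q] by (simp_all add: linear_jac jac_jac jac_refl)

lemma coord_vec_chart_at: "coord_vec M (chart_at M p) p = (\<lambda>v. v)"
  unfolding coord_vec_jac using jac_refl chart_at by blast

lemma coords_coord_vec_jac:
  assumes "c \<in> atlas M" "d \<in> atlas M" "q \<in> fst c" "q \<in> fst d"
  shows "coords M d q (coord_vec M c q v) = jac c d q v"
  unfolding coords_jac coord_vec_jac using assms chart_at[of q] by (simp add: jac_jac)

lemma vector_expansion:
  assumes "c \<in> atlas M" "q \<in> fst c"
  shows "v = (\<Sum>b\<in>Basis. (coords M c q v \<bullet> b) *\<^sub>R coord_vec M c q b)"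
proof -
  have "v = coord_vec M c q (\<Sum>b\<in>Basis. (coords M c q v \<bullet> b) *\<^sub>R b)"
    by (simp add: euclidean_representation coord_vec_coords[OF assms])
  then show ?thesis
    by (simp add: linear_sum[OF linear_coord_vec[OF assms]] linear_scale[OF linear_coord_vec[OF assms]])
qed

section \<open>Smooth functions, vector fields and forms\<close>

lemma smooth_fun_chart:
  "smooth_fun M u \<Longrightarrow> c \<in> atlas M \<Longrightarrow> smooth_on (snd c ` fst c) (\<lambda>x. u (chart_inv c x))"
  by (auto simp: smooth_fun_def o_def)

lemma smooth_fun_const: "smooth_fun M (\<lambda>q. r)"
  by (simp add: smooth_fun_def o_def smooth_on_const)

lemma smooth_fun_mult: "smooth_fun M u \<Longrightarrow> smooth_fun M w \<Longrightarrow> smooth_fun M (\<lambda>q. u q * w q)"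
  by (auto simp: smooth_fun_def o_def intro!: smooth_on_mult chart_open_image)

lemma smooth_fun_sum:
  "finite I \<Longrightarrow> (\<And>i. i \<in> I \<Longrightarrow> smooth_fun M (u i)) \<Longrightarrow> smooth_fun M (\<lambda>q. \<Sum>i\<in>I. u i q)"
  by (auto simp: smooth_fun_def o_def intro!: smooth_on_sum chart_open_image)

lemma smooth_fun_compose:
  assumes "smooth_fun M u" "open T" "range u \<subseteq> T" "smooth_on T H"
  shows "smooth_fun M (\<lambda>q. H (u q))"
  unfolding smooth_fun_def o_def
proof
  fix c assume c: "c \<in> atlas M"
  show "smooth_on (snd c ` fst c) (\<lambda>x. H (u (chart_inv c x)))"
    by (rule smooth_on_compose[OF chart_open_image[OF c] assms(2) _ smooth_fun_chart[OF assms(1) c] assms(4)])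
       (use assms(3) in auto)
qed

lemma smooth_fun_local:
  assumes "\<And>p. \<exists>U w. open U \<and> p \<in> U \<and> smooth_fun M w \<and> (\<forall>q\<in>U. u q = w q)"
  shows "smooth_fun M u"
  unfolding smooth_fun_def
proof
  fix c assume c: "c \<in> atlas M"
  show "smooth_on (snd c ` fst c) (u \<circ> chart_inv c)"
  proof (rule smooth_on_chart_local[OF c])
    fix q assume "q \<in> fst c"
    obtain U w where U: "open U" "q \<in> U" "smooth_fun M w" "\<forall>q\<in>U. u q = w q" using assms by blast
    have "smooth_on (snd c ` (fst c \<inter> U)) (\<lambda>x. w (chart_inv c x))"
      using smooth_fun_chart[OF U(3) c] by (rule smooth_on_subset) auto
    then have "smooth_on (snd c ` (fst c \<inter> U)) (u \<circ> chart_inv c)"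
      by (rule smooth_on_cong[OF chart_open_restrict[OF c U(1)]])
         (use U(4) chart_inv_left[OF c] in auto)
    then show "\<exists>U. open U \<and> q \<in> U \<and> smooth_on (snd c ` (fst c \<inter> U)) (u \<circ> chart_inv c)"
      using U by blast
  qed
qed

lemma smooth_fun_continuous: assumes "smooth_fun M u" shows "continuous_on UNIV u"
proof (rule continuous_at_imp_continuous_on, rule ballI)
  fix p
  let ?c = "chart_at M p"
  note c = chart_at[of p]
  have "continuous_on (snd ?c ` fst ?c) (\<lambda>x. u (chart_inv ?c x))"
    by (rule smooth_on_continuous_on[OF smooth_fun_chart[OF assms c(1)]])
  then have "continuous_on (fst ?c) (\<lambda>q. u (chart_inv ?c (snd ?c q)))"
    by (rule continuous_on_compose2[OF _ chart_cont[OF c(1)]]) simp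
  then have "continuous_on (fst ?c) u"
    by (rule continuous_on_eq) (simp add: chart_inv_left[OF c(1)])
  then show "isCont u p" using c chart_open[OF c(1)] by (simp add: continuous_on_eq_continuous_at)
qed

lemma smooth_fun_differentiable:
  assumes "smooth_fun M u"
  shows "(u \<circ> chart_inv (chart_at M p)) differentiable (at (snd (chart_at M p) p))"
  using assms chart_at[of p] smooth_on_differentiable unfolding smooth_fun_def by blast

lemma linear_ext_d: "smooth_fun M u \<Longrightarrow> linear (ext_d M u p)"
  unfolding ext_d_def using smooth_fun_differentiable frechet_derivative_works has_derivative_linear by blast

section \<open>Vector fields and 1-forms\<close>

lemma vfields_chart:
  "X \<in> vfields M \<Longrightarrow> c \<in> atlas M \<Longrightarrow>
    smooth_on (snd c ` fst c) (\<lambda>x. coords M c (chart_inv c x) (X (chart_inv c x)))"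
  by (simp add: vfields_def Let_def)

lemma vfieldsI:
  "(\<And>c. c \<in> atlas M \<Longrightarrow> smooth_on (snd c ` fst c) (\<lambda>x. coords M c (chart_inv c x) (X (chart_inv c x))))
    \<Longrightarrow> X \<in> vfields M"
  by (simp add: vfields_def Let_def)

lemma vfields_add:
  assumes "X \<in> vfields M" "Y \<in> vfields M"
  shows "(\<lambda>q. X q + Y q) \<in> vfields M"
proof (rule vfieldsI)
  fix c assume c: "c \<in> atlas M"
  show "smooth_on (snd c ` fst c) (\<lambda>x. coords M c (chart_inv c x) (X (chart_inv c x) + Y (chart_inv c x)))"
    by (rule smooth_on_cong[OF chart_open_image[OF c] smooth_on_add[OF chart_open_image[OF c]
          vfields_chart[OF assms(1) c] vfields_chart[OF assms(2) c]]])
       (simp add: linear_add[OF linear_coords[OF c chart_inv_in[OF c]]])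
qed

lemma vfields_scale:
  assumes "smooth_fun M u" "X \<in> vfields M"
  shows "(\<lambda>q. u q *\<^sub>R X q) \<in> vfields M"
proof (rule vfieldsI)
  fix c assume c: "c \<in> atlas M"
  show "smooth_on (snd c ` fst c) (\<lambda>x. coords M c (chart_inv c x) (u (chart_inv c x) *\<^sub>R X (chart_inv c x)))"
    by (rule smooth_on_cong[OF chart_open_image[OF c] smooth_on_scaleR[OF chart_open_image[OF c]
          smooth_fun_chart[OF assms(1) c] vfields_chart[OF assms(2) c]]])
       (simp add: linear_scale[OF linear_coords[OF c chart_inv_in[OF c]]])
qed

lemma vfields_zero: "(\<lambda>q. 0) \<in> vfields M"
proof (rule vfieldsI)
  fix c assume c: "c \<in> atlas M"
  show "smooth_on (snd c ` fst c) (\<lambda>x. coords M c (chart_inv c x) 0)"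
    by (rule smooth_on_cong[OF chart_open_image[OF c] smooth_on_const[of _ 0]])
       (simp add: linear_0[OF linear_coords[OF c chart_inv_in[OF c]]])
qed

lemma vfields_sum:
  "finite I \<Longrightarrow> (\<And>i. i \<in> I \<Longrightarrow> X i \<in> vfields M) \<Longrightarrow> (\<lambda>q. \<Sum>i\<in>I. X i q) \<in> vfields M"
  by (induction I rule: finite_induct) (auto intro: vfields_zero vfields_add)

lemma formsI:
  "(\<And>p. linear (\<alpha> p)) \<Longrightarrow> (\<And>c e. c \<in> atlas M \<Longrightarrow> smooth_on (snd c ` fst c)
      (\<lambda>x. \<alpha> (chart_inv c x) (coord_vec M c (chart_inv c x) e))) \<Longrightarrow> \<alpha> \<in> forms M"
  by (simp add: forms_def Let_def)

lemma forms_linear: "\<alpha> \<in> forms M \<Longrightarrow> linear (\<alpha> p)"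
  by (simp add: forms_def)

lemma forms_chart:
  "\<alpha> \<in> forms M \<Longrightarrow> c \<in> atlas M \<Longrightarrow>
    smooth_on (snd c ` fst c) (\<lambda>x. \<alpha> (chart_inv c x) (coord_vec M c (chart_inv c x) e))"
  by (simp add: forms_def Let_def)

text \<open>In a chart the contraction is a finite sum of products of components.\<close>

lemma smooth_fun_form_apply:
  assumes "\<alpha> \<in> forms M" "X \<in> vfields M"
  shows "smooth_fun M (\<lambda>q. \<alpha> q (X q))"
  unfolding smooth_fun_def o_def
proof
  fix c assume c: "c \<in> atlas M"
  note op = chart_open_image[OF c]
  have "smooth_on (snd c ` fst c) (\<lambda>x. \<Sum>b\<in>Basis. (coords M c (chart_inv c x) (X (chart_inv c x)) \<bullet> b) *
          \<alpha> (chart_inv c x) (coord_vec M c (chart_inv c x) b))"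
    by (intro smooth_on_sum smooth_on_mult smooth_on_inner op finite_Basis
        vfields_chart[OF assms(2) c] forms_chart[OF assms(1) c])
  then show "smooth_on (snd c ` fst c) (\<lambda>x. \<alpha> (chart_inv c x) (X (chart_inv c x)))"
  proof (rule smooth_on_cong[OF op])
    fix x assume x: "x \<in> snd c ` fst c"
    let ?q = "chart_inv c x"
    note lin = forms_linear[OF assms(1), of ?q]
    show "(\<Sum>b\<in>Basis. (coords M c ?q (X ?q) \<bullet> b) * \<alpha> ?q (coord_vec M c ?q b)) = \<alpha> ?q (X ?q)"
      by (subst (2) vector_expansion[OF c chart_inv_in[OF c x]])
         (simp add: linear_sum[OF lin] linear_scale[OF lin])
  qed
qed

text \<open>A field with constant coefficients in the chart at \<open>p\<close> is cut off by a bump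
  function and extended by zero. Such fields supply the frames and, after lowering the index, forms
  with prescribed value.\<close>

lemma ex_vfield_value: "\<exists>X\<in>vfields M. X p = v"
proof -
  define c where "c = chart_at M p"
  have c: "c \<in> atlas M" "p \<in> fst c" using chart_at by (auto simp: c_def)
  define x\<^sub>0 where "x\<^sub>0 = snd c p"
  obtain r where r: "r > 0" "cball x\<^sub>0 r \<subseteq> snd c ` fst c"
    using chart_open_image[OF c(1)] c(2) unfolding x\<^sub>0_def by (meson image_eqI open_contains_cball)
  \<comment> \<open>Positive inside the ball and zero outside. The squared distance is spelled out
    in coordinates so that smoothness follows from sums and products.\<close>
  define \<rho> where "\<rho> x = flat_exp 0 (r\<^sup>2 + - (\<Sum>b\<in>Basis. ((x + - x\<^sub>0) \<bullet> b) * ((x + - x\<^sub>0) \<bullet> b)))" for x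
  have \<rho>_eq: "\<rho> x = flat_exp 0 (r\<^sup>2 - (dist x x\<^sub>0)\<^sup>2)" for x
    unfolding \<rho>_def euclidean_inner[of "x + - x\<^sub>0" "x + - x\<^sub>0", symmetric]
    by (simp add: dist_norm power2_norm_eq_inner)
  have \<rho>_pos: "\<rho> x\<^sub>0 > 0" using r by (simp add: \<rho>_eq flat_exp_def)
  have \<rho>_zero: "\<rho> x = 0" if "x \<notin> cball x\<^sub>0 r" for x
  proof -
    have "r < dist x x\<^sub>0" using that by (simp add: dist_commute)
    then have "r\<^sup>2 < (dist x x\<^sub>0)\<^sup>2" using r by (simp add: power_strict_mono)
    then show ?thesis by (simp add: \<rho>_eq flat_exp_def)
  qed
  have id: "smooth_on UNIV (\<lambda>x::'e. x)" and neg: "smooth_on UNIV (\<lambda>x::real. - x)"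
    by (rule smooth_on_linear, simp add: linear_iff)+
  have "smooth_on UNIV (\<lambda>x::'e. \<Sum>b\<in>Basis. ((x + - x\<^sub>0) \<bullet> b) * ((x + - x\<^sub>0) \<bullet> b))"
    by (intro smooth_on_sum smooth_on_mult smooth_on_inner smooth_on_add id smooth_on_const) auto
  then have "smooth_on UNIV (\<lambda>x::'e. r\<^sup>2 + - (\<Sum>b\<in>Basis. ((x + - x\<^sub>0) \<bullet> b) * ((x + - x\<^sub>0) \<bullet> b)))"
    by (intro smooth_on_add smooth_on_const open_UNIV
        smooth_on_compose[where g = uminus, OF open_UNIV open_UNIV subset_UNIV _ neg])
  then have sm\<rho>: "smooth_on UNIV \<rho>" unfolding \<rho>_def
    by (rule smooth_on_compose[where g = "flat_exp 0", OF open_UNIV open_UNIV subset_UNIV _ smooth_on_flat_exp])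
  define X where "X q = (if q \<in> fst c then (\<rho> (snd c q) * inverse (\<rho> x\<^sub>0)) *\<^sub>R coord_vec M c q v else 0)" for q
  \<comment> \<open>\<open>X\<close> vanishes off \<open>K\<close>. Being compact in a Hausdorff
    space, \<open>K\<close> is closed, so its open complement and the domain of \<open>c\<close>
    cover the manifold and smoothness can be checked on each.\<close>
  define K where "K = chart_inv c ` cball x\<^sub>0 r"
  have "compact K" unfolding K_def
    by (rule compact_continuous_image[OF continuous_on_subset[OF chart_inv_cont[OF c(1)] r(2)] compact_cball])
  then have opK: "open (- K)" using compact_imp_closed by auto
  have X0: "X q = 0" if "q \<notin> K" for q
  proof (cases "q \<in> fst c")
    case True
    have "snd c q \<notin> cball x\<^sub>0 r"
    proof
      assume "snd c q \<in> cball x\<^sub>0 r"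
      then have "chart_inv c (snd c q) \<in> K" unfolding K_def by blast
      then show False using that chart_inv_left[OF c(1) True] by simp
    qed
    then show ?thesis by (simp add: X_def \<rho>_zero)
  qed (simp add: X_def)
  have "X \<in> vfields M"
  proof (rule vfieldsI, rule smooth_on_chart_local)
    fix d q assume d: "d \<in> atlas M" and q: "q \<in> fst d"
    let ?Y = "\<lambda>x. coords M d (chart_inv d x) (X (chart_inv d x))"
    show "\<exists>U. open U \<and> q \<in> U \<and> smooth_on (snd d ` (fst d \<inter> U)) ?Y"
    proof (cases "q \<in> fst c")
      case True
      \<comment> \<open>On the overlap with \<open>c\<close>, the components of \<open>X\<close> in
        the chart \<open>d\<close> are the normalised cutoff times the Jacobian from
        \<open>c\<close> to \<open>d\<close> applied to \<open>v\<close>.\<close>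
      let ?S = "snd d ` (fst d \<inter> fst c)"
      let ?T = "snd c ` (fst c \<inter> fst d)"
      let ?t = "snd c \<circ> chart_inv d"
      have opS: "open ?S" and opT: "open ?T"
        using chart_open_restrict chart_open c d by blast+
      have smt: "smooth_on ?S ?t" by (rule smooth_transition[OF d c(1)])
      have 1: "smooth_on ?S (\<lambda>x. \<rho> (?t x))"
        by (rule smooth_on_compose[OF opS open_UNIV subset_UNIV smt sm\<rho>])
      have 2: "smooth_on ?S (\<lambda>x. frechet_derivative (snd d \<circ> chart_inv c) (at (?t x)) v)"
        by (rule smooth_on_compose[OF opS opT _ smt smooth_on_frechet_derivative[OF smooth_transition[OF c(1) d]]])
           (auto simp: chart_inv_left[OF d])
      have "smooth_on ?S (\<lambda>x. (\<rho> (?t x) * inverse (\<rho> x\<^sub>0)) *\<^sub>R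
          frechet_derivative (snd d \<circ> chart_inv c) (at (?t x)) v)"
        by (intro smooth_on_scaleR smooth_on_mult smooth_on_const opS 1 2)
      then have "smooth_on ?S ?Y"
      proof (rule smooth_on_cong[OF opS])
        fix x assume "x \<in> ?S"
        then obtain q' where q': "q' \<in> fst d" "q' \<in> fst c" "x = snd d q'" by blast
        then show "(\<rho> (?t x) * inverse (\<rho> x\<^sub>0)) *\<^sub>R
            frechet_derivative (snd d \<circ> chart_inv c) (at (?t x)) v = ?Y x"
          using coords_coord_vec_jac[OF c(1) d q'(2,1)]
          by (simp add: X_def chart_inv_left[OF d] linear_scale[OF linear_coords[OF d q'(1)]] jac_def)
      qed
      then show ?thesis using True chart_open[OF c(1)] by blast
    next
      case False
      have "q \<notin> K"
        using False r(2) chart_inv_in[OF c(1)] unfolding K_def by blast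
      have "smooth_on (snd d ` (fst d \<inter> - K)) ?Y"
        by (rule smooth_on_cong[OF chart_open_restrict[OF d opK] smooth_on_const[of _ 0]])
           (auto simp: chart_inv_left[OF d] X0 linear_0[OF linear_coords[OF d]])
      then show ?thesis using opK \<open>q \<notin> K\<close> by blast
    qed
  qed
  moreover have "X p = v"
    using c \<rho>_pos coord_vec_chart_at[of p] by (simp add: X_def x\<^sub>0_def c_def)
  ultimately show ?thesis by blast
qed

end

section \<open>Metrics and orthonormal coframes\<close>

locale metric_manifold = manifold M
  for M :: "('a::{t2_space, second_countable_topology}, 'e::euclidean_space) mfd" +
  fixes g :: "('a, 'e) metric"
  assumes metric: "pseudo_riemannian_metric M g"
begin

lemma metric_at: "nondegenerate_form (g p)"
proof
  show "bilinear (g p)" "g p v w = g p w v" for v w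
    using metric by (auto simp: pseudo_riemannian_metric_def)
  show "v = 0" if "\<And>w. g p v w = 0" for v
    using metric that unfolding pseudo_riemannian_metric_def by blast
qed

lemmas metric_linear_right = nondegenerate_form.linear_right[OF metric_at]
  and metric_linear_left = nondegenerate_form.linear_left[OF metric_at]
  and metric_sym = nondegenerate_form.sym[OF metric_at]

abbreviation "orthonormal_at q \<equiv> nondegenerate_form.orthonormal (g q)"

lemma metric_form:
  assumes "X \<in> vfields M"
  shows "(\<lambda>q. g q (X q)) \<in> forms M"
proof (rule formsI)
  show "linear (g p (X p))" for p by (rule metric_linear_right)
  fix c e assume c: "c \<in> atlas M"
  note op = chart_open_image[OF c]
  have "smooth_on (snd c ` fst c) (\<lambda>x. g (chart_inv c x) (coord_vec M c (chart_inv c x) b)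
      (coord_vec M c (chart_inv c x) e))" for b
    using metric c by (simp add: pseudo_riemannian_metric_def Let_def)
  then have "smooth_on (snd c ` fst c) (\<lambda>x. \<Sum>b\<in>Basis. (coords M c (chart_inv c x) (X (chart_inv c x)) \<bullet> b) *
          g (chart_inv c x) (coord_vec M c (chart_inv c x) b) (coord_vec M c (chart_inv c x) e))"
    by (intro smooth_on_sum smooth_on_mult smooth_on_inner op finite_Basis vfields_chart[OF assms c])
  then show "smooth_on (snd c ` fst c)
      (\<lambda>x. g (chart_inv c x) (X (chart_inv c x)) (coord_vec M c (chart_inv c x) e))"
  proof (rule smooth_on_cong[OF op])
    fix x assume x: "x \<in> snd c ` fst c"
    let ?q = "chart_inv c x"
    note lin = metric_linear_left[of ?q]
    show "(\<Sum>b\<in>Basis. (coords M c ?q (X ?q) \<bullet> b) * g ?q (coord_vec M c ?q b) (coord_vec M c ?q e))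
        = g ?q (X ?q) (coord_vec M c ?q e)"
      by (subst (2) vector_expansion[OF c chart_inv_in[OF c x]])
         (simp add: linear_sum[OF lin] linear_scale[OF lin])
  qed
qed

lemma smooth_fun_metric:
  "X \<in> vfields M \<Longrightarrow> Y \<in> vfields M \<Longrightarrow> smooth_fun M (\<lambda>q. g q (X q) (Y q))"
  by (rule smooth_fun_form_apply[OF metric_form])

text \<open>Gram-Schmidt by induction on the number of fields. The fields live on the whole
  manifold; only the set on which they are orthonormal shrinks at each stage.\<close>

lemma ex_local_frame:
  assumes "k \<le> DIM('e)"
  shows "\<exists>U E \<epsilon>. open U \<and> p \<in> U \<and> (\<forall>i<k. E i \<in> vfields M) \<and> (\<forall>q\<in>U. orthonormal_at q k (\<lambda>i. E i q) \<epsilon>)"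
  using assms
proof (induction k)
  case 0
  show ?case
    by (rule exI[of _ UNIV]) (simp add: nondegenerate_form.orthonormal_def[OF metric_at])
next
  case (Suc k)
  then have "\<exists>U E \<epsilon>. open U \<and> p \<in> U \<and> (\<forall>i<k. E i \<in> vfields M) \<and>
      (\<forall>q\<in>U. orthonormal_at q k (\<lambda>i. E i q) \<epsilon>)" by simp
  then obtain U E \<epsilon> where U: "open U" "p \<in> U" and "\<forall>i<k. E i \<in> vfields M"
    and "\<forall>q\<in>U. orthonormal_at q k (\<lambda>i. E i q) \<epsilon>" by blast
  then have E: "\<And>i. i < k \<Longrightarrow> E i \<in> vfields M"
    and on: "\<And>q. q \<in> U \<Longrightarrow> orthonormal_at q k (\<lambda>i. E i q) \<epsilon>" by blast+
  have k: "k < DIM('e)" using Suc by simp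
  obtain v where v: "\<And>i. i < k \<Longrightarrow> g p v (E i p) = 0" "g p v v \<noteq> 0"
    using nondegenerate_form.orthonormal_extend[OF metric_at on[OF U(2)] k] by blast
  obtain Y where Y: "Y \<in> vfields M" "Y p = v" using ex_vfield_value by blast
  \<comment> \<open>Subtracting projections makes \<open>W\<close> orthogonal to the frame on all of
    \<open>U\<close> and keeps the value \<open>v\<close> at \<open>p\<close>, because
    \<open>v\<close> is already orthogonal to the frame there.\<close>
  define W where "W q = Y q + (-1) *\<^sub>R (\<Sum>i<k. (\<epsilon> i * g q (Y q) (E i q)) *\<^sub>R E i q)" for q
  have W: "W \<in> vfields M" unfolding W_def
    by (intro vfields_add Y vfields_scale[OF smooth_fun_const] vfields_sum vfields_scale
        smooth_fun_mult smooth_fun_const smooth_fun_metric) (auto intro: E)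
  have W_perp: "g q (W q) (E i q) = 0" if "q \<in> U" "i < k" for q i
    using nondegenerate_form.orthonormal_remainder[OF metric_at on[OF that(1)] that(2)] by (simp add: W_def)
  have Wp: "W p = v" using v by (simp add: W_def Y)
  \<comment> \<open>The sign makes \<open>u\<close> positive at \<open>p\<close>. On
    \<open>V\<close> below, \<open>u\<close> exceeds half of that value, which is the range where
    \<open>H\<close> inverts the square root, so the normalised field has square
    \<open>s\<close>.\<close>
  define s where "s = sgn (g p v v)"
  have s: "s \<in> {1, -1}" "s * s = 1" using v(2) by (auto simp: s_def sgn_if)
  define u where "u q = s * g q (W q) (W q)" for q
  have smu: "smooth_fun M u"
    unfolding u_def by (intro smooth_fun_mult smooth_fun_const smooth_fun_metric W)
  have "u p > 0" using v(2) by (simp add: u_def Wp s_def sgn_if)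
  then obtain H where H: "smooth_on UNIV H" "\<And>t. t > u p / 2 \<Longrightarrow> H t * H t * t = 1"
    using smooth_inverse_sqrt_exists by blast
  define N where "N q = H (u q) *\<^sub>R W q" for q
  have N: "N \<in> vfields M" unfolding N_def
    by (rule vfields_scale[OF smooth_fun_compose[OF smu open_UNIV subset_UNIV H(1)] W])
  define V where "V = U \<inter> {q. u p / 2 < u q}"
  have "open {q. u p / 2 < u q}"
    by (intro open_Collect_less continuous_on_const smooth_fun_continuous smu)
  then have V: "open V" "p \<in> V" "V \<subseteq> U" using U \<open>u p > 0\<close> by (auto simp: V_def)
  have NN: "g q (N q) (N q) = s" if "q \<in> V" for q
  proof -
    have "g q (N q) (N q) = (s * s) * (H (u q) * H (u q) * g q (W q) (W q))"
      by (simp add: s(2) N_def linear_scale[OF metric_linear_left] linear_scale[OF metric_linear_right])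
    also have "\<dots> = s * (H (u q) * H (u q) * u q)" by (simp only: u_def ac_simps)
    finally have "g q (N q) (N q) = s * (H (u q) * H (u q) * u q)" .
    then show ?thesis using H(2)[of "u q"] that by (simp add: V_def)
  qed
  have NE: "g q (N q) (E i q) = 0" "g q (E i q) (N q) = 0" if "q \<in> V" "i < k" for q i
    using W_perp[of q i] that V(3) metric_sym[of q "E i q"]
    by (auto simp: N_def linear_scale[OF metric_linear_left])
  have "orthonormal_at q (Suc k) (\<lambda>i. (E(k := N)) i q) (\<epsilon>(k := s))" if "q \<in> V" for q
    using on[of q] V(3) that NN[OF that] NE[OF that] s(1)
    unfolding nondegenerate_form.orthonormal_def[OF metric_at] by (auto simp: less_Suc_eq)
  moreover have "\<forall>i<Suc k. (E(k := N)) i \<in> vfields M" using E N by (simp add: less_Suc_eq)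
  ultimately show ?case using V by blast
qed

section \<open>The cometric and local coframes\<close>

lemma metric_dual_vec: "linear a \<Longrightarrow> g p (dual_vec g p a) = a"
  unfolding dual_vec_def by (rule theI') (rule nondegenerate_form.ex_representing_vector[OF metric_at])

lemma dual_vec_metric: "dual_vec g p (g p v) = v"
  unfolding dual_vec_def
  by (rule the1_equality[OF nondegenerate_form.ex_representing_vector[OF metric_at]])
     (simp_all add: metric_linear_right)

lemma cometric_metric: "cometric g p (g p v) (g p w) = g p v w"
  by (simp add: cometric_def dual_vec_metric)

text \<open>Lowering cancels raising in the first argument. In this form linearity in
  \<open>a\<close> is visible.\<close>

lemma cometric_eq: "linear a \<Longrightarrow> cometric g p a b = a (dual_vec g p b)"
  by (simp add: cometric_def metric_dual_vec)

lemma cometric_sym: "cometric g p a b = cometric g p b a"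
  unfolding cometric_def by (rule metric_sym)

text \<open>Testing against the covector \<open>g p v\<close> returns \<open>a v\<close>.\<close>

lemma cometric_nondegenerate:
  fixes a :: "'e \<Rightarrow> real"
  assumes "linear a" "\<And>b. linear b \<Longrightarrow> cometric g p a b = 0"
  shows "a = (\<lambda>v. 0)"
proof
  fix v
  show "a v = 0"
    using assms(2)[OF metric_linear_right[of p v]] by (simp add: cometric_eq[OF assms(1)] dual_vec_metric)
qed

lemma cometric_frame:
  assumes "orthonormal_at p DIM('e) E \<epsilon>" "linear a" "linear b"
  shows "cometric g p a b = (\<Sum>i<DIM('e). \<epsilon> i * a (E i) * b (E i))"
proof -
  let ?v = "dual_vec g p a"
  have "cometric g p a b = b ?v"
    using assms by (simp add: cometric_sym[of p a] cometric_eq)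
  also have "\<dots> = b (\<Sum>i<DIM('e). (\<epsilon> i * g p ?v (E i)) *\<^sub>R E i)"
    using nondegenerate_form.orthonormal_expansion[OF metric_at assms(1), of ?v] by simp
  also have "\<dots> = (\<Sum>i<DIM('e). \<epsilon> i * a (E i) * b (E i))"
    by (simp add: linear_sum[OF assms(3)] linear_scale[OF assms(3)] metric_dual_vec[OF assms(2)])
  finally show ?thesis .
qed

text \<open>An orthonormal frame expresses the cometric without inverting the matrix of \<open>g\<close>.\<close>

lemma smooth_fun_cometric:
  assumes "\<alpha> \<in> forms M" "\<beta> \<in> forms M"
  shows "smooth_fun M (pairing (cometric g) \<alpha> \<beta>)"
proof (rule smooth_fun_local)
  fix p
  obtain U E \<epsilon> where U: "open U" "p \<in> U" "\<forall>i<DIM('e). E i \<in> vfields M"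
    and on: "\<forall>q\<in>U. orthonormal_at q DIM('e) (\<lambda>i. E i q) \<epsilon>"
    using ex_local_frame[of "DIM('e)" p] by auto
  have "smooth_fun M (\<lambda>q. \<Sum>i<DIM('e). \<epsilon> i * \<alpha> q (E i q) * \<beta> q (E i q))"
    using U by (intro smooth_fun_sum smooth_fun_mult smooth_fun_const smooth_fun_form_apply assms) auto
  moreover have "pairing (cometric g) \<alpha> \<beta> q = (\<Sum>i<DIM('e). \<epsilon> i * \<alpha> q (E i q) * \<beta> q (E i q))"
    if "q \<in> U" for q
    unfolding pairing_def
    by (rule cometric_frame[OF on[rule_format, OF that] forms_linear[OF assms(1)] forms_linear[OF assms(2)]])
  ultimately show "\<exists>U w. open U \<and> p \<in> U \<and> smooth_fun M w \<and> (\<forall>q\<in>U. pairing (cometric g) \<alpha> \<beta> q = w q)"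
    using U(1,2) by blast
qed

lemma ex_local_coframe:
  obtains U \<eta> \<epsilon> where "p \<in> U" "local_coframe M (cometric g) U \<eta> \<epsilon>"
proof -
  obtain U E \<epsilon> where U: "open U" "p \<in> U" "\<forall>i<DIM('e). E i \<in> vfields M"
    and on: "\<forall>q\<in>U. orthonormal_at q DIM('e) (\<lambda>i. E i q) \<epsilon>"
    using ex_local_frame[of "DIM('e)" p] by auto
  have "local_coframe M (cometric g) U (\<lambda>i q. g q (E i q)) \<epsilon>"
    using U on by (auto simp: local_coframe_def metric_form pairing_def cometric_metric
        nondegenerate_form.orthonormal_def[OF metric_at])
  then show ?thesis using that U by blast
qed

text \<open>Lowering the index of a vector field with prescribed value replaces a second
  construction with bump functions.\<close>

lemma ex_form_value:
  assumes "linear a"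
  obtains \<alpha> where "\<alpha> \<in> forms M" "\<alpha> p = a"
proof -
  obtain X where "X \<in> vfields M" "X p = dual_vec g p a" using ex_vfield_value by blast
  then show ?thesis
    using that[of "\<lambda>q. g q (X q)"] by (simp add: metric_form metric_dual_vec[OF assms])
qed

end

section \<open>Bivector fields\<close>

lemma anchor_unique:
  fixes P :: "('a, 'e::euclidean_space) cobilinear"
  assumes "\<And>b. linear b \<Longrightarrow> b v = P p (\<alpha> p) b"
  shows "anchor P \<alpha> p = v"
  unfolding anchor_def
proof (rule the_equality)
  show "\<forall>b. linear b \<longrightarrow> b v = P p (\<alpha> p) b" using assms by blast
  fix w assume w: "\<forall>b. linear b \<longrightarrow> b w = P p (\<alpha> p) b"
  have "w \<bullet> e = v \<bullet> e" for e
  proof -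
    have "linear (\<lambda>x. x \<bullet> e)" by (simp add: linear_iff inner_add_left)
    then show ?thesis using w assms by metis
  qed
  then show "w = v" by (rule euclidean_eqI)
qed

locale bivector_manifold = manifold M
  for M :: "('a::{t2_space, second_countable_topology}, 'e::euclidean_space) mfd" +
  fixes P :: "('a, 'e) cobilinear"
  assumes bivector: "bivector_field M P"
begin

lemma P_comb: "linear a \<Longrightarrow> linear b \<Longrightarrow> linear c \<Longrightarrow>
    P p (\<lambda>v. s * a v + t * b v) c = s * P p a c + t * P p b c"
  using bivector unfolding bivector_field_def by blast

lemma P_antisym: "linear a \<Longrightarrow> linear b \<Longrightarrow> P p a b = - P p b a"
  using bivector unfolding bivector_field_def by blast

lemma P_smooth:
  assumes "c \<in> atlas M" "linear a" "linear b"
  shows "smooth_on (snd c ` fst c)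
    (\<lambda>x. P (chart_inv c x) (a \<circ> coords M c (chart_inv c x)) (b \<circ> coords M c (chart_inv c x)))"
  using bivector assms unfolding bivector_field_def Let_def by blast

lemma P_zero: "linear c \<Longrightarrow> P p (\<lambda>v. 0) c = 0"
  using P_comb[of "\<lambda>v. 0" "\<lambda>v. 0" c p 0 0] by (simp add: linear_zero)

lemma linear_sum_functionals:
  fixes a :: "'i \<Rightarrow> 'e \<Rightarrow> real"
  assumes "\<And>i. i \<in> I \<Longrightarrow> linear (a i)"
  shows "linear (\<lambda>v. \<Sum>i\<in>I. s i * a i v)"
proof (rule linearI)
  show "(\<Sum>i\<in>I. s i * a i (v + w)) = (\<Sum>i\<in>I. s i * a i v) + (\<Sum>i\<in>I. s i * a i w)" for v w
    unfolding sum.distrib[symmetric]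
    by (rule sum.cong) (simp_all add: linear_add[OF assms] distrib_left)
  show "(\<Sum>i\<in>I. s i * a i (r *\<^sub>R v)) = r *\<^sub>R (\<Sum>i\<in>I. s i * a i v)" for r v
    unfolding scaleR_sum_right
    by (rule sum.cong) (simp_all add: linear_scale[OF assms])
qed

lemma P_sum:
  assumes "finite I" "\<And>i. i \<in> I \<Longrightarrow> linear (a i)" "linear c"
  shows "P p (\<lambda>v. \<Sum>i\<in>I. s i * a i v) c = (\<Sum>i\<in>I. s i * P p (a i) c)"
  using assms(1,2)
proof (induction I)
  case empty
  then show ?case using P_zero[OF assms(3)] by simp
next
  case (insert i I)
  have "P p (\<lambda>v. s i * a i v + 1 * (\<Sum>i\<in>I. s i * a i v)) c
      = s i * P p (a i) c + 1 * P p (\<lambda>v. \<Sum>i\<in>I. s i * a i v) c"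
    using insert.prems by (intro P_comb linear_sum_functionals assms(3)) auto
  then show ?case using insert by simp
qed

text \<open>\<open>anchor\<close> is a definite description, so a witness is required: the vector
  whose components are the values of \<open>P p (\<alpha> p)\<close> on the coordinate functionals.
  Linearity of \<open>P\<close> is given in the first argument; antisymmetry moves the functional
  \<open>b\<close> there.\<close>

lemma anchor_apply:
  assumes "linear (\<alpha> p)" "linear b"
  shows "b (anchor P \<alpha> p) = P p (\<alpha> p) b"
proof -
  let ?v = "\<Sum>e\<in>Basis. P p (\<alpha> p) (\<lambda>w. w \<bullet> e) *\<^sub>R e"
  have inner: "linear (\<lambda>w. w \<bullet> e)" for e :: 'e by (simp add: linear_iff inner_add_left)
  have "b ?v = P p (\<alpha> p) b" if b: "linear b" for b
  proof -
    have b_eq: "b = (\<lambda>w. \<Sum>e\<in>Basis. b e * (w \<bullet> e))"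
    proof
      fix w
      have "b w = b (\<Sum>e\<in>Basis. (w \<bullet> e) *\<^sub>R e)" by (simp add: euclidean_representation)
      then show "b w = (\<Sum>e\<in>Basis. b e * (w \<bullet> e))"
        by (simp add: linear_sum[OF b] linear_scale[OF b] mult.commute)
    qed
    have "P p b (\<alpha> p) = (\<Sum>e\<in>Basis. b e * P p (\<lambda>w. w \<bullet> e) (\<alpha> p))"
      by (subst b_eq) (rule P_sum[OF finite_Basis inner assms(1)])
    then show ?thesis
      by (simp add: linear_sum[OF b] linear_scale[OF b] P_antisym[OF assms(1) b]
          P_antisym[OF assms(1) inner] sum_negf linear_neg[OF b] mult.commute)
  qed
  then have "anchor P \<alpha> p = ?v" by (rule anchor_unique)
  then show ?thesis using \<open>\<And>b. linear b \<Longrightarrow> b ?v = P p (\<alpha> p) b\<close> assms(2) by simp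
qed

text \<open>Expanding \<alpha> in coordinate covectors turns each component of the anchor into a sum
  of products of components of \<alpha> and of \<open>P\<close>.\<close>

lemma anchor_vfields:
  assumes "\<alpha> \<in> forms M"
  shows "anchor P \<alpha> \<in> vfields M"
proof (rule vfieldsI)
  fix c assume c: "c \<in> atlas M"
  note op = chart_open_image[OF c]
  have inner: "linear (\<lambda>w. w \<bullet> e)" for e :: 'e by (simp add: linear_iff inner_add_left)
  show "smooth_on (snd c ` fst c) (\<lambda>x. coords M c (chart_inv c x) (anchor P \<alpha> (chart_inv c x)))"
  proof (rule smooth_on_componentwise[OF op])
    fix b :: 'e assume "b \<in> Basis"
    have "smooth_on (snd c ` fst c) (\<lambda>x. P (chart_inv c x) ((\<lambda>w. w \<bullet> e) \<circ> coords M c (chart_inv c x))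
        ((\<lambda>w. w \<bullet> b) \<circ> coords M c (chart_inv c x)))" for e
      by (rule P_smooth[OF c inner inner])
    then have "smooth_on (snd c ` fst c) (\<lambda>x. \<Sum>e\<in>Basis. \<alpha> (chart_inv c x) (coord_vec M c (chart_inv c x) e) *
        P (chart_inv c x) ((\<lambda>w. w \<bullet> e) \<circ> coords M c (chart_inv c x))
        ((\<lambda>w. w \<bullet> b) \<circ> coords M c (chart_inv c x)))"
      by (intro smooth_on_sum smooth_on_mult op finite_Basis forms_chart[OF assms c])
    then show "smooth_on (snd c ` fst c) (\<lambda>x. coords M c (chart_inv c x) (anchor P \<alpha> (chart_inv c x)) \<bullet> b)"
    proof (rule smooth_on_cong[OF op])
      fix x assume x: "x \<in> snd c ` fst c"
      let ?q = "chart_inv c x"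
      note lin = forms_linear[OF assms, of ?q]
      note linc = linear_coords[OF c chart_inv_in[OF c x]]
      have comp: "linear ((\<lambda>w. w \<bullet> e) \<circ> coords M c ?q)" for e
        by (rule linear_compose[OF linc inner])
      have \<alpha>_eq: "\<alpha> ?q = (\<lambda>v. \<Sum>e\<in>Basis. \<alpha> ?q (coord_vec M c ?q e) * ((\<lambda>w. w \<bullet> e) \<circ> coords M c ?q) v)"
      proof
        fix v
        show "\<alpha> ?q v = (\<Sum>e\<in>Basis. \<alpha> ?q (coord_vec M c ?q e) * ((\<lambda>w. w \<bullet> e) \<circ> coords M c ?q) v)"
          by (subst vector_expansion[OF c chart_inv_in[OF c x]])
             (simp add: linear_sum[OF lin] linear_scale[OF lin] mult.commute)
      qed
      have "coords M c ?q (anchor P \<alpha> ?q) \<bullet> b = P ?q (\<alpha> ?q) ((\<lambda>w. w \<bullet> b) \<circ> coords M c ?q)"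
        using anchor_apply[where \<alpha> = \<alpha> and p = ?q, OF lin comp, of b] by simp
      also have "\<dots> = (\<Sum>e\<in>Basis. \<alpha> ?q (coord_vec M c ?q e) *
          P ?q ((\<lambda>w. w \<bullet> e) \<circ> coords M c ?q) ((\<lambda>w. w \<bullet> b) \<circ> coords M c ?q))"
        by (subst \<alpha>_eq) (rule P_sum[OF finite_Basis comp comp])
      finally show "(\<Sum>e\<in>Basis. \<alpha> ?q (coord_vec M c ?q e) *
          P ?q ((\<lambda>w. w \<bullet> e) \<circ> coords M c ?q) ((\<lambda>w. w \<bullet> b) \<circ> coords M c ?q))
          = coords M c ?q (anchor P \<alpha> ?q) \<bullet> b" by simp
    qed
  qed
qed

lemma pairing_anchor: "\<alpha> \<in> forms M \<Longrightarrow> \<beta> \<in> forms M \<Longrightarrow> pairing P \<alpha> \<beta> p = \<beta> p (anchor P \<alpha> p)"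
  by (simp add: pairing_def anchor_apply forms_linear)

lemma smooth_fun_pairing:
  assumes "\<alpha> \<in> forms M" "\<beta> \<in> forms M"
  shows "smooth_fun M (pairing P \<alpha> \<beta>)"
proof -
  have "smooth_fun M (\<lambda>p. \<beta> p (anchor P \<alpha> p))"
    by (rule smooth_fun_form_apply[OF assms(2) anchor_vfields[OF assms(1)]])
  then show ?thesis by (simp add: pairing_anchor[OF assms, symmetric])
qed

text \<open>By antisymmetry, differentiating \<open>f\<close> along the anchor of \<alpha> is, up to
  sign, evaluating \<alpha> on the anchor of the differential of \<open>f\<close>, which is
  0.\<close>

lemma act_casimir:
  assumes "casimir M P f" "linear (\<alpha> p)"
  shows "act M (anchor P \<alpha>) f p = 0"
proof -
  have lin: "linear (ext_d M f p)" using assms(1) by (simp add: casimir_def linear_ext_d)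
  have "act M (anchor P \<alpha>) f p = P p (\<alpha> p) (ext_d M f p)"
    unfolding act_def by (rule anchor_apply[where \<alpha> = \<alpha>, OF assms(2) lin])
  also have "\<dots> = - (\<alpha> p) (anchor P (ext_d M f) p)"
    using P_antisym[OF assms(2) lin, of p] anchor_apply[where \<alpha> = "ext_d M f" and p = p and b = "\<alpha> p", OF lin assms(2)]
    by simp
  also have "\<dots> = 0" using assms by (simp add: casimir_def linear_0)
  finally show ?thesis .
qed

end

section \<open>Products\<close>

lemma has_derivative_map_prod:
  assumes "(f has_derivative f') (at (fst z))" "(g has_derivative g') (at (snd z))"
  shows "((\<lambda>z. (f (fst z), g (snd z))) has_derivative (\<lambda>v. (f' (fst v), g' (snd v)))) (at z)"
proof -
  have "(fst has_derivative fst) (at z)" "(snd has_derivative snd) (at z)"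
    by (auto intro!: derivative_eq_intros)
  from diff_chain_at[OF this(1) assms(1)] diff_chain_at[OF this(2) assms(2)] show ?thesis
    by (intro has_derivative_Pair) (simp_all add: o_def)
qed

lemma has_derivative_comp_fst:
  "(f has_derivative f') (at (fst z)) \<Longrightarrow> ((\<lambda>z. f (fst z)) has_derivative (\<lambda>v. f' (fst v))) (at z)"
  using has_derivative_fst[OF has_derivative_map_prod[where g = "\<lambda>x. x" and g' = "\<lambda>x. x"]] by simp

lemma has_derivative_comp_snd:
  "(g has_derivative g') (at (snd z)) \<Longrightarrow> ((\<lambda>z. g (snd z)) has_derivative (\<lambda>v. g' (snd v))) (at z)"
  using has_derivative_snd[OF has_derivative_map_prod[where f = "\<lambda>x. x" and f' = "\<lambda>x. x"]] by simp

lemma has_derivative_add_prod: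
  fixes f g :: "_ \<Rightarrow> real"
  assumes "(f has_derivative f') (at (fst z))" "(g has_derivative g') (at (snd z))"
  shows "((\<lambda>z. f (fst z) + g (snd z)) has_derivative (\<lambda>v. f' (fst v) + g' (snd v))) (at z)"
  using has_derivative_add[OF has_derivative_fst[OF has_derivative_map_prod[OF assms]]
      has_derivative_snd[OF has_derivative_map_prod[OF assms]]] by simp

lemma smooth_on_fst: "open S \<Longrightarrow> open T \<Longrightarrow> smooth_on S f \<Longrightarrow> smooth_on (S \<times> T) (\<lambda>z. f (fst z))"
  by (rule smooth_on_compose[where f = fst and T = S])
     (auto intro: open_Times smooth_on_linear simp: linear_fst)

lemma smooth_on_snd: "open S \<Longrightarrow> open T \<Longrightarrow> smooth_on T f \<Longrightarrow> smooth_on (S \<times> T) (\<lambda>z. f (snd z))"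
  by (rule smooth_on_compose[where f = snd and T = T])
     (auto intro: open_Times smooth_on_linear simp: linear_snd)

text \<open>This is \<alpha>^h + \<beta>^v. With a zero form in one slot it is a horizontal or
  vertical lift, so that one formula serves both kinds of lift and the test forms.\<close>

definition sum_form :: "('b, 'e::euclidean_space) form \<Rightarrow> ('f, 'h::euclidean_space) form \<Rightarrow> ('b \<times> 'f, 'e \<times> 'h) form" where
  "sum_form \<alpha> \<beta> = (\<lambda>p v. \<alpha> (fst p) (fst v) + \<beta> (snd p) (snd v))"

lemma linear_sum_form: "linear (\<alpha> (fst p)) \<Longrightarrow> linear (\<beta> (snd p)) \<Longrightarrow> linear (sum_form \<alpha> \<beta> p)"
  unfolding sum_form_def
  by (intro linear_compose_add linear_compose[OF linear_fst, unfolded o_def]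
      linear_compose[OF linear_snd, unfolded o_def])

lemma linear_restrict:
  fixes b :: "'e::euclidean_space \<times> 'h::euclidean_space \<Rightarrow> real"
  assumes "linear b"
  shows "linear (\<lambda>x. b (x, 0))" "linear (\<lambda>y. b (0, y))"
  using linear_compose[OF _ assms, of "\<lambda>x. (x, 0)"] linear_compose[OF _ assms, of "\<lambda>y. (0, y)"]
  by (simp_all add: o_def linear_iff)

locale product_manifold = B: manifold B + F: manifold F
  for B :: "('b::{t2_space, second_countable_topology}, 'e::euclidean_space) mfd"
    and F :: "('f::{t2_space, second_countable_topology}, 'h::euclidean_space) mfd"
begin

abbreviation "N \<equiv> prod_mfd B F"

lemma chart_at_prod: "chart_at N (b, q) = prod_chart (chart_at B b) (chart_at F q)"
  by (simp add: prod_mfd_def)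

lemma atlas_prodE:
  assumes "k \<in> atlas N"
  obtains c d where "c \<in> atlas B" "d \<in> atlas F" "k = prod_chart c d"
  using assms by (auto simp: prod_mfd_def)

lemma prod_chart_image: "snd (prod_chart c d) ` fst (prod_chart c d) = (snd c ` fst c) \<times> (snd d ` fst d)"
  by (force simp: prod_chart_def)

lemma chart_inv_prod:
  assumes "c \<in> atlas B" "d \<in> atlas F" "z \<in> (snd c ` fst c) \<times> (snd d ` fst d)"
  shows "chart_inv (prod_chart c d) z = (chart_inv c (fst z), chart_inv d (snd z))"
proof -
  obtain b q where z: "b \<in> fst c" "q \<in> fst d" "z = (snd c b, snd d q)" using assms(3) by auto
  have "inj_on (snd c) (fst c)" "inj_on (snd d) (fst d)"
    using B.chart_inv_left[OF assms(1)] F.chart_inv_left[OF assms(2)] by (metis inj_onI)+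
  then have "inj_on (map_prod (snd c) (snd d)) (fst c \<times> fst d)" by (rule map_prod_inj_on)
  then have "chart_inv (prod_chart c d) z = (b, q)"
    unfolding chart_inv_def prod_chart_def by (simp add: z inv_into_f_eq)
  then show ?thesis
    using z by (simp add: B.chart_inv_left[OF assms(1)] F.chart_inv_left[OF assms(2)])
qed

lemma open_prod_image:
  assumes "c \<in> atlas B" "d \<in> atlas F"
  shows "open ((snd c ` fst c) \<times> (snd d ` fst d))"
  using assms by (intro open_Times B.chart_open_image F.chart_open_image)

text \<open>Product charts change each factor separately. The splittings of \<open>coords\<close>
  and \<open>coord_vec\<close> are instances, since the distinguished charts of the product are
  product charts.\<close>

lemma prod_transition:
  assumes "c \<in> atlas B" "d \<in> atlas F" "c' \<in> atlas B" "d' \<in> atlas F"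
    and "b \<in> fst c" "b \<in> fst c'" "q \<in> fst d" "q \<in> fst d'"
  shows "frechet_derivative (snd (prod_chart c' d') \<circ> chart_inv (prod_chart c d))
      (at (snd (prod_chart c d) (b, q))) = (\<lambda>v. (B.jac c c' b (fst v), F.jac d d' q (snd v)))"
proof (rule frechet_derivative_eqI)
  let ?z = "snd (prod_chart c d) (b, q)"
  have z: "fst ?z = snd c b" "snd ?z = snd d q" by (simp_all add: prod_chart_def)
  have "((\<lambda>z. ((snd c' \<circ> chart_inv c) (fst z), (snd d' \<circ> chart_inv d) (snd z))) has_derivative
      (\<lambda>v. (B.jac c c' b (fst v), F.jac d d' q (snd v)))) (at ?z)"
    by (rule has_derivative_map_prod)
       (simp_all only: z B.has_derivative_jac[OF assms(1,3,5,6)] F.has_derivative_jac[OF assms(2,4,7,8)])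
  then show "((snd (prod_chart c' d') \<circ> chart_inv (prod_chart c d)) has_derivative
      (\<lambda>v. (B.jac c c' b (fst v), F.jac d d' q (snd v)))) (at ?z)"
  proof (rule has_derivative_transform_within_open[OF _ open_prod_image[OF assms(1,2)]])
    show "?z \<in> (snd c ` fst c) \<times> (snd d ` fst d)" using assms by (auto simp: prod_chart_def)
    fix z assume "z \<in> (snd c ` fst c) \<times> (snd d ` fst d)"
    then show "((snd c' \<circ> chart_inv c) (fst z), (snd d' \<circ> chart_inv d) (snd z))
        = (snd (prod_chart c' d') \<circ> chart_inv (prod_chart c d)) z"
      using chart_inv_prod[OF assms(1,2)] by (simp add: prod_chart_def)
  qed
qed

lemma coords_prod:
  assumes "c \<in> atlas B" "d \<in> atlas F" "b \<in> fst c" "q \<in> fst d"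
  shows "coords N (prod_chart c d) (b, q) = (\<lambda>v. (coords B c b (fst v), coords F d q (snd v)))"
  unfolding coords_def[of N] chart_at_prod
  by (subst prod_transition)
     (use assms B.chart_at F.chart_at in \<open>auto simp: B.coords_jac F.coords_jac\<close>)

lemma coord_vec_prod:
  assumes "c \<in> atlas B" "d \<in> atlas F" "b \<in> fst c" "q \<in> fst d"
  shows "coord_vec N (prod_chart c d) (b, q) = (\<lambda>v. (coord_vec B c b (fst v), coord_vec F d q (snd v)))"
  unfolding coord_vec_def[of N] chart_at_prod
  by (subst prod_transition)
     (use assms B.chart_at F.chart_at in \<open>auto simp: B.coord_vec_jac F.coord_vec_jac\<close>)

lemma chart_at_image:
  shows "snd (chart_at N (b, q)) (b, q) = (snd (chart_at B b) b, snd (chart_at F q) q)"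
    and "(snd (chart_at B b) b, snd (chart_at F q) q)
      \<in> (snd (chart_at B b) ` fst (chart_at B b)) \<times> (snd (chart_at F q) ` fst (chart_at F q))"
  using B.chart_at F.chart_at by (auto simp: chart_at_prod prod_chart_def)

text \<open>In the distinguished charts the projection is \<open>fst\<close> itself, a linear map
  and hence its own derivative.\<close>

lemma tangent_map_fst: "tangent_map N B fst (b, q) = fst"
  unfolding tangent_map_def
proof (rule frechet_derivative_eqI)
  note cd = B.chart_at(1)[of b] F.chart_at(1)[of q]
  have "(fst has_derivative fst) (at (snd (chart_at N (b, q)) (b, q)))"
    by (auto intro!: derivative_eq_intros)
  then show "((snd (chart_at B (fst (b, q))) \<circ> fst \<circ> chart_inv (chart_at N (b, q))) has_derivative fst)
      (at (snd (chart_at N (b, q)) (b, q)))"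
    by (rule has_derivative_transform_within_open[OF _ open_prod_image[OF cd]])
       (use chart_at_image in \<open>auto simp: chart_at_prod chart_inv_prod[OF cd] B.chart_inv_left[OF cd(1)]\<close>)
qed

lemma tangent_map_snd: "tangent_map N F snd (b, q) = snd"
  unfolding tangent_map_def
proof (rule frechet_derivative_eqI)
  note cd = B.chart_at(1)[of b] F.chart_at(1)[of q]
  have "(snd has_derivative snd) (at (snd (chart_at N (b, q)) (b, q)))"
    by (auto intro!: derivative_eq_intros)
  then show "((snd (chart_at F (snd (b, q))) \<circ> snd \<circ> chart_inv (chart_at N (b, q))) has_derivative snd)
      (at (snd (chart_at N (b, q)) (b, q)))"
    by (rule has_derivative_transform_within_open[OF _ open_prod_image[OF cd]])
       (use chart_at_image in \<open>auto simp: chart_at_prod chart_inv_prod[OF cd] F.chart_inv_left[OF cd(2)]\<close>)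
qed

text \<open>The shape covers pairings of lifts with the bivector (\<open>k\<close> constantly 1),
  with the cometric (\<open>k\<close> equal to \<open>1 / f^2\<close>), and the lift of
  \<open>f\<close> (\<open>k\<close> and \<open>w\<close> zero).\<close>

lemma ext_d_prod:
  assumes "smooth_fun B u" "smooth_fun B k" "smooth_fun F w"
  shows "ext_d N (\<lambda>z. u (fst z) + k (fst z) * w (snd z)) (b, q) =
    (\<lambda>v. ext_d B u b (fst v) + (k b * ext_d F w q (snd v) + ext_d B k b (fst v) * w q))"
  unfolding ext_d_def[of N]
proof (rule frechet_derivative_eqI)
  let ?c = "chart_at B b" and ?d = "chart_at F q"
  let ?z = "(snd ?c b, snd ?d q)"
  note cd = B.chart_at(1)[of b] F.chart_at(1)[of q]
  have dB: "((\<lambda>z. (r \<circ> chart_inv ?c) (fst z)) has_derivative (\<lambda>v. ext_d B r b (fst v))) (at ?z)"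
    if "smooth_fun B r" for r
    unfolding ext_d_def
    by (rule has_derivative_comp_fst)
       (simp add: frechet_derivative_works[symmetric] B.smooth_fun_differentiable[OF that, unfolded o_def] o_def)
  have dF: "((\<lambda>z. (w \<circ> chart_inv ?d) (snd z)) has_derivative (\<lambda>v. ext_d F w q (snd v))) (at ?z)"
    unfolding ext_d_def
    by (rule has_derivative_comp_snd)
       (simp add: frechet_derivative_works[symmetric] F.smooth_fun_differentiable[OF assms(3), unfolded o_def] o_def)
  from has_derivative_add[OF dB[OF assms(1)] has_derivative_mult[OF dB[OF assms(2)] dF]]
  have "((\<lambda>z. (u \<circ> chart_inv ?c) (fst z) + (k \<circ> chart_inv ?c) (fst z) * (w \<circ> chart_inv ?d) (snd z))
      has_derivative (\<lambda>v. ext_d B u b (fst v) + (k b * ext_d F w q (snd v) + ext_d B k b (fst v) * w q)))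
      (at ?z)"
    by (simp add: B.chart_inv_left[OF cd(1) B.chart_at(2)] F.chart_inv_left[OF cd(2) F.chart_at(2)])
  then show "((\<lambda>z. u (fst z) + k (fst z) * w (snd z)) \<circ> chart_inv (chart_at N (b, q)) has_derivative
      (\<lambda>v. ext_d B u b (fst v) + (k b * ext_d F w q (snd v) + ext_d B k b (fst v) * w q)))
      (at (snd (chart_at N (b, q)) (b, q)))"
    unfolding chart_at_image(1)
    by (rule has_derivative_transform_within_open[OF _ open_prod_image[OF cd] chart_at_image(2)])
       (simp add: chart_at_prod chart_inv_prod[OF cd])
qed

lemma smooth_fun_fst:
  assumes "smooth_fun B u"
  shows "smooth_fun N (\<lambda>z. u (fst z))"
  unfolding smooth_fun_def o_def
proof
  fix k assume "k \<in> atlas N"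
  then obtain c d where cd: "c \<in> atlas B" "d \<in> atlas F" and k: "k = prod_chart c d" by (rule atlas_prodE)
  show "smooth_on (snd k ` fst k) (\<lambda>x. u (fst (chart_inv k x)))"
    unfolding k prod_chart_image
    by (rule smooth_on_cong[OF open_prod_image[OF cd] smooth_on_fst[OF B.chart_open_image[OF cd(1)]
          F.chart_open_image[OF cd(2)] B.smooth_fun_chart[OF assms cd(1)]]])
       (simp add: chart_inv_prod[OF cd])
qed

lemma sum_form_forms:
  assumes "\<alpha> \<in> forms B" "\<beta> \<in> forms F"
  shows "sum_form \<alpha> \<beta> \<in> forms N"
  unfolding forms_def Let_def
proof (intro CollectI conjI ballI allI)
  show "linear (sum_form \<alpha> \<beta> p)" for p
    by (intro linear_sum_form B.forms_linear F.forms_linear assms)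
  fix k and e :: "'e \<times> 'h" assume "k \<in> atlas N"
  then obtain c d where cd: "c \<in> atlas B" "d \<in> atlas F" and k: "k = prod_chart c d" by (rule atlas_prodE)
  note op = B.chart_open_image[OF cd(1)] F.chart_open_image[OF cd(2)]
  show "smooth_on (snd k ` fst k) (\<lambda>x. sum_form \<alpha> \<beta> (chart_inv k x) (coord_vec N k (chart_inv k x) e))"
    unfolding k prod_chart_image
    by (rule smooth_on_cong[OF open_prod_image[OF cd] smooth_on_add[OF open_prod_image[OF cd]
          smooth_on_fst[OF op B.forms_chart[OF assms(1) cd(1), of "fst e"]]
          smooth_on_snd[OF op F.forms_chart[OF assms(2) cd(2), of "snd e"]]]])
       (auto simp: chart_inv_prod[OF cd] coord_vec_prod[OF cd] B.chart_inv_left[OF cd(1)]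
          F.chart_inv_left[OF cd(2)] sum_form_def)
qed

lemma scale_form_forms:
  assumes "smooth_fun N u" "\<alpha> \<in> forms N"
  shows "scale_form u \<alpha> \<in> forms N"
  unfolding forms_def Let_def
proof (intro CollectI conjI ballI allI)
  show "linear (scale_form u \<alpha> p)" for p
  proof -
    have "linear (\<alpha> p)" using assms(2) unfolding forms_def by blast
    then show ?thesis
      by (intro linearI) (simp_all add: scale_form_def linear_add linear_scale distrib_left)
  qed
  fix k and e :: "'e \<times> 'h" assume k: "k \<in> atlas N"
  then obtain c d where cd: "c \<in> atlas B" "d \<in> atlas F" "k = prod_chart c d" by (rule atlas_prodE)
  have "open (snd k ` fst k)" unfolding cd(3) prod_chart_image by (rule open_prod_image[OF cd(1,2)])
  moreover have "smooth_on (snd k ` fst k) (\<lambda>x. u (chart_inv k x))"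
    using assms(1) k unfolding smooth_fun_def o_def by blast
  moreover have "smooth_on (snd k ` fst k) (\<lambda>x. \<alpha> (chart_inv k x) (coord_vec N k (chart_inv k x) e))"
    using assms(2) k unfolding forms_def Let_def by blast
  ultimately show "smooth_on (snd k ` fst k) (\<lambda>x. scale_form u \<alpha> (chart_inv k x) (coord_vec N k (chart_inv k x) e))"
    unfolding scale_form_def by (rule smooth_on_mult)
qed

text \<open>In a product chart the components of field and form split into summands that depend on
  one factor only, so the mixed derivatives in the local formula vanish.\<close>

lemma lie_form_prod:
  assumes "X \<in> vfields B" "Y \<in> vfields F" "\<gamma> \<in> forms B" "\<delta> \<in> forms F"
  shows "lie_form N (\<lambda>p. (X (fst p), Y (snd p))) (sum_form \<gamma> \<delta>) = sum_form (lie_form B X \<gamma>) (lie_form F Y \<delta>)"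
proof (intro ext)
  fix p :: "'b \<times> 'f" and v :: "'e \<times> 'h"
  obtain b q where p: "p = (b, q)" by force
  let ?c = "chart_at B b" and ?d = "chart_at F q"
  note cd = B.chart_at(1)[of b] F.chart_at(1)[of q]
  let ?z = "(snd ?c b, snd ?d q)"
  let ?O = "(snd ?c ` fst ?c) \<times> (snd ?d ` fst ?d)"
  note zO = chart_at_image(2)[of b q]
  define X' where "X' = (\<lambda>x. coords B ?c (chart_inv ?c x) (X (chart_inv ?c x)))"
  define Y' where "Y' = (\<lambda>x. coords F ?d (chart_inv ?d x) (Y (chart_inv ?d x)))"
  define \<gamma>' where "\<gamma>' = (\<lambda>x w. \<gamma> (chart_inv ?c x) (coord_vec B ?c (chart_inv ?c x) w))"
  define \<delta>' where "\<delta>' = (\<lambda>x w. \<delta> (chart_inv ?d x) (coord_vec F ?d (chart_inv ?d x) w))"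
  let ?k = "prod_chart ?c ?d"
  \<comment> \<open>\<open>Z\<close> and \<zeta> are the local expressions in
    \<open>lie_form\<close> on the product. They match those of the factors on the image of the
    product chart, which is open, so derivatives match as well.\<close>
  define Z where "Z = (\<lambda>x. coords N ?k (chart_inv ?k x) (X (fst (chart_inv ?k x)), Y (snd (chart_inv ?k x))))"
  define \<zeta> where "\<zeta> = (\<lambda>x w. sum_form \<gamma> \<delta> (chart_inv ?k x) (coord_vec N ?k (chart_inv ?k x) w))"
  have Z: "Z x = (X' (fst x), Y' (snd x))" if "x \<in> ?O" for x
    using that by (auto simp: Z_def X'_def Y'_def chart_inv_prod[OF cd] coords_prod[OF cd]
        B.chart_inv_left[OF cd(1)] F.chart_inv_left[OF cd(2)])
  have \<zeta>: "\<zeta> x w = \<gamma>' (fst x) (fst w) + \<delta>' (snd x) (snd w)" if "x \<in> ?O" for x w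
    using that by (auto simp: \<zeta>_def \<gamma>'_def \<delta>'_def sum_form_def chart_inv_prod[OF cd] coord_vec_prod[OF cd]
        B.chart_inv_left[OF cd(1)] F.chart_inv_left[OF cd(2)])
  have "(X' has_derivative frechet_derivative X' (at (fst ?z))) (at (fst ?z))"
    "(Y' has_derivative frechet_derivative Y' (at (snd ?z))) (at (snd ?z))"
    using zO smooth_on_has_derivative[OF B.vfields_chart[OF assms(1) cd(1)]]
      smooth_on_has_derivative[OF F.vfields_chart[OF assms(2) cd(2)]]
    unfolding X'_def Y'_def by auto
  note has_derivative_transform_within_open[OF has_derivative_map_prod[OF this] open_prod_image[OF cd] zO]
  from frechet_derivative_eqI[OF this[of Z]]
  have dZ: "frechet_derivative Z (at ?z) =
      (\<lambda>v. (frechet_derivative X' (at (snd ?c b)) (fst v), frechet_derivative Y' (at (snd ?d q)) (snd v)))"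
    by (simp add: Z)
  have "((\<lambda>x. \<gamma>' x (fst v)) has_derivative frechet_derivative (\<lambda>x. \<gamma>' x (fst v)) (at (fst ?z))) (at (fst ?z))"
    "((\<lambda>x. \<delta>' x (snd v)) has_derivative frechet_derivative (\<lambda>x. \<delta>' x (snd v)) (at (snd ?z))) (at (snd ?z))"
    using zO smooth_on_has_derivative[OF B.forms_chart[OF assms(3) cd(1)]]
      smooth_on_has_derivative[OF F.forms_chart[OF assms(4) cd(2)]]
    unfolding \<gamma>'_def \<delta>'_def by auto
  note has_derivative_transform_within_open[OF has_derivative_add_prod[OF this] open_prod_image[OF cd] zO]
  from frechet_derivative_eqI[OF this[of "\<lambda>x. \<zeta> x v"]]
  have d\<zeta>: "frechet_derivative (\<lambda>x. \<zeta> x v) (at ?z) =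
      (\<lambda>w. frechet_derivative (\<lambda>x. \<gamma>' x (fst v)) (at (snd ?c b)) (fst w)
        + frechet_derivative (\<lambda>x. \<delta>' x (snd v)) (at (snd ?d q)) (snd w))"
    by (simp add: \<zeta>)
  have "lie_form N (\<lambda>p. (X (fst p), Y (snd p))) (sum_form \<gamma> \<delta>) p v
      = frechet_derivative (\<lambda>x. \<zeta> x v) (at ?z) (Z ?z) + \<zeta> ?z (frechet_derivative Z (at ?z) v)"
    unfolding lie_form_def Let_def p chart_at_image(1) Z_def \<zeta>_def by (simp add: chart_at_prod)
  also have "\<dots> = lie_form B X \<gamma> b (fst v) + lie_form F Y \<delta> q (snd v)"
    unfolding dZ d\<zeta> Z[OF zO] \<zeta>[OF zO]
    unfolding lie_form_def Let_def X'_def Y'_def \<gamma>'_def \<delta>'_def by simp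
  finally show "lie_form N (\<lambda>p. (X (fst p), Y (snd p))) (sum_form \<gamma> \<delta>) p v
      = sum_form (lie_form B X \<gamma>) (lie_form F Y \<delta>) p v" by (simp add: sum_form_def p)
qed

end

section \<open>The product bivector\<close>

locale product_bivector = product_manifold B F + PB: bivector_manifold B PB + PF: bivector_manifold F PF
  for B :: "('b::{t2_space, second_countable_topology}, 'e::euclidean_space) mfd"
    and F :: "('f::{t2_space, second_countable_topology}, 'h::euclidean_space) mfd"
    and PB :: "('b, 'e) cobilinear" and PF :: "('f, 'h) cobilinear"
begin

abbreviation "P \<equiv> prod_bivector PB PF"

text \<open>The anchor at \<open>p\<close> depends only on the covector at \<open>p\<close>, so each
  half of this covector may be frozen to a constant family on its factor.\<close>

lemma anchor_prod:
  assumes "linear (A p)"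
  shows "anchor P A p = (anchor PB (\<lambda>_ x. A p (x, 0)) (fst p), anchor PF (\<lambda>_ y. A p (0, y)) (snd p))"
proof (rule anchor_unique)
  fix b :: "'e \<times> 'h \<Rightarrow> real" assume b: "linear b"
  have split: "b (x, y) = b (x, 0) + b (0, y)" for x y
    using linear_add[OF b, of "(x, 0)" "(0, y)"] by simp
  show "b (anchor PB (\<lambda>_ x. A p (x, 0)) (fst p), anchor PF (\<lambda>_ y. A p (0, y)) (snd p)) = P p (A p) b"
    unfolding prod_bivector_def
    using PB.anchor_apply[where \<alpha> = "\<lambda>_ x. A p (x, 0)" and p = "fst p", OF linear_restrict(1)[OF assms] linear_restrict(1)[OF b]]
      PF.anchor_apply[where \<alpha> = "\<lambda>_ y. A p (0, y)" and p = "snd p", OF linear_restrict(2)[OF assms] linear_restrict(2)[OF b]]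
    by (subst split) (simp only:)
qed

lemma anchor_sum_form:
  assumes "\<alpha> \<in> forms B" "\<beta> \<in> forms F"
  shows "anchor P (sum_form \<alpha> \<beta>) = (\<lambda>p. (anchor PB \<alpha> (fst p), anchor PF \<beta> (snd p)))"
proof
  fix p
  have "anchor P (sum_form \<alpha> \<beta>) p = (anchor PB (\<lambda>_ x. sum_form \<alpha> \<beta> p (x, 0)) (fst p), anchor PF (\<lambda>_ y. sum_form \<alpha> \<beta> p (0, y)) (snd p))"
    by (rule anchor_prod) (intro linear_sum_form B.forms_linear F.forms_linear assms)
  then show "anchor P (sum_form \<alpha> \<beta>) p = (anchor PB \<alpha> (fst p), anchor PF \<beta> (snd p))"
    using linear_0[OF B.forms_linear[OF assms(1)]] linear_0[OF F.forms_linear[OF assms(2)]]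
    by (simp add: sum_form_def anchor_def)
qed

text \<open>The factor 1 brings the right-hand side into the shape of
  \<open>ext_d_prod\<close>.\<close>

lemma pairing_sum_form:
  assumes "\<alpha> \<in> forms B" "\<beta> \<in> forms F" "\<gamma> \<in> forms B" "\<delta> \<in> forms F"
  shows "pairing P (sum_form \<alpha> \<beta>) (sum_form \<gamma> \<delta>) = (\<lambda>z. pairing PB \<alpha> \<gamma> (fst z) + 1 * pairing PF \<beta> \<delta> (snd z))"
  using linear_0[OF B.forms_linear[OF assms(1)]] linear_0[OF F.forms_linear[OF assms(2)]]
    linear_0[OF B.forms_linear[OF assms(3)]] linear_0[OF F.forms_linear[OF assms(4)]]
  by (simp add: pairing_def prod_bivector_def sum_form_def)

text \<open>Anchors, Lie derivatives and the differential of the pairing all split, so the bracket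
  has no mixed terms.\<close>

lemma koszul_sum_form:
  assumes "\<alpha> \<in> forms B" "\<beta> \<in> forms F" "\<gamma> \<in> forms B" "\<delta> \<in> forms F"
  shows "koszul N P (sum_form \<alpha> \<beta>) (sum_form \<gamma> \<delta>) = sum_form (koszul B PB \<alpha> \<gamma>) (koszul F PF \<beta> \<delta>)"
proof -
  have 1: "ext_d N (pairing P (sum_form \<alpha> \<beta>) (sum_form \<gamma> \<delta>))
      = sum_form (ext_d B (pairing PB \<alpha> \<gamma>)) (ext_d F (pairing PF \<beta> \<delta>))"
  proof
    fix p :: "'b \<times> 'f"
    obtain b q where p: "p = (b, q)" by force
    have "ext_d B (\<lambda>_. 1) b = (\<lambda>v. 0)"
      unfolding ext_d_def o_def by (rule frechet_derivative_eqI) simp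
    then show "ext_d N (pairing P (sum_form \<alpha> \<beta>) (sum_form \<gamma> \<delta>)) p
      = sum_form (ext_d B (pairing PB \<alpha> \<gamma>)) (ext_d F (pairing PF \<beta> \<delta>)) p"
      unfolding p pairing_sum_form[OF assms]
        ext_d_prod[OF PB.smooth_fun_pairing[OF assms(1,3)] B.smooth_fun_const PF.smooth_fun_pairing[OF assms(2,4)]]
      by (simp add: sum_form_def)
  qed
  show ?thesis
    unfolding koszul_def 1 anchor_sum_form[OF assms(1,2)] anchor_sum_form[OF assms(3,4)]
      lie_form_prod[OF PB.anchor_vfields[OF assms(1)] PF.anchor_vfields[OF assms(2)] assms(3,4)]
      lie_form_prod[OF PB.anchor_vfields[OF assms(3)] PF.anchor_vfields[OF assms(4)] assms(1,2)]
    by (simp add: diff_form_def sum_form_def fun_eq_iff)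
qed

end

section \<open>The contravariant Levi-Civita connection\<close>

abbreviation zero_form :: "('a, 'e::euclidean_space) form" where
  "zero_form \<equiv> (\<lambda>_ _. 0)"

lemma (in manifold) zero_form_forms: "zero_form \<in> forms M"
  by (rule formsI) (auto simp: linear_zero smooth_on_const)

lemma (in manifold) diff_form_forms:
  assumes "\<alpha> \<in> forms M" "\<beta> \<in> forms M"
  shows "diff_form \<alpha> \<beta> \<in> forms M"
proof (rule formsI)
  show "linear (diff_form \<alpha> \<beta> p)" for p
    unfolding diff_form_def by (intro linear_compose_sub forms_linear assms)
  fix c e assume c: "c \<in> atlas M"
  note op = chart_open_image[OF c]
  show "smooth_on (snd c ` fst c) (\<lambda>x. diff_form \<alpha> \<beta> (chart_inv c x) (coord_vec M c (chart_inv c x) e))"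
    by (rule smooth_on_cong[OF op smooth_on_add[OF op forms_chart[OF assms(1) c, of e]
          smooth_on_mult[OF op smooth_on_const[of _ "-1"] forms_chart[OF assms(2) c, of e]]]])
       (simp add: diff_form_def)
qed

lemma (in manifold) ext_d_compose:
  assumes "smooth_fun M u" "(H has_real_derivative d) (at (u p))"
  shows "ext_d M (\<lambda>q. H (u q)) p v = d * ext_d M u p v"
proof -
  let ?c = "chart_at M p"
  have "((u \<circ> chart_inv ?c) has_derivative ext_d M u p) (at (snd ?c p))"
    unfolding ext_d_def using smooth_fun_differentiable[OF assms(1)] frechet_derivative_works by blast
  moreover have "(H has_derivative (\<lambda>t. d * t)) (at ((u \<circ> chart_inv ?c) (snd ?c p)))"
    using assms(2) chart_inv_left[OF chart_at] by (simp add: has_field_derivative_def)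
  ultimately have "((H \<circ> (u \<circ> chart_inv ?c)) has_derivative ((\<lambda>t. d * t) \<circ> ext_d M u p)) (at (snd ?c p))"
    by (rule diff_chain_at)
  from frechet_derivative_eqI[OF this] show ?thesis by (simp add: ext_d_def[of M "\<lambda>q. H (u q)"] o_def)
qed

lemma ext_d_const: "ext_d M (\<lambda>_. r) p = (\<lambda>_. 0)"
  unfolding ext_d_def o_def by (rule frechet_derivative_eqI) simp

lemma (in bivector_manifold) anchor_zero: "anchor P zero_form p = 0"
  by (rule anchor_unique) (simp add: P_zero linear_0)

lemma (in metric_manifold) cometric_zero: "cometric g p (\<lambda>_. 0) b = 0" "cometric g p b (\<lambda>_. 0) = 0"
  using cometric_eq[of "\<lambda>_. 0" p b] cometric_sym[of p b] by (simp_all add: linear_zero)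

lemma (in metric_manifold) cometric_diff:
  "linear a \<Longrightarrow> linear b \<Longrightarrow> cometric g p (\<lambda>v. a v - b v) c = cometric g p a c - cometric g p b c"
  by (simp add: cometric_eq linear_compose_sub)

lemma (in metric_manifold) cometric_scale:
  assumes "linear a" "linear b"
  shows "cometric g p (\<lambda>v. s * a v) b = s * cometric g p a b"
    and "cometric g p a (\<lambda>v. s * b v) = s * cometric g p a b"
proof -
  have *: "cometric g p (\<lambda>v. s * a v) b = s * cometric g p a b" if "linear a" for a b
  proof -
    have "linear (\<lambda>v. s * a v)"
      using that by (intro linearI) (simp_all add: linear_add linear_scale distrib_left)
    then show ?thesis by (simp add: cometric_eq that)
  qed
  show "cometric g p (\<lambda>v. s * a v) b = s * cometric g p a b" by (rule *[OF assms(1)])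
  show "cometric g p a (\<lambda>v. s * b v) = s * cometric g p a b"
    using *[OF assms(2), of a] by (simp only: cometric_sym)
qed

text \<open>By \<open>koszul_formula\<close> this is twice the pairing of
  \<open>D \<alpha> \<beta>\<close> with \<gamma>, but no connection occurs in it, so it is
  available on \<open>B\<close>.\<close>

definition koszul_rhs ::
    "('a, 'e::euclidean_space) mfd \<Rightarrow> ('a, 'e) cobilinear \<Rightarrow> ('a, 'e) cobilinear \<Rightarrow>
     ('a, 'e) form \<Rightarrow> ('a, 'e) form \<Rightarrow> ('a, 'e) form \<Rightarrow> 'a \<Rightarrow> real" where
  "koszul_rhs M P g \<alpha> \<beta> \<gamma> p =
     act M (anchor P \<alpha>) (pairing g \<beta> \<gamma>) p + act M (anchor P \<beta>) (pairing g \<alpha> \<gamma>) p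
     - act M (anchor P \<gamma>) (pairing g \<alpha> \<beta>) p
     + pairing g (koszul M P \<alpha> \<beta>) \<gamma> p - pairing g (koszul M P \<beta> \<gamma>) \<alpha> p + pairing g (koszul M P \<gamma> \<alpha>) \<beta> p"

locale contravariant_connection =
  fixes M :: "('a, 'e::euclidean_space) mfd"
    and P g :: "('a, 'e) cobilinear" and D :: "('a, 'e) connection"
  assumes levi_civita: "levi_civita M P g D"
begin

lemma D_forms: "\<alpha> \<in> forms M \<Longrightarrow> \<beta> \<in> forms M \<Longrightarrow> D \<alpha> \<beta> \<in> forms M"
  and D_scale_left: "smooth_fun M u \<Longrightarrow> \<alpha> \<in> forms M \<Longrightarrow> \<beta> \<in> forms M \<Longrightarrow>
    D (scale_form u \<alpha>) \<beta> = scale_form u (D \<alpha> \<beta>)"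
  and D_scale_right: "smooth_fun M u \<Longrightarrow> \<alpha> \<in> forms M \<Longrightarrow> \<beta> \<in> forms M \<Longrightarrow>
    D \<alpha> (scale_form u \<beta>) = add_form (scale_form u (D \<alpha> \<beta>)) (scale_form (act M (anchor P \<alpha>) u) \<beta>)"
  and D_const_left: "\<alpha> \<in> forms M \<Longrightarrow> \<beta> \<in> forms M \<Longrightarrow>
    D (scale_form (\<lambda>_. r) \<alpha>) \<beta> = scale_form (\<lambda>_. r) (D \<alpha> \<beta>)"
  and D_const_right: "\<alpha> \<in> forms M \<Longrightarrow> \<beta> \<in> forms M \<Longrightarrow>
    D \<alpha> (scale_form (\<lambda>_. r) \<beta>) = scale_form (\<lambda>_. r) (D \<alpha> \<beta>)"
  and torsion_free: "\<alpha> \<in> forms M \<Longrightarrow> \<beta> \<in> forms M \<Longrightarrow> diff_form (D \<alpha> \<beta>) (D \<beta> \<alpha>) = koszul M P \<alpha> \<beta>"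
  and metric_compatible: "\<alpha> \<in> forms M \<Longrightarrow> \<beta> \<in> forms M \<Longrightarrow> \<gamma> \<in> forms M \<Longrightarrow>
    act M (anchor P \<alpha>) (pairing g \<beta> \<gamma>) p = pairing g (D \<alpha> \<beta>) \<gamma> p + pairing g \<beta> (D \<alpha> \<gamma>) p"
  using levi_civita unfolding levi_civita_def by blast+

lemma forms_linear': "\<alpha> \<in> forms M \<Longrightarrow> linear (\<alpha> p)"
  unfolding forms_def by blast

text \<open>Torsion-freeness exhibits the bracket as a difference of forms, which bypasses the Lie
  derivatives in its definition.\<close>

lemma koszul_linear:
  assumes "\<alpha> \<in> forms M" "\<beta> \<in> forms M"
  shows "linear (koszul M P \<alpha> \<beta> p)"
  unfolding torsion_free[OF assms, symmetric] diff_form_def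
  by (intro linear_compose_sub forms_linear' D_forms assms)

lemma D_zero:
  assumes "\<alpha> \<in> forms M" "zero_form \<in> forms M"
  shows "D zero_form \<alpha> = zero_form" "D \<alpha> zero_form = zero_form"
  using D_const_left[OF assms(2,1), of 0] D_const_right[OF assms, of 0]
  by (simp_all add: scale_form_def)

lemma koszul_zero:
  assumes "\<alpha> \<in> forms M" "zero_form \<in> forms M"
  shows "koszul M P zero_form \<alpha> = zero_form" "koszul M P \<alpha> zero_form = zero_form"
  using torsion_free[OF assms(2,1)] torsion_free[OF assms] D_zero[OF assms]
  by (simp_all add: diff_form_def)

text \<open>Metric compatibility and torsion-freeness rewrite every term through \<open>D\<close>;
  by symmetry all cancels except two copies of the left-hand pairing. Symmetry and additivity are
  hypotheses so that the formula applies to the cometrics of both \<open>F\<close> and the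
  product.\<close>

lemma koszul_formula:
  assumes sym: "\<And>p a b. g p a b = g p b a"
    and diff: "\<And>p a b c. linear a \<Longrightarrow> linear b \<Longrightarrow> linear c \<Longrightarrow> g p (\<lambda>v. a v - b v) c = g p a c - g p b c"
    and "\<alpha> \<in> forms M" "\<beta> \<in> forms M" "\<gamma> \<in> forms M"
  shows "2 * pairing g (D \<alpha> \<beta>) \<gamma> p = koszul_rhs M P g \<alpha> \<beta> \<gamma> p"
proof -
  have bracket: "pairing g (koszul M P \<mu> \<nu>) \<xi> p = pairing g (D \<mu> \<nu>) \<xi> p - pairing g (D \<nu> \<mu>) \<xi> p"
    if "\<mu> \<in> forms M" "\<nu> \<in> forms M" "\<xi> \<in> forms M" for \<mu> \<nu> \<xi>
    unfolding torsion_free[OF that(1,2), symmetric] pairing_def diff_form_def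
    by (rule diff) (intro forms_linear' D_forms that)+
  have psym: "pairing g \<mu> \<nu> p = pairing g \<nu> \<mu> p" for \<mu> \<nu>
    unfolding pairing_def by (rule sym)
  show ?thesis
    unfolding koszul_rhs_def bracket[OF assms(3,4,5)] bracket[OF assms(4,5,3)] bracket[OF assms(5,3,4)]
      metric_compatible[OF assms(3,4,5)] metric_compatible[OF assms(4,3,5)] metric_compatible[OF assms(5,3,4)]
    using psym[of \<beta> "D \<alpha> \<gamma>"] psym[of \<alpha> "D \<beta> \<gamma>"] psym[of \<alpha> "D \<gamma> \<beta>"] by simp
qed

end

section \<open>Warped products\<close>

locale warped_product = product_bivector B F PB PF + GB: metric_manifold B gB + GF: metric_manifold F gF
  for B :: "('b::{t2_space, second_countable_topology}, 'e::euclidean_space) mfd"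
    and F :: "('f::{t2_space, second_countable_topology}, 'h::euclidean_space) mfd"
    and PB :: "('b, 'e) cobilinear" and PF :: "('f, 'h) cobilinear"
    and gB :: "('b, 'e) metric" and gF :: "('f, 'h) metric" +
  fixes f :: "'b \<Rightarrow> real"
  assumes warping: "warping_function B f" and casimir: "casimir B PB f"
begin

lemma f_smooth: "smooth_fun B f" and f_pos: "f b > 0"
  using warping by (auto simp: warping_function_def)

definition W :: "('b \<times> 'f, 'e \<times> 'h) metric" where
  "W = warped_metric B gB F gF f"

text \<open>The weight of the cometric of \<open>F\<close> inside the cometric of the
  product.\<close>

definition k :: "'b \<Rightarrow> real" where
  "k b = inverse ((f b)\<^sup>2)"

abbreviation "G \<equiv> cometric W"
abbreviation "GBs \<equiv> cometric gB"
abbreviation "GFs \<equiv> cometric gF"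
abbreviation "fh \<equiv> (\<lambda>z. f (fst z)) :: 'b \<times> 'f \<Rightarrow> real"

lemma k_smooth: "smooth_fun B k"
proof -
  have "k b = f b powr (- 2)" for b
    using f_pos[of b] by (simp add: k_def powr_minus)
  then have "k = (\<lambda>b. f b powr (- 2))" by (rule ext)
  then show ?thesis
    using B.smooth_fun_compose[OF f_smooth, of "{0<..}" "\<lambda>x. x powr (- 2)"] smooth_on_powr[of "- 2"] f_pos
    by auto
qed

lemma act_f: "linear (\<alpha> b) \<Longrightarrow> ext_d B f b (anchor PB \<alpha> b) = 0"
  using PB.act_casimir[OF casimir] by (simp add: act_def)

text \<open>By the chain rule the differential of \<open>k\<close> is a multiple of that of
  \<open>f\<close>, which anchors annihilate.\<close>

lemma act_k:
  assumes "linear (\<alpha> b)"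
  shows "ext_d B k b (anchor PB \<alpha> b) = 0"
proof -
  have "((\<lambda>x. inverse (x\<^sup>2)) has_real_derivative - (inverse ((f b)\<^sup>2) * (2 * f b) * inverse ((f b)\<^sup>2))) (at (f b))"
    using f_pos[of b] by (auto intro!: derivative_eq_intros)
  from B.ext_d_compose[OF f_smooth this] show ?thesis
    using act_f[of \<alpha>, OF assms] by (simp add: k_def[abs_def])
qed

section \<open>The warped cometric on lifts\<close>

lemma W_eq: "W p v w = gB (fst p) (fst v) (fst w) + (f (fst p))\<^sup>2 * gF (snd p) (snd v) (snd w)"
  by (cases p) (simp add: W_def warped_metric_def pullback_metric_def tangent_map_fst tangent_map_snd)

text \<open>Raising an index works blockwise, with weight \<open>k\<close> on the block of
  \<open>F\<close>. In the value, \<open>k^2\<close> meets \<open>f^2\<close> and one factor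
  \<open>k\<close> survives.\<close>

lemma cometric_warped:
  assumes "linear a" "linear a'"
  shows "G p a a' = GBs (fst p) (\<lambda>x. a (x, 0)) (\<lambda>x. a' (x, 0)) + k (fst p) * GFs (snd p) (\<lambda>y. a (0, y)) (\<lambda>y. a' (0, y))"
proof -
  have f0: "f (fst p) \<noteq> 0" using f_pos[of "fst p"] by simp
  have dual: "dual_vec W p b = (dual_vec gB (fst p) (\<lambda>x. b (x, 0)), k (fst p) *\<^sub>R dual_vec gF (snd p) (\<lambda>y. b (0, y)))"
    if b: "linear b" for b :: "'e \<times> 'h \<Rightarrow> real"
    unfolding dual_vec_def[of W]
  proof (rule the_equality)
    show "W p (dual_vec gB (fst p) (\<lambda>x. b (x, 0)), k (fst p) *\<^sub>R dual_vec gF (snd p) (\<lambda>y. b (0, y))) = b"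
    proof
      fix v :: "'e \<times> 'h"
      have "W p (dual_vec gB (fst p) (\<lambda>x. b (x, 0)), k (fst p) *\<^sub>R dual_vec gF (snd p) (\<lambda>y. b (0, y))) v
          = b (fst v, 0) + b (0, snd v)"
        using f0 by (simp add: W_eq linear_scale[OF GF.metric_linear_left] k_def
          GB.metric_dual_vec[OF linear_restrict(1)[OF b]] GF.metric_dual_vec[OF linear_restrict(2)[OF b]])
      also have "\<dots> = b v" using linear_add[OF b, of "(fst v, 0)" "(0, snd v)"] by simp
      finally show "W p (dual_vec gB (fst p) (\<lambda>x. b (x, 0)), k (fst p) *\<^sub>R dual_vec gF (snd p) (\<lambda>y. b (0, y))) v
          = b v" .
    qed
    \<comment> \<open>Uniqueness: restricting \<open>b\<close> to each block yields the covector
      lowered from the corresponding component of \<open>v\<close>, with the factor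
      \<open>f^2\<close> on the block of \<open>F\<close>.\<close>
    fix v assume v: "W p v = b"
    have 1: "(\<lambda>x. b (x, 0)) = gB (fst p) (fst v)"
      by (simp add: v[symmetric] W_eq fun_eq_iff linear_0[OF GF.metric_linear_right])
    have 2: "(\<lambda>y. b (0, y)) = gF (snd p) ((f (fst p))\<^sup>2 *\<^sub>R snd v)"
      by (simp add: v[symmetric] W_eq fun_eq_iff linear_0[OF GB.metric_linear_right]
          linear_scale[OF GF.metric_linear_left])
    show "v = (dual_vec gB (fst p) (\<lambda>x. b (x, 0)), k (fst p) *\<^sub>R dual_vec gF (snd p) (\<lambda>y. b (0, y)))"
      unfolding 1 2 GB.dual_vec_metric GF.dual_vec_metric using f0 by (simp add: k_def)
  qed
  have "(f (fst p))\<^sup>2 * k (fst p) = 1" using f0 by (simp add: k_def)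
  then show ?thesis
    by (simp add: cometric_def dual[OF assms(1)] dual[OF assms(2)] W_eq
        linear_scale[OF GF.metric_linear_left] linear_scale[OF GF.metric_linear_right])
qed

lemma W_sym: "W p v w = W p w v"
  using GB.metric_sym[of "fst p" "fst v" "fst w"] GF.metric_sym[of "snd p" "snd v" "snd w"]
  by (simp only: W_eq)

lemma G_sym: "G p a b = G p b a"
  unfolding cometric_def by (rule W_sym)

text \<open>Read off from the splitting of \<open>G\<close>; together with \<open>G_sym\<close> this
  is what \<open>koszul_formula\<close> asks of the cometric.\<close>

lemma G_diff:
  assumes "linear a" "linear b" "linear c"
  shows "G p (\<lambda>v. a v - b v) c = G p a c - G p b c"
  by (simp add: cometric_warped linear_compose_sub assms GB.cometric_diff GF.cometric_diff linear_restrict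
      right_diff_distrib)

lemma G_scale:
  assumes "linear a" "linear b"
  shows "G p (\<lambda>v. s * a v) b = s * G p a b"
proof -
  have "linear (\<lambda>v. s * a v)"
    using assms(1) by (intro linearI) (simp_all add: linear_add linear_scale distrib_left)
  then show ?thesis
    by (simp add: cometric_warped assms GB.cometric_scale GF.cometric_scale linear_restrict distrib_left)
qed

lemma G_sum_form:
  assumes "linear (\<alpha> (fst p))" "linear (\<beta> (snd p))" "linear (\<gamma> (fst p))" "linear (\<delta> (snd p))"
  shows "G p (sum_form \<alpha> \<beta> p) (sum_form \<gamma> \<delta> p)
    = GBs (fst p) (\<alpha> (fst p)) (\<gamma> (fst p)) + k (fst p) * GFs (snd p) (\<beta> (snd p)) (\<delta> (snd p))"
proof -
  have "linear (sum_form \<alpha> \<beta> p)" "linear (sum_form \<gamma> \<delta> p)" by (intro linear_sum_form assms)+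
  then show ?thesis
    by (subst cometric_warped) (simp_all add: sum_form_def assms linear_0)
qed

text \<open>Test forms with one slot zero isolate one block of the difference. Their values exhaust
  the covectors of that factor, so nondegeneracy there applies, on \<open>F\<close> because the
  weight \<open>k\<close> is nonzero.\<close>

lemma G_cancel:
  assumes "linear a" "linear a'"
    and "\<And>\<gamma> \<delta>. \<gamma> \<in> forms B \<Longrightarrow> \<delta> \<in> forms F \<Longrightarrow> G p a (sum_form \<gamma> \<delta> p) = G p a' (sum_form \<gamma> \<delta> p)"
  shows "a = a'"
proof -
  define d where "d = (\<lambda>v. a v - a' v)"
  have d: "linear d" unfolding d_def by (intro linear_compose_sub assms)
  have G0: "G p d (sum_form \<gamma> \<delta> p) = 0" if "\<gamma> \<in> forms B" "\<delta> \<in> forms F" for \<gamma> \<delta>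
    unfolding d_def using assms(3)[OF that]
    by (simp add: G_diff assms linear_sum_form B.forms_linear F.forms_linear that)
  have k0: "k (fst p) \<noteq> 0" using f_pos[of "fst p"] by (simp add: k_def)
  have "(\<lambda>x. d (x, 0)) = (\<lambda>_. 0)"
  proof (rule GB.cometric_nondegenerate[OF linear_restrict(1)[OF d], where p = "fst p"])
    fix c :: "'e \<Rightarrow> real" assume c: "linear c"
    obtain \<gamma> where \<gamma>: "\<gamma> \<in> forms B" "\<gamma> (fst p) = c" using GB.ex_form_value[OF c] by blast
    show "GBs (fst p) (\<lambda>x. d (x, 0)) c = 0"
      using G0[OF \<gamma>(1) F.zero_form_forms]
      by (simp add: cometric_warped d linear_sum_form linear_zero c \<gamma> sum_form_def GF.cometric_zero
          B.forms_linear[OF \<gamma>(1)] linear_compose[OF linear_fst c, unfolded o_def] linear_0[OF c])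
  qed
  moreover have "(\<lambda>y. d (0, y)) = (\<lambda>_. 0)"
  proof (rule GF.cometric_nondegenerate[OF linear_restrict(2)[OF d], where p = "snd p"])
    fix c :: "'h \<Rightarrow> real" assume c: "linear c"
    obtain \<delta> where \<delta>: "\<delta> \<in> forms F" "\<delta> (snd p) = c" using GF.ex_form_value[OF c] by blast
    show "GFs (snd p) (\<lambda>y. d (0, y)) c = 0"
      using G0[OF B.zero_form_forms \<delta>(1)] k0
      by (simp add: cometric_warped d linear_sum_form linear_zero c \<delta> sum_form_def GB.cometric_zero
          F.forms_linear[OF \<delta>(1)] linear_compose[OF linear_snd c, unfolded o_def] linear_0[OF c])
  qed
  ultimately have "d v = 0" for v
    using linear_add[OF d, of "(fst v, 0)" "(0, snd v)"] by (simp add: fun_eq_iff)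
  then show ?thesis by (simp add: d_def fun_eq_iff)
qed

text \<open>Differentiating the weighted summand produces a Leibniz term with the differential of
  \<open>k\<close>. It vanishes by \<open>act_k\<close>, so the weight passes through the
  derivative.\<close>

lemma act_pairing_sum_form:
  assumes "\<alpha> \<in> forms B" "\<beta> \<in> forms F" "\<gamma> \<in> forms B" "\<delta> \<in> forms F" "\<mu> \<in> forms B" "\<nu> \<in> forms F"
  shows "act N (anchor P (sum_form \<alpha> \<beta>)) (pairing G (sum_form \<gamma> \<delta>) (sum_form \<mu> \<nu>)) p =
    act B (anchor PB \<alpha>) (pairing GBs \<gamma> \<mu>) (fst p) + k (fst p) * act F (anchor PF \<beta>) (pairing GFs \<delta> \<nu>) (snd p)"
proof -
  obtain b q where p: "p = (b, q)" by force
  have "pairing G (sum_form \<gamma> \<delta>) (sum_form \<mu> \<nu>) = (\<lambda>z. pairing GBs \<gamma> \<mu> (fst z) + k (fst z) * pairing GFs \<delta> \<nu> (snd z))"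
    unfolding pairing_def by (intro ext G_sum_form B.forms_linear F.forms_linear assms)
  then show ?thesis
    unfolding act_def p anchor_sum_form[OF assms(1,2)]
    using act_k[of \<alpha>, OF B.forms_linear[OF assms(1)]]
    by (simp add: ext_d_prod[OF GB.smooth_fun_cometric[OF assms(3,5)] k_smooth GF.smooth_fun_cometric[OF assms(4,6)]])
qed

lemma act_f_prod:
  assumes "A \<in> forms N"
  shows "act N (anchor P A) fh p = 0"
proof -
  obtain b q where p: "p = (b, q)" by force
  have lin: "linear (A p)" using assms unfolding forms_def by blast
  show ?thesis
    \<comment> \<open>The lift of \<open>f\<close> is written as \<open>f\<close> plus a product of
      zero functions.\<close>
    using ext_d_prod[OF f_smooth B.smooth_fun_const[of 0] F.smooth_fun_const[of 0], of b q]
      act_f[of "\<lambda>_ x. A p (x, 0)", OF linear_restrict(1)[OF lin]]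
    unfolding act_def anchor_prod[where A = A and p = p, OF lin] by (simp add: p ext_d_const)
qed

end

lemma sum_lessThan_add:
  fixes u :: "nat \<Rightarrow> real"
  shows "(\<Sum>i<m + n. u i) = (\<Sum>i<m. u i) + (\<Sum>j<n. u (m + j))"
  by (induction n) auto

lemma add_form_zero: "add_form \<alpha> (scale_form (\<lambda>_. 0) \<beta>) = \<alpha>"
  by (simp add: add_form_def scale_form_def)

section \<open>The connection of the product on lifts\<close>

locale warped_connection = warped_product B F PB PF gB gF f
  + DN: contravariant_connection N P G DN + DF: contravariant_connection F PF GFs DF
  for B :: "('b::{t2_space, second_countable_topology}, 'e::euclidean_space) mfd"
    and F :: "('f::{t2_space, second_countable_topology}, 'h::euclidean_space) mfd"
    and PB :: "('b, 'e) cobilinear" and PF :: "('f, 'h) cobilinear"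
    and gB :: "('b, 'e) metric" and gF :: "('f, 'h) metric"
    and f :: "'b \<Rightarrow> real"
    and DN :: "('b \<times> 'f, 'e \<times> 'h) connection" and DF :: "('f, 'h) connection"
begin

abbreviation hl :: "('b, 'e) form \<Rightarrow> ('b \<times> 'f, 'e \<times> 'h) form" where
  "hl \<alpha> \<equiv> sum_form \<alpha> zero_form"

abbreviation vl :: "('f, 'h) form \<Rightarrow> ('b \<times> 'f, 'e \<times> 'h) form" where
  "vl \<beta> \<equiv> sum_form zero_form \<beta>"

lemma hl_forms: "\<alpha> \<in> forms B \<Longrightarrow> hl \<alpha> \<in> forms N"
  and vl_forms: "\<beta> \<in> forms F \<Longrightarrow> vl \<beta> \<in> forms N"
  by (simp_all add: sum_form_forms B.zero_form_forms F.zero_form_forms)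

lemma sum_form_zero: "sum_form zero_form zero_form = zero_form"
  by (simp add: sum_form_def)

lemma zero_form_forms_prod: "zero_form \<in> forms N"
  using hl_forms[OF B.zero_form_forms] by (simp add: sum_form_zero)

text \<open>On \<open>F\<close> and on the product this follows from homogeneity of a connection.
  \<open>B\<close> comes without one, so its bracket is read off from the bracket of horizontal
  lifts.\<close>

lemma koszul_zero_B:
  assumes "\<gamma> \<in> forms B"
  shows "koszul B PB zero_form \<gamma> = zero_form" "koszul B PB \<gamma> zero_form = zero_form"
proof -
  note z = B.zero_form_forms F.zero_form_forms
  have kF: "koszul F PF zero_form zero_form = zero_form" by (rule DF.koszul_zero[OF z(2) z(2)])
  have "hl (koszul B PB zero_form \<gamma>) = koszul N P zero_form (hl \<gamma>)"
    using koszul_sum_form[OF z(1) z(2) assms z(2)] by (simp only: sum_form_zero kF)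
  also have "\<dots> = zero_form" by (rule DN.koszul_zero(1)[OF hl_forms[OF assms] zero_form_forms_prod])
  finally have "hl (koszul B PB zero_form \<gamma>) = zero_form" .
  then have "hl (koszul B PB zero_form \<gamma>) (b, q) (v, 0) = 0" for b v and q :: 'f by simp
  then show "koszul B PB zero_form \<gamma> = zero_form" by (simp add: sum_form_def fun_eq_iff)
  have "hl (koszul B PB \<gamma> zero_form) = koszul N P (hl \<gamma>) zero_form"
    using koszul_sum_form[OF assms z(2) z(1) z(2)] by (simp only: sum_form_zero kF)
  also have "\<dots> = zero_form" by (rule DN.koszul_zero(2)[OF hl_forms[OF assms] zero_form_forms_prod])
  finally have "hl (koszul B PB \<gamma> zero_form) = zero_form" .
  then have "hl (koszul B PB \<gamma> zero_form) (b, q) (v, 0) = 0" for b v and q :: 'f by simp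
  then show "koszul B PB \<gamma> zero_form = zero_form" by (simp add: sum_form_def fun_eq_iff)
qed

lemmas koszul_zero_F = DF.koszul_zero[OF _ F.zero_form_forms]

text \<open>Also obtained from the product, by restricting to the first block over an arbitrary
  point of \<open>F\<close>.\<close>

lemma koszul_linear_B:
  assumes "\<alpha> \<in> forms B" "\<gamma> \<in> forms B"
  shows "linear (koszul B PB \<alpha> \<gamma> b)"
proof -
  note z = F.zero_form_forms
  have "linear (koszul N P (hl \<alpha>) (hl \<gamma>) (b, undefined))"
    by (intro DN.koszul_linear hl_forms assms)
  then have "linear (hl (koszul B PB \<alpha> \<gamma>) (b, undefined))"
    by (simp only: koszul_sum_form[OF assms(1) z assms(2) z] koszul_zero_F[OF z])
  from linear_restrict(1)[OF this] show ?thesis by (simp add: sum_form_def)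
qed

text \<open>Derivatives split by \<open>act_pairing_sum_form\<close>, brackets by
  \<open>koszul_sum_form\<close> and \<open>G_sum_form\<close>, each time with weight
  \<open>k\<close> on the part of \<open>F\<close>.\<close>

lemma koszul_rhs_prod:
  assumes "\<alpha> \<in> forms B" "\<beta> \<in> forms F" "\<gamma> \<in> forms B" "\<delta> \<in> forms F" "\<mu> \<in> forms B" "\<nu> \<in> forms F"
  shows "koszul_rhs N P G (sum_form \<alpha> \<beta>) (sum_form \<gamma> \<delta>) (sum_form \<mu> \<nu>) p =
    koszul_rhs B PB GBs \<alpha> \<gamma> \<mu> (fst p) + k (fst p) * koszul_rhs F PF GFs \<beta> \<delta> \<nu> (snd p)"
proof -
  have br: "pairing G (koszul N P (sum_form \<alpha>1 \<beta>1) (sum_form \<alpha>2 \<beta>2)) (sum_form \<alpha>3 \<beta>3) p =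
      pairing GBs (koszul B PB \<alpha>1 \<alpha>2) \<alpha>3 (fst p) + k (fst p) * pairing GFs (koszul F PF \<beta>1 \<beta>2) \<beta>3 (snd p)"
    if "\<alpha>1 \<in> forms B" "\<beta>1 \<in> forms F" "\<alpha>2 \<in> forms B" "\<beta>2 \<in> forms F" "\<alpha>3 \<in> forms B" "\<beta>3 \<in> forms F"
    for \<alpha>1 \<alpha>2 \<alpha>3 \<beta>1 \<beta>2 \<beta>3
    unfolding koszul_sum_form[OF that(1-4)] pairing_def
    by (intro G_sum_form koszul_linear_B DF.koszul_linear B.forms_linear F.forms_linear that)
  show ?thesis
    unfolding koszul_rhs_def
      act_pairing_sum_form[OF assms] act_pairing_sum_form[OF assms(3,4,1,2,5,6)]
      act_pairing_sum_form[OF assms(5,6,1,2,3,4)]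
      br[OF assms] br[OF assms(3-6) assms(1,2)] br[OF assms(5,6) assms(1-4)]
    by (simp add: algebra_simps)
qed

lemma koszul_rhs_zero_B:
  assumes "\<gamma> \<in> forms B" "\<mu> \<in> forms B"
  shows "koszul_rhs B PB GBs zero_form \<gamma> \<mu> b = 0"
proof -
  have p0: "pairing GBs zero_form \<alpha> = (\<lambda>_. 0)" "pairing GBs \<alpha> zero_form = (\<lambda>_. 0)" for \<alpha>
    by (simp_all add: pairing_def GB.cometric_zero)
  show ?thesis
    using linear_0[OF B.linear_ext_d[OF GB.smooth_fun_cometric[OF assms]]]
    by (simp add: koszul_rhs_def p0 koszul_zero_B assms act_def PB.anchor_zero ext_d_const)
qed

lemma koszul_rhs_zero_F:
  assumes "\<beta> \<in> forms F" "\<nu> \<in> forms F"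
  shows "koszul_rhs F PF GFs \<beta> zero_form \<nu> q = 0"
proof -
  have p0: "pairing GFs zero_form \<alpha> = (\<lambda>_. 0)" "pairing GFs \<alpha> zero_form = (\<lambda>_. 0)" for \<alpha>
    by (simp_all add: pairing_def GF.cometric_zero)
  show ?thesis
    using linear_0[OF F.linear_ext_d[OF GF.smooth_fun_cometric[OF assms]]]
    by (simp add: koszul_rhs_def p0 koszul_zero_F assms act_def PF.anchor_zero ext_d_const)
qed

lemma koszul_formula_N:
  "\<alpha> \<in> forms N \<Longrightarrow> \<beta> \<in> forms N \<Longrightarrow> \<gamma> \<in> forms N \<Longrightarrow>
    2 * pairing G (DN \<alpha> \<beta>) \<gamma> p = koszul_rhs N P G \<alpha> \<beta> \<gamma> p"
  by (rule DN.koszul_formula[OF G_sym G_diff])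

lemma koszul_formula_F:
  "\<alpha> \<in> forms F \<Longrightarrow> \<beta> \<in> forms F \<Longrightarrow> \<gamma> \<in> forms F \<Longrightarrow>
    2 * pairing GFs (DF \<alpha> \<beta>) \<gamma> p = koszul_rhs F PF GFs \<alpha> \<beta> \<gamma> p"
  by (rule DF.koszul_formula[OF GF.cometric_sym GF.cometric_diff])

text \<open>Against a test form \<gamma>^h + \<delta>^v the part of \<open>B\<close> in the Koszul
  formula is zero, the part of \<open>F\<close> is the Koszul formula of \<open>DF\<close>, and both
  sides carry the same weight \<open>k\<close>.\<close>

lemma D_vl_vl:
  assumes "\<alpha> \<in> forms F" "\<beta> \<in> forms F"
  shows "DN (vl \<alpha>) (vl \<beta>) = vl (DF \<alpha> \<beta>)"
proof
  fix p
  note z = B.zero_form_forms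
  have D: "DF \<alpha> \<beta> \<in> forms F" by (rule DF.D_forms[OF assms])
  show "DN (vl \<alpha>) (vl \<beta>) p = vl (DF \<alpha> \<beta>) p"
  proof (rule G_cancel)
    show "linear (DN (vl \<alpha>) (vl \<beta>) p)"
      by (intro DN.forms_linear' DN.D_forms vl_forms assms)
    show "linear (vl (DF \<alpha> \<beta>) p)" by (intro DN.forms_linear' vl_forms D)
    fix \<gamma> \<delta> assume c: "\<gamma> \<in> forms B" "\<delta> \<in> forms F"
    have "2 * pairing G (DN (vl \<alpha>) (vl \<beta>)) (sum_form \<gamma> \<delta>) p = k (fst p) * (2 * pairing GFs (DF \<alpha> \<beta>) \<delta> (snd p))"
      unfolding koszul_formula_F[OF assms c(2)]
        koszul_formula_N[OF vl_forms[OF assms(1)] vl_forms[OF assms(2)] sum_form_forms[OF c]]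
        koszul_rhs_prod[OF z assms(1) z assms(2) c] koszul_rhs_zero_B[OF z c(1)] by simp
    moreover have "pairing G (vl (DF \<alpha> \<beta>)) (sum_form \<gamma> \<delta>) p = k (fst p) * pairing GFs (DF \<alpha> \<beta>) \<delta> (snd p)"
      unfolding pairing_def
      by (subst G_sum_form) (simp_all add: B.forms_linear F.forms_linear c D z linear_zero GB.cometric_zero)
    ultimately show "G p (DN (vl \<alpha>) (vl \<beta>) p) (sum_form \<gamma> \<delta> p) = G p (vl (DF \<alpha> \<beta>) p) (sum_form \<gamma> \<delta> p)"
      unfolding pairing_def by simp
  qed
qed

text \<open>The first argument is zero over \<open>B\<close> and the second is zero over
  \<open>F\<close>, so both parts of the Koszul formula vanish.\<close>

lemma D_vl_hl:
  assumes "\<alpha> \<in> forms F" "\<eta> \<in> forms B"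
  shows "DN (vl \<alpha>) (hl \<eta>) = zero_form"
proof
  fix p
  note z = B.zero_form_forms F.zero_form_forms
  show "DN (vl \<alpha>) (hl \<eta>) p = (\<lambda>_. 0)"
  proof (rule G_cancel)
    show "linear (DN (vl \<alpha>) (hl \<eta>) p)"
      by (intro DN.forms_linear' DN.D_forms vl_forms hl_forms assms)
    show "linear (\<lambda>_ :: 'e \<times> 'h. 0 :: real)" by (rule linear_zero)
    fix \<gamma> \<delta> assume c: "\<gamma> \<in> forms B" "\<delta> \<in> forms F"
    have "2 * pairing G (DN (vl \<alpha>) (hl \<eta>)) (sum_form \<gamma> \<delta>) p = 0"
      unfolding koszul_formula_N[OF vl_forms[OF assms(1)] hl_forms[OF assms(2)] sum_form_forms[OF c]]
        koszul_rhs_prod[OF z(1) assms z(2) c] koszul_rhs_zero_B[OF assms(2) c(1)]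
        koszul_rhs_zero_F[OF assms(1) c(2)] by simp
    moreover have "G p (\<lambda>_. 0) (sum_form \<gamma> \<delta> p) = 0"
      using G_sum_form[of zero_form p zero_form \<gamma> \<delta>]
      by (simp add: B.forms_linear F.forms_linear c linear_zero sum_form_zero GB.cometric_zero GF.cometric_zero)
    ultimately show "G p (DN (vl \<alpha>) (hl \<eta>) p) (sum_form \<gamma> \<delta> p) = G p (\<lambda>_. 0) (sum_form \<gamma> \<delta> p)"
      unfolding pairing_def by simp
  qed
qed

lemma koszul_vl_hl:
  assumes "\<alpha> \<in> forms F" "\<eta> \<in> forms B"
  shows "koszul N P (vl \<alpha>) (hl \<eta>) = zero_form"
  using koszul_sum_form[OF B.zero_form_forms assms F.zero_form_forms]
  by (simp add: koszul_zero_B koszul_zero_F assms sum_form_zero)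

text \<open>Lifts from different factors have zero bracket, so torsion-freeness carries
  \<open>D_vl_hl\<close> over.\<close>

lemma D_hl_vl:
  assumes "\<alpha> \<in> forms F" "\<eta> \<in> forms B"
  shows "DN (hl \<eta>) (vl \<alpha>) = zero_form"
  using DN.torsion_free[OF vl_forms[OF assms(1)] hl_forms[OF assms(2)]]
    koszul_vl_hl[OF assms] D_vl_hl[OF assms] by (simp add: diff_form_def fun_eq_iff)

lemma G_zero: "linear a \<Longrightarrow> G p (\<lambda>_. 0) a = 0" "linear a \<Longrightarrow> G p a (\<lambda>_. 0) = 0"
  by (simp_all add: cometric_warped linear_zero GB.cometric_zero GF.cometric_zero)

lemma pairing_hl_vl:
  assumes "\<eta> \<in> forms B" "\<beta> \<in> forms F"
  shows "pairing G (hl \<eta>) (vl \<beta>) = (\<lambda>_. 0)"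
  by (rule ext) (simp add: pairing_def G_sum_form B.forms_linear F.forms_linear assms linear_zero
      GB.cometric_zero GF.cometric_zero)

lemma pairing_vl_vl:
  assumes "\<alpha> \<in> forms F" "\<beta> \<in> forms F"
  shows "pairing G (vl \<alpha>) (vl \<beta>) p = k (fst p) * pairing GFs \<alpha> \<beta> (snd p)"
  by (simp add: pairing_def G_sum_form F.forms_linear assms linear_zero GB.cometric_zero)

lemma pairing_hl_hl:
  assumes "\<alpha> \<in> forms B" "\<beta> \<in> forms B"
  shows "pairing G (hl \<alpha>) (hl \<beta>) p = pairing GBs \<alpha> \<beta> (fst p)"
  by (simp add: pairing_def G_sum_form B.forms_linear assms linear_zero GF.cometric_zero)

text \<open>
  Only the fact that \<open>D\<^sub>\<eta> \<eta>\<close> is orthogonal to the vertical lifts enters here, so that no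
  Levi-Civita connection on \<open>B\<close> is needed.
\<close>

lemma curvature_vl_hl:
  assumes "\<alpha> \<in> forms F" "\<beta> \<in> forms F" "\<eta> \<in> forms B"
  shows "pairing G (curvature N P DN (vl \<alpha>) (hl \<eta>) (hl \<eta>)) (vl \<beta>) p = 0"
proof -
  let ?\<theta> = "DN (hl \<eta>) (hl \<eta>)"
  note h = hl_forms[OF assms(3)]
  have \<theta>: "?\<theta> \<in> forms N" by (rule DN.D_forms[OF h h])
  \<comment> \<open>Metric compatibility along \<open>hl \<eta>\<close>: the pairing of
    \<open>hl \<eta>\<close> with \<open>vl \<delta>\<close> is constantly 0, and
    \<open>vl \<delta>\<close> is parallel in this direction.\<close>
  have perp: "pairing G ?\<theta> (vl \<delta>) = (\<lambda>_. 0)" if "\<delta> \<in> forms F" for \<delta>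
    using DN.metric_compatible[OF h h vl_forms[OF that]]
    by (simp add: fun_eq_iff pairing_hl_vl[OF assms(3) that] D_hl_vl[OF that assms(3)] act_def ext_d_const)
       (simp add: pairing_def G_zero DN.forms_linear'[OF h])
  have "curvature N P DN (vl \<alpha>) (hl \<eta>) (hl \<eta>) = DN (vl \<alpha>) ?\<theta>"
    unfolding curvature_def D_vl_hl[OF assms(1,3)] koszul_vl_hl[OF assms(1,3)]
      DN.D_zero[OF h zero_form_forms_prod] by (simp add: diff_form_def)
  \<comment> \<open>Metric compatibility along \<open>vl \<alpha>\<close> moves the derivative onto
    \<open>vl \<beta>\<close>, where it gives a vertical lift again, orthogonal to \<theta>.\<close>
  moreover have "pairing G (DN (vl \<alpha>) ?\<theta>) (vl \<beta>) p = 0"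
    using DN.metric_compatible[OF vl_forms[OF assms(1)] \<theta> vl_forms[OF assms(2)], of p]
    by (simp add: perp assms(2) act_def ext_d_const D_vl_vl assms(1) DF.D_forms)
  ultimately show ?thesis by simp
qed

section \<open>Curvature on rescaled vertical forms\<close>

lemma fh_smooth: "smooth_fun N fh"
  by (rule smooth_fun_fst[OF f_smooth])

abbreviation fscale :: "('b \<times> 'f, 'e \<times> 'h) form \<Rightarrow> ('b \<times> 'f, 'e \<times> 'h) form" where
  "fscale \<equiv> scale_form fh"

lemma fscale_forms: "A \<in> forms N \<Longrightarrow> fscale A \<in> forms N"
  by (rule scale_form_forms[OF fh_smooth])

text \<open>The Leibniz term contains the derivative of \<open>f\<close> along an anchor, which is
  0, so multiplication by \<open>f\<close> commutes with the connection in both slots.\<close>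

lemma D_fscale:
  assumes "A \<in> forms N" "C \<in> forms N"
  shows "DN A (fscale C) = fscale (DN A C)" "DN (fscale A) C = fscale (DN A C)"
proof -
  have "act N (anchor P A) fh = (\<lambda>_. 0)" by (rule ext) (rule act_f_prod[OF assms(1)])
  then show "DN A (fscale C) = fscale (DN A C)"
    using DN.D_scale_right[OF fh_smooth assms] by (simp add: add_form_zero)
  show "DN (fscale A) C = fscale (DN A C)" by (rule DN.D_scale_left[OF fh_smooth assms])
qed

lemma fscale_diff: "diff_form (fscale A) (fscale C) = fscale (diff_form A C)"
  by (simp add: diff_form_def scale_form_def right_diff_distrib)

lemma vl_diff: "diff_form (vl \<alpha>) (vl \<beta>) = vl (diff_form \<alpha> \<beta>)"
  by (simp add: diff_form_def sum_form_def)

text \<open>Each rescaled argument contributes one factor \<open>f\<close>, also through the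
  bracket; what remains is computed by \<open>D_vl_vl\<close>.\<close>

lemma curvature_vl_fscale:
  assumes "\<alpha> \<in> forms F" "\<eta> \<in> forms F"
  shows "curvature N P DN (vl \<alpha>) (fscale (vl \<eta>)) (fscale (vl \<eta>)) =
    fscale (fscale (vl (curvature F PF DF \<alpha> \<eta> \<eta>)))"
proof -
  note a = vl_forms[OF assms(1)] and e = vl_forms[OF assms(2)]
  \<comment> \<open>Torsion-freeness shows that the bracket is a smooth form, as a difference of two
    such.\<close>
  have kos: "koszul F PF \<alpha> \<eta> \<in> forms F"
    unfolding DF.torsion_free[OF assms, symmetric]
    by (intro F.diff_form_forms DF.D_forms assms)
  have "koszul N P (vl \<alpha>) (fscale (vl \<eta>)) = fscale (vl (koszul F PF \<alpha> \<eta>))"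
    unfolding DN.torsion_free[OF a fscale_forms[OF e], symmetric] DF.torsion_free[OF assms, symmetric]
    by (simp add: D_fscale a e D_vl_vl assms fscale_diff vl_diff)
  then show ?thesis
    unfolding curvature_def
    by (simp add: D_fscale D_vl_vl assms a e kos DF.D_forms vl_forms fscale_forms fscale_diff vl_diff)
qed

lemma pairing_curvature_vl:
  assumes "\<alpha> \<in> forms F" "\<beta> \<in> forms F" "\<eta> \<in> forms F"
  shows "pairing G (curvature N P DN (vl \<alpha>) (fscale (vl \<eta>)) (fscale (vl \<eta>))) (vl \<beta>) p =
    pairing GFs (curvature F PF DF \<alpha> \<eta> \<eta>) \<beta> (snd p)"
proof -
  let ?R = "curvature F PF DF \<alpha> \<eta> \<eta>"
  have kos: "koszul F PF \<alpha> \<eta> \<in> forms F"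
    unfolding DF.torsion_free[OF assms(1,3), symmetric]
    by (intro F.diff_form_forms DF.D_forms assms)
  have R: "?R \<in> forms F"
    unfolding curvature_def by (intro F.diff_form_forms DF.D_forms assms kos)
  have "f (fst p) \<noteq> 0" using f_pos[of "fst p"] by simp
  moreover have "pairing G (fscale (fscale (vl ?R))) (vl \<beta>) p = (f (fst p))\<^sup>2 * pairing G (vl ?R) (vl \<beta>) p"
    using G_scale[of "vl ?R p" "vl \<beta> p" p "(f (fst p))\<^sup>2"]
    by (simp add: pairing_def scale_form_def power2_eq_square mult.assoc DN.forms_linear' vl_forms R assms(2))
  ultimately show ?thesis
    unfolding curvature_vl_fscale[OF assms(1,3)] pairing_vl_vl[OF R assms(2)] by (simp add: k_def pairing_vl_vl[OF R assms(2)])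
qed

section \<open>Adapted coframes and the vertical Ricci curvature\<close>

lemma prod_coframe:
  assumes "local_coframe B GBs U \<eta> \<epsilon>" "local_coframe F GFs V \<zeta> \<kappa>"
  shows "local_coframe N G (U \<times> V)
    (\<lambda>i. if i < DIM('e) then hl (\<eta> i) else fscale (vl (\<zeta> (i - DIM('e)))))
    (\<lambda>i. if i < DIM('e) then \<epsilon> i else \<kappa> (i - DIM('e)))"
proof -
  let ?\<xi> = "\<lambda>i. if i < DIM('e) then hl (\<eta> i) else fscale (vl (\<zeta> (i - DIM('e))))"
  have B: "open U" "\<And>i. i < DIM('e) \<Longrightarrow> \<eta> i \<in> forms B" "\<And>i. i < DIM('e) \<Longrightarrow> \<epsilon> i \<in> {1, -1}"
    "\<And>p i j. p \<in> U \<Longrightarrow> i < DIM('e) \<Longrightarrow> j < DIM('e) \<Longrightarrow> pairing GBs (\<eta> i) (\<eta> j) p = (if i = j then \<epsilon> i else 0)"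
    using assms(1) by (auto simp: local_coframe_def)
  have F: "open V" "\<And>i. i < DIM('h) \<Longrightarrow> \<zeta> i \<in> forms F" "\<And>i. i < DIM('h) \<Longrightarrow> \<kappa> i \<in> {1, -1}"
    "\<And>p i j. p \<in> V \<Longrightarrow> i < DIM('h) \<Longrightarrow> j < DIM('h) \<Longrightarrow> pairing GFs (\<zeta> i) (\<zeta> j) p = (if i = j then \<kappa> i else 0)"
    using assms(2) by (auto simp: local_coframe_def)
  have psym: "pairing G A C p = pairing G C A p" for A C p unfolding pairing_def by (rule G_sym)
  have psc: "pairing G (fscale A) C p = f (fst p) * pairing G A C p" if "A \<in> forms N" "C \<in> forms N" for A C p
    unfolding pairing_def scale_form_def by (intro G_scale DN.forms_linear' that)
  have forms: "?\<xi> i \<in> forms N" if "i < DIM('e) + DIM('h)" for i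
    using that by (auto intro!: hl_forms vl_forms fscale_forms B(2) F(2))
  have hv: "pairing G (hl (\<eta> i)) (fscale (vl (\<zeta> j))) p = 0" if "i < DIM('e)" "j < DIM('h)" for i j p
    using psc[OF vl_forms[OF F(2)[OF that(2)]] hl_forms[OF B(2)[OF that(1)]], of p]
      psym[of "vl (\<zeta> j)" "hl (\<eta> i)" p] psym[of "hl (\<eta> i)" "fscale (vl (\<zeta> j))" p]
      pairing_hl_vl[OF B(2)[OF that(1)] F(2)[OF that(2)]] by simp
  \<comment> \<open>Each rescaling gives one factor \<open>f\<close>, and together they cancel
    \<open>k\<close>.\<close>
  have vv: "pairing G (fscale (vl (\<zeta> i))) (fscale (vl (\<zeta> j))) p = pairing GFs (\<zeta> i) (\<zeta> j) (snd p)"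
    if ij: "i < DIM('h)" "j < DIM('h)" for i j p
  proof -
    have "f (fst p) \<noteq> 0" using f_pos[of "fst p"] by simp
    have v: "vl (\<zeta> i) \<in> forms N" "vl (\<zeta> j) \<in> forms N" by (intro vl_forms F(2) ij)+
    have "pairing G (fscale (vl (\<zeta> i))) (fscale (vl (\<zeta> j))) p
        = f (fst p) * (f (fst p) * pairing G (vl (\<zeta> j)) (vl (\<zeta> i)) p)"
      unfolding psc[OF v(1) fscale_forms[OF v(2)]] psym[of "vl (\<zeta> i)"] psc[OF v(2,1)] ..
    then show ?thesis
      unfolding psym[of "vl (\<zeta> j)"] pairing_vl_vl[OF F(2)[OF ij(1)] F(2)[OF ij(2)]]
      using \<open>f (fst p) \<noteq> 0\<close> by (simp add: k_def power2_eq_square field_simps)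
  qed
  have orth: "pairing G (?\<xi> i) (?\<xi> j) p = (if i = j then if i < DIM('e) then \<epsilon> i else \<kappa> (i - DIM('e)) else 0)"
    if p: "p \<in> U \<times> V" and ij: "i < DIM('e) + DIM('h)" "j < DIM('e) + DIM('h)" for p i j
  proof (cases "i < DIM('e)"; cases "j < DIM('e)")
    assume "i < DIM('e)" "j < DIM('e)"
    then show ?thesis using p by (auto simp: pairing_hl_hl B)
  next
    assume "i < DIM('e)" "\<not> j < DIM('e)"
    then show ?thesis using ij hv[of i "j - DIM('e)"] by auto
  next
    assume "\<not> i < DIM('e)" "j < DIM('e)"
    then show ?thesis using ij hv[of j "i - DIM('e)" p] psym[of "hl (\<eta> j)" _ p] by auto
  next
    assume "\<not> i < DIM('e)" "\<not> j < DIM('e)"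
    moreover from this ij have "i - DIM('e) < DIM('h)" "j - DIM('e) < DIM('h)" by auto
    ultimately show ?thesis using p F(4)[of "snd p" "i - DIM('e)" "j - DIM('e)"] by (auto simp: vv)
  qed
  show ?thesis
    unfolding local_coframe_def DIM_prod
  proof (intro conjI allI impI ballI)
    show "open (U \<times> V)" using B(1) F(1) by (rule open_Times)
    show "(if i < DIM('e) then \<epsilon> i else \<kappa> (i - DIM('e))) \<in> {1, -1}" if "i < DIM('e) + DIM('h)" for i
      using that B(3)[of i] F(3)[of "i - DIM('e)"] by auto
  qed (fact forms orth)+
qed

text \<open>The sum splits at the index \<open>DIM('e)\<close>: the horizontal summands vanish by
  \<open>curvature_vl_hl\<close>, and the vertical ones lose their dependence on \<open>f\<close> by
  \<open>pairing_curvature_vl\<close>.\<close>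

lemma ricci_vl:
  assumes "local_coframe B GBs U \<eta> \<epsilon>" "local_coframe F GFs V \<zeta> \<kappa>" "\<alpha> \<in> forms F" "\<beta> \<in> forms F"
  shows "(\<Sum>i<DIM('e \<times> 'h). (if i < DIM('e) then \<epsilon> i else \<kappa> (i - DIM('e))) * pairing G (curvature N P DN (vl \<alpha>)
      (if i < DIM('e) then hl (\<eta> i) else fscale (vl (\<zeta> (i - DIM('e)))))
      (if i < DIM('e) then hl (\<eta> i) else fscale (vl (\<zeta> (i - DIM('e)))))) (vl \<beta>) p) =
    (\<Sum>j<DIM('h). \<kappa> j * pairing GFs (curvature F PF DF \<alpha> (\<zeta> j) (\<zeta> j)) \<beta> (snd p))"
proof -
  have "\<eta> i \<in> forms B" if "i < DIM('e)" for i using assms(1) that by (auto simp: local_coframe_def)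
  moreover have "\<zeta> j \<in> forms F" if "j < DIM('h)" for j using assms(2) that by (auto simp: local_coframe_def)
  ultimately show ?thesis
    unfolding DIM_prod sum_lessThan_add
    by (simp add: curvature_vl_hl pairing_curvature_vl assms(3,4))
qed

end

section \<open>Comparison of the Einstein constants\<close>

context warped_product
begin

lemma einstein_constants:
  assumes "einstein_const N P G lam" "einstein_const F PF GFs lamF"
  shows "lam = lamF * (f b)\<^sup>2"
proof -
  obtain Ric where Ric: "ricci N P G Ric"
    and lam: "\<forall>\<alpha>\<in>forms N. \<forall>\<beta>\<in>forms N. \<forall>p. Ric \<alpha> \<beta> p = lam * pairing G \<alpha> \<beta> p"
    using assms(1) unfolding einstein_const_def by (elim exE conjE)
  obtain DN where DN: "levi_civita N P G DN"
    and Ric_eq: "\<forall>U \<eta> \<epsilon>. local_coframe N G U \<eta> \<epsilon> \<longrightarrow> (\<forall>\<alpha>\<in>forms N. \<forall>\<beta>\<in>forms N. \<forall>p\<in>U.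
      Ric \<alpha> \<beta> p = (\<Sum>i<DIM('e \<times> 'h). \<epsilon> i * pairing G (curvature N P DN \<alpha> (\<eta> i) (\<eta> i)) \<beta> p))"
    using Ric unfolding ricci_def by (elim exE conjE)
  obtain RicF where RicF: "ricci F PF GFs RicF"
    and lamF: "\<forall>\<alpha>\<in>forms F. \<forall>\<beta>\<in>forms F. \<forall>p. RicF \<alpha> \<beta> p = lamF * pairing GFs \<alpha> \<beta> p"
    using assms(2) unfolding einstein_const_def by (elim exE conjE)
  obtain DF where DF: "levi_civita F PF GFs DF"
    and RicF_eq: "\<forall>U \<eta> \<epsilon>. local_coframe F GFs U \<eta> \<epsilon> \<longrightarrow> (\<forall>\<alpha>\<in>forms F. \<forall>\<beta>\<in>forms F. \<forall>p\<in>U.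
      RicF \<alpha> \<beta> p = (\<Sum>i<DIM('h). \<epsilon> i * pairing GFs (curvature F PF DF \<alpha> (\<eta> i) (\<eta> i)) \<beta> p))"
    using RicF unfolding ricci_def by (elim exE conjE)
  interpret warped_connection B F PB PF gB gF f DN DF
    using DN DF by unfold_locales
  \<comment> \<open>An arbitrary point of \<open>F\<close> over which the two Ricci curvatures are
    compared.\<close>
  define q :: 'f where "q = undefined"
  obtain U \<eta> \<epsilon> where U: "b \<in> U" "local_coframe B GBs U \<eta> \<epsilon>" by (rule GB.ex_local_coframe)
  obtain V \<zeta> \<kappa> where V: "q \<in> V" "local_coframe F GFs V \<zeta> \<kappa>" by (rule GF.ex_local_coframe)
  \<comment> \<open>Positive dimension makes 0 an admissible index. The square of this form at
    \<open>q\<close> is a sign, so it can be cancelled at the end.\<close>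
  have \<zeta>: "\<zeta> 0 \<in> forms F" "pairing GFs (\<zeta> 0) (\<zeta> 0) q \<noteq> 0"
    using V DIM_positive[where 'a = 'h] unfolding local_coframe_def by force+
  have "lam * pairing G (vl (\<zeta> 0)) (vl (\<zeta> 0)) (b, q) = Ric (vl (\<zeta> 0)) (vl (\<zeta> 0)) (b, q)"
    using lam[rule_format, OF vl_forms[OF \<zeta>(1)] vl_forms[OF \<zeta>(1)]] by simp
  also have "\<dots> = (\<Sum>j<DIM('h). \<kappa> j * pairing GFs (curvature F PF DF (\<zeta> 0) (\<zeta> j) (\<zeta> j)) (\<zeta> 0) q)"
    using Ric_eq[rule_format, OF prod_coframe[OF U(2) V(2)] vl_forms[OF \<zeta>(1)] vl_forms[OF \<zeta>(1)], of "(b, q)"]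
      U(1) V(1) ricci_vl[OF U(2) V(2) \<zeta>(1) \<zeta>(1), of "(b, q)"] by simp
  also have "\<dots> = RicF (\<zeta> 0) (\<zeta> 0) q"
    by (rule RicF_eq[rule_format, OF V(2) \<zeta>(1) \<zeta>(1) V(1), symmetric])
  also have "\<dots> = lamF * pairing GFs (\<zeta> 0) (\<zeta> 0) q" by (rule lamF[rule_format, OF \<zeta>(1) \<zeta>(1)])
  finally have "lam * k b = lamF"
    using \<zeta>(2) by (simp add: pairing_vl_vl[OF \<zeta>(1) \<zeta>(1)])
  then show ?thesis using f_pos[of b] by (auto simp: k_def)
qed

end

theorem theorem4p8:
  fixes B :: "('b::{t2_space, second_countable_topology}, 'e::euclidean_space) mfd"
    and F :: "('f::{t2_space, second_countable_topology}, 'h::euclidean_space) mfd"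
    and gB :: "('b, 'e) metric" and gF :: "('f, 'h) metric"
    and PB :: "('b, 'e) cobilinear" and PF :: "('f, 'h) cobilinear"
    and lam lamF :: real
  assumes "smooth_manifold B" and "smooth_manifold F"
    and "pseudo_riemannian_metric B gB" and "pseudo_riemannian_metric F gF"
    and "poisson_bivector B PB" and "poisson_bivector F PF"
    and "DIM('e) \<ge> 2"
    and "einstein_const F PF (cometric gF) lamF"
    and "lamF > 0"
  shows "(lam > 0 \<longrightarrow> (\<forall>f. warping_function B f \<and>
             einstein_poisson_warped_product B gB PB F gF PF f lam \<longrightarrow>
             (\<forall>b. f b = sqrt (lam / lamF)))) \<and>
         (lam < 0 \<longrightarrow> \<not> (\<exists>f. warping_function B f \<and>
             einstein_poisson_warped_product B gB PB F gF PF f lam))"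
proof -
  \<comment> \<open>The constants do not depend on \<open>b\<close>, so this relation and positivity
    determine \<open>f\<close> at every point.\<close>
  have key: "lam = lamF * (f b)\<^sup>2" "f b > 0"
    if "warping_function B f" "einstein_poisson_warped_product B gB PB F gF PF f lam" for f b
  proof -
    have E: "casimir B PB f"
      "einstein_const (prod_mfd B F) (prod_bivector PB PF) (cometric (warped_metric B gB F gF f)) lam"
      using that(2) unfolding einstein_poisson_warped_product_def Let_def by blast+
    interpret warped_product B F PB PF gB gF f
      using assms(1-6) that(1) E(1) by unfold_locales (auto simp: poisson_bivector_def)
    show "lam = lamF * (f b)\<^sup>2"
      by (rule einstein_constants[OF E(2)[folded W_def] assms(8)])
    show "f b > 0" by (rule f_pos)
  qed
  show ?thesis
  proof (intro conjI impI allI notI)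
    fix f b assume *: "warping_function B f \<and> einstein_poisson_warped_product B gB PB F gF PF f lam"
    then have "lam / lamF = (f b)\<^sup>2" using key(1)[of f b] assms(9) by simp
    then show "f b = sqrt (lam / lamF)" using key(2)[of f b] * by simp
  next
    assume "lam < 0" and "\<exists>f. warping_function B f \<and> einstein_poisson_warped_product B gB PB F gF PF f lam"
    \<comment> \<open>For positive \<open>lamF\<close> the relation makes \<open>lam\<close>
      nonnegative at any point of \<open>B\<close>.\<close>
    then show False using key(1) assms(9) by (metis mult_nonneg_nonneg not_less order_less_imp_le zero_le_power2)
  qed
qed

end
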